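(* For any $\beta,\gamma\in\mathbb{R}$ with $\beta^2+\gamma^2>0$ there exist $c_{\gamma,\beta}>0$, $\lambda>0$ and $\varepsilon_0>0$ such that for any $0<\varepsilon\le\varepsilon_0$ there exist real analytic functions $\Psi_\varepsilon\in C^\omega(\mathbb{S}^2)$ and $F_\varepsilon\in C^\omega(\mathbb{R})$ such that $$\Delta\Psi_\varepsilon-4\gamma Y_1^0=F_\varepsilon(\Psi_\varepsilon)\quad\text{on }\mathbb{S}^2$$ and $$\|\beta Y_2^0+\gamma Y_1^0-\Psi_\varepsilon\|_{\mathcal{G}_\lambda(\mathbb{S}^2)}=O(\varepsilon),$$ with $$\langle\Psi_\varepsilon,Y_6^2\rangle_{L^2(\mathbb{S}^2)}=-\beta^2\,\frac{1}{36}\,\frac{45}{11\pi\sqrt{182}}\,c_{\gamma,\beta}\,\varepsilon^2+O(\varepsilon^3),$$ $$\langle\Psi_\varepsilon,Y_4^2\rangle_{L^2(\mathbb{S}^2)}=-\frac{1}{14}\left(\frac{3\sqrt3}{154\pi}(11\gamma^2-5\beta^2)-\beta^2\frac{1}{7\pi}\frac{30\gamma^2}{7\gamma^2+15\beta^2}\right)c_{\gamma,\beta}\,\varepsilon^2+O(\varepsilon^3).$$ In particular, $\Psi_\varepsilon$ is non-zonal and non-trivial.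
   Context: $\mathbb{S}^2$ is the unit sphere with colatitude-longitude coordinates $(\theta,\varphi)\mapsto(\sin\theta\cos\varphi,\sin\theta\sin\varphi,\cos\theta)$, and $\Delta$ is its Laplace-Beltrami operator. The $O(\cdot)$ notation is as $\varepsilon\to0$, with constants independent of $\varepsilon$ (they may depend on $\beta,\gamma$). $\langle u,v\rangle_{L^2(\mathbb{S}^2)}=\int_{\mathbb{S}^2}uv\,d\mathbb{S}^2$, with $d\mathbb{S}^2=\sin\theta\,d\theta\,d\varphi$. Real spherical harmonics: for $n\ge0$, $|m|\le n$, $Y_n^0=\sqrt{\frac{2n+1}{4\pi}}P_n(\cos\theta)$, and for $m\ne0$, $Y_n^m=(-1)^m\sqrt2\sqrt{\frac{2n+1}{4\pi}\frac{(n-|m|)!}{(n+|m|)!}}\,P_n^{|m|}(\cos\theta)\,\tau_m(\varphi)$ with $\tau_m(\varphi)=\cos(m\varphi)$ if $m>0$ and $\tau_m(\varphi)=\sin(|m|\varphi)$ if $m<0$, where $P_n(s)=\frac{1}{2^nn!}\frac{d^n}{ds^n}(s^2-1)^n$ and $P_n^m(s)=(-1)^m(1-s^2)^{m/2}\frac{d^m}{ds^m}P_n(s)$ for $0<m\le n$. They form an orthonormal basis of $L^2(\mathbb{S}^2)$ and $-\Delta Y_n^m=\lambda_nY_n^m$, $\lambda_n=n(n+1)$. In particular $Y_1^0=\frac12\sqrt{\frac3\pi}\cos\theta$ and $Y_2^0=\frac14\sqrt{\frac5\pi}(3\cos^2\theta-1)$. Let $\mathbf{Y}_2=\mathrm{span}\{Y_2^m:|m|\le2\}$.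 Gevrey norm: with $\mu_n=\lambda_n+1$ and $u=\sum_{n,m}u_n^mY_n^m$, $\|u\|_{\mathcal{G}_\lambda}^2=\sum_{n\ge1}\sum_{|m|\le n}\mu_n^2e^{2\lambda\mu_n^{1/2}}|u_n^m|^2$. A function is zonal if it depends only on $\theta$. Non-trivial means not in the kernel of the Euler operator linearized about $\beta Y_2^0+\gamma Y_1^0$, that is, not the sum of a zonal function and an element of $\mathbf{Y}_2$; in particular, not a linear combination of spherical harmonics of eigenvalue $\lambda_2=6$. *)

theory Defs
  imports
    "HOL-Analysis.Analysis"
    "HOL-Computational_Algebra.Polynomial"
    "HOL-Library.Landau_Symbols"
begin

text \<open>
  Functions on the unit sphere are functions on \<^typ>\<open>real^3\<close> of which only the values on
  \<^term>\<open>sphere 0 1\<close> matter.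
\<close>

abbreviation S2 :: "(real^3) set" where
  "S2 \<equiv> sphere 0 1"

definition sph :: "real \<Rightarrow> real \<Rightarrow> real^3" where
  "sph \<theta> \<phi> = vector [sin \<theta> * cos \<phi>, sin \<theta> * sin \<phi>, cos \<theta>]"

definition l2_inner :: "(real^3 \<Rightarrow> real) \<Rightarrow> (real^3 \<Rightarrow> real) \<Rightarrow> real" where
  "l2_inner u v =
     (LINT p : {0..pi} \<times> {0..2 * pi} | lborel.
        u (sph (fst p) (snd p)) * v (sph (fst p) (snd p)) * sin (fst p))"

definition laplacian :: "(real^3 \<Rightarrow> real) \<Rightarrow> real^3 \<Rightarrow> real" where
  "laplacian g x = (\<Sum>b\<in>Basis. (deriv ^^ 2) (\<lambda>t. g (x + t *\<^sub>R b)) 0)"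

text \<open>
  The Laplace-Beltrami operator of the round sphere: in polar coordinates
  \<open>\<Delta>\<^bsub>R\<^sup>3\<^esub> = \<partial>\<^sub>r\<^sup>2 + (2/r) \<partial>\<^sub>r + r\<^sup>-\<^sup>2 \<Delta>\<^bsub>S2\<^esub>\<close>, so on the unit sphere
  it is the Euclidean Laplacian of the extension that is constant along rays. In contrast to the
  expression in the coordinates \<open>(\<theta>, \<phi>)\<close> this also covers the two poles.
\<close>

definition laplace_beltrami :: "(real^3 \<Rightarrow> real) \<Rightarrow> real^3 \<Rightarrow> real" where
  "laplace_beltrami u = laplacian (\<lambda>y. u (y /\<^sub>R norm y))"

text \<open>
  A function is real analytic on \<open>S\<close> if near each point of \<open>S\<close> it is the restriction of the sum of
  a convergent power series in the ambient coordinates (multi-indices are functions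
  \<^typ>\<open>'n \<Rightarrow> nat\<close>). For an analytic submanifold such as the sphere this is analyticity in
  analytic charts. The series has to converge on a full ball of the ambient space, not only on
  \<open>S\<close>.
\<close>

definition real_analytic_on :: "(real^'n \<Rightarrow> real) \<Rightarrow> (real^'n) set \<Rightarrow> bool" where
  "real_analytic_on f S \<longleftrightarrow>
     (\<forall>p\<in>S. \<exists>r>0. \<exists>(a :: ('n \<Rightarrow> nat) \<Rightarrow> real) g.
        (\<forall>x\<in>ball p r. ((\<lambda>\<alpha>. a \<alpha> * (\<Prod>i\<in>UNIV. (x $ i - p $ i) ^ \<alpha> i)) has_sum g x) UNIV) \<and>
        (\<forall>x\<in>S \<inter> ball p r. f x = g x))"

definition real_analytic :: "(real \<Rightarrow> real) \<Rightarrow> bool" where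
  "real_analytic F \<longleftrightarrow>
     (\<forall>p. \<exists>r>0. \<exists>a :: nat \<Rightarrow> real. \<forall>x\<in>ball p r. (\<lambda>n. a n * (x - p) ^ n) sums F x)"

definition legendre :: "nat \<Rightarrow> real poly" where
  "legendre n = smult (1 / (2 ^ n * fact n)) ((pderiv ^^ n) ([:-1, 0, 1:] ^ n))"

definition assoc_legendre :: "nat \<Rightarrow> nat \<Rightarrow> real \<Rightarrow> real" where
  "assoc_legendre n m s =
     (-1) ^ m * sqrt (1 - s\<^sup>2) ^ m * poly ((pderiv ^^ m) (legendre n)) s"

definition sph_harm_coord :: "nat \<Rightarrow> int \<Rightarrow> real \<Rightarrow> real \<Rightarrow> real" where
  "sph_harm_coord n m \<theta> \<phi> =
     (if m = 0 then sqrt ((2 * real n + 1) / (4 * pi)) * poly (legendre n) (cos \<theta>)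
      else (-1) ^ nat \<bar>m\<bar> * sqrt 2 *
           sqrt ((2 * real n + 1) / (4 * pi) * (fact (n - nat \<bar>m\<bar>) / fact (n + nat \<bar>m\<bar>))) *
           assoc_legendre n (nat \<bar>m\<bar>) (cos \<theta>) *
           (if m > 0 then cos (of_int m * \<phi>) else sin (of_int \<bar>m\<bar> * \<phi>)))"

text \<open>
  The spherical harmonics as functions on the sphere. The choice of the longitude is
  immaterial, also at the poles; see \<open>sph_harm_sph\<close> below.
\<close>

definition sph_harm :: "nat \<Rightarrow> int \<Rightarrow> real^3 \<Rightarrow> real" where
  "sph_harm n m x = sph_harm_coord n m (arccos (x $ 3)) (Arg (Complex (x $ 1) (x $ 2)))"

lemma sph_harm_sph:
  assumes "0 \<le> \<theta>" "\<theta> \<le> pi"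
  shows "sph_harm n m (sph \<theta> \<phi>) = sph_harm_coord n m \<theta> \<phi>"
proof -
  let ?z = "Complex (sin \<theta> * cos \<phi>) (sin \<theta> * sin \<phi>)"
  have *: "sph_harm n m (sph \<theta> \<phi>) = sph_harm_coord n m \<theta> (Arg ?z)"
    using assms by (simp add: sph_harm_def sph_def arccos_cos)
  show ?thesis
  proof (cases "sin \<theta> = 0")
    case True
    then have "(cos \<theta>)\<^sup>2 = 1"
      using sin_cos_squared_add[of \<theta>] by simp
    then show ?thesis
      unfolding * by (simp add: sph_harm_coord_def assoc_legendre_def zero_power)
  next
    case False
    then have pos: "sin \<theta> > 0"
      using assms by (simp add: sin_ge_zero less_le)
    have z: "?z = of_real (sin \<theta>) * cis \<phi>"
      by (simp add: complex_eq_iff)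
    have "cis (Arg ?z) = sgn ?z"
      unfolding z by (rule cis_Arg) (use pos in auto)
    also have "\<dots> = cis \<phi>"
      unfolding z using pos by (simp add: sgn_mult sgn_of_real)
    finally have "cis (real k * Arg ?z) = cis (real k * \<phi>)" for k
      by (metis Complex.DeMoivre)
    then have eq: "cos (real k * Arg ?z) = cos (real k * \<phi>)"
        "sin (real k * Arg ?z) = sin (real k * \<phi>)" for k
      by (simp_all add: complex_eq_iff)
    have "cos (of_int m * Arg ?z) = cos (of_int m * \<phi>)" if "m > 0"
      using eq(1)[of "nat m"] that by simp
    moreover have "sin (of_int \<bar>m\<bar> * Arg ?z) = sin (of_int \<bar>m\<bar> * \<phi>)"
      using eq(2)[of "nat \<bar>m\<bar>"] by simp
    ultimately show ?thesis
      unfolding * sph_harm_coord_def by (auto simp del: of_int_abs)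
  qed
qed

definition eigval :: "nat \<Rightarrow> real" where
  "eigval n = real n * (real n + 1)"

definition gevrey_weight :: "real \<Rightarrow> nat \<Rightarrow> real" where
  "gevrey_weight l n = (eigval n + 1)\<^sup>2 * exp (2 * l * sqrt (eigval n + 1))"

definition gevrey_index :: "(nat \<times> int) set" where
  "gevrey_index = {(n, m). 1 \<le> n \<and> \<bar>m\<bar> \<le> int n}"

text \<open>
  The series defining the norm ranges over \<open>n \<ge> 1\<close>, so the mean value does not contribute.
  \<^term>\<open>infsum\<close> yields 0 for a divergent series; finiteness of the norm is the
  separate predicate \<open>gevrey_finite\<close>.
\<close>

definition gevrey_finite :: "real \<Rightarrow> (real^3 \<Rightarrow> real) \<Rightarrow> bool" where
  "gevrey_finite l u \<longleftrightarrow>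
     (\<lambda>(n, m). gevrey_weight l n * \<bar>l2_inner u (sph_harm n m)\<bar>\<^sup>2) summable_on gevrey_index"

definition gevrey_norm :: "real \<Rightarrow> (real^3 \<Rightarrow> real) \<Rightarrow> real" where
  "gevrey_norm l u =
     sqrt (\<Sum>\<^sub>\<infinity>(n, m)\<in>gevrey_index. gevrey_weight l n * \<bar>l2_inner u (sph_harm n m)\<bar>\<^sup>2)"

definition zonal :: "(real^3 \<Rightarrow> real) \<Rightarrow> bool" where
  "zonal u \<longleftrightarrow> (\<exists>g. \<forall>\<theta>\<in>{0..pi}. \<forall>\<phi>. u (sph \<theta> \<phi>) = g \<theta>)"

definition Y2_space :: "(real^3 \<Rightarrow> real) set" where
  "Y2_space = {w. \<exists>a :: int \<Rightarrow> real. \<forall>x\<in>S2. w x = (\<Sum>m = -2..2. a m * sph_harm 2 m x)}"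

definition nontrivial :: "(real^3 \<Rightarrow> real) \<Rightarrow> bool" where
  "nontrivial u \<longleftrightarrow> \<not> (\<exists>z w. zonal z \<and> w \<in> Y2_space \<and> (\<forall>x\<in>S2. u x = z x + w x))"

end

theory Submission
  imports Defs
begin

text \<open>
  With \<open>F(s) = - 6 s + \<epsilon> f(s)\<close> and \<open>\<Psi> = \<Psi>\<^sub>0 + \<epsilon> \<psi>\<close> the equation becomes \<open>(\<Delta> + 6) \<psi> = f(\<Psi>\<^sub>0 + \<epsilon> \<psi>)\<close>.
  We look for \<open>\<psi>\<close> among the functions of \<open>z = x\<^sub>3\<close> and \<open>w = x\<^sub>1\<^sup>2 - x\<^sub>2\<^sup>2\<close>, so that the kernel of \<open>\<Delta> + 6\<close> is
  spanned by \<open>3 z\<^sup>2 - 1\<close> and \<open>w\<close>. On a monomial of degree \<open>n = i + 2 j\<close>,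
  \<open>\<Delta>(z\<^sup>i w\<^sup>j) = - n (n + 1) z\<^sup>i w\<^sup>j + lower order\<close>: in the Banach algebra of absolutely convergent power series in
  \<open>(z, w)\<close> on a large polydisc, \<open>\<Delta> + 6\<close> is triangular and has a bounded inverse up to the two resonant
  monomials \<open>z\<^sup>2\<close> and \<open>w\<close>. Splitting \<open>\<psi> = w + e + \<epsilon> ob\<close> into its parts even and odd in \<open>w\<close>, and solving the two
  resonance conditions for two coefficients of \<open>f\<close>, one is left with a contraction. The second order
  coefficients are those of the solution of \<open>(\<Delta> + 6) ob = f'(\<Psi>\<^sub>0) w\<close>; a quartic \<open>f\<close> has just enough freedom to
  satisfy the resonance conditions at \<open>\<epsilon> = 0\<close> and to prescribe both coefficients, whence \<open>c = 1\<close>.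
\<close>

text \<open>The term \<open>4 \<gamma> Y\<^sub>1\<^sup>0\<close> shifts the eigenvalue -2 of degree
  1 to -6, so that (\<Delta> + 6) \<Psi>0 = \<open>4 \<gamma> Y\<^sub>1\<^sup>0\<close> and the
  linear profile - 6 s fits \<Psi>0 exactly. Functions of (z, w) are closed under \<Delta>, because
  on the sphere \<Delta> z = - 2 z, \<Delta> w = - 6 w, |grad z|^2 = 1 - z^2, grad z . grad w = - 2
  z w and |grad w|^2 = 4 (1 - z^2) - 4 w^2. The obstacle is that \<Delta> is unbounded on the
  algebra of series. Its inverse, however, is bounded there, and so is composition with a polynomial
  f: the fixed point argument loses no derivatives, and \<Delta> itself occurs only together with
  evaluation at a point of the sphere. If \<beta> = 0, the coefficient of degree 6 cannot be
  prescribed, but then its target is 0 as well. Non-triviality comes from the same two coefficients: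
  a trivial \<Psi> forces \<open>ob\<close> to be a multiple of w along a meridian, whereas its
  limit is w times a non-constant function of z, since one of the two targets is non-zero.\<close>

section \<open>Absolutely summable power series over a commutative Banach algebra\<close>

class banach_calg = comm_ring_1 + real_normed_algebra_1 + banach

instance real :: banach_calg ..

text \<open>The coefficients come from a commutative Banach algebra and the type will be one again,
  so the construction nests: \<open>real ps ps\<close> holds the series in (z, w),
  \<open>real ps ps ps\<close> the local expansions in three ambient coordinates.\<close>

typedef (overloaded) 'a ps = "{f :: 'a::banach_calg fps. summable (\<lambda>n. norm (fps_nth f n))}"
  by (rule exI[of _ 0]) simp

setup_lifting type_definition_ps

lift_definition psc :: "'a::banach_calg ps \<Rightarrow> nat \<Rightarrow> 'a" is fps_nth .

lemma summable_psc: "summable (\<lambda>n. norm (psc f n))"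
  by transfer simp

lemma ps_eqI: "(\<And>n. psc f n = psc g n) \<Longrightarrow> f = g"
  by transfer (simp add: fps_ext)

instantiation ps :: (banach_calg) comm_ring_1
begin

lift_definition zero_ps :: "'a ps" is 0 by simp

lift_definition one_ps :: "'a ps" is 1
  by (rule summable_finite[of "{0}"]) auto

lift_definition plus_ps :: "'a ps \<Rightarrow> 'a ps \<Rightarrow> 'a ps" is plus
  by (rule summable_comparison_test'[OF summable_add, where N = 0], assumption, assumption)
    (simp add: norm_triangle_ineq)

lift_definition minus_ps :: "'a ps \<Rightarrow> 'a ps \<Rightarrow> 'a ps" is minus
  by (rule summable_comparison_test'[OF summable_add, where N = 0], assumption, assumption)
    (simp add: norm_triangle_ineq4)

lift_definition uminus_ps :: "'a ps \<Rightarrow> 'a ps" is uminus by simp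

lift_definition times_ps :: "'a ps \<Rightarrow> 'a ps \<Rightarrow> 'a ps" is times
proof -
  fix f g :: "'a fps"
  assume f: "summable (\<lambda>n. norm (fps_nth f n))" and g: "summable (\<lambda>n. norm (fps_nth g n))"
  have "summable (\<lambda>n. \<Sum>i\<le>n. norm (fps_nth f i) * norm (fps_nth g (n - i)))"
    by (rule summable_Cauchy_product) (use f g in simp_all)
  then show "summable (\<lambda>n. norm (fps_nth (f * g) n))"
  proof (rule summable_comparison_test')
    fix n
    show "norm (norm (fps_nth (f * g) n)) \<le> (\<Sum>i\<le>n. norm (fps_nth f i) * norm (fps_nth g (n - i)))"
      by (auto simp: fps_mult_nth atLeast0AtMost
          intro!: order_trans[OF norm_sum] sum_mono norm_mult_ineq)
  qed
qed

instance
proof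
  fix a b c :: "'a ps"
  show "a * b * c = a * (b * c)" by transfer (simp add: mult.assoc)
  show "a * b = b * a" by transfer (simp add: mult.commute)
  show "1 * a = a" by transfer simp
  show "a + b + c = a + (b + c)" by transfer (simp add: add.assoc)
  show "a + b = b + a" by transfer (simp add: add.commute)
  show "0 + a = a" by transfer simp
  show "- a + a = 0" by transfer simp
  show "a - b = a + - b" by transfer simp
  show "(a + b) * c = a * c + b * c" by transfer (simp add: distrib_right)
  show "(0::'a ps) \<noteq> 1" by transfer simp
qed

end

lemma psc_simps [simp]:
  "psc 0 n = 0" "psc 1 n = (if n = 0 then 1 else 0)"
  "psc (f + g) n = psc f n + psc g n" "psc (f - g) n = psc f n - psc g n"
  "psc (- f) n = - psc f n"
  by (transfer; simp)+

lemma psc_mult: "psc (f * g) n = (\<Sum>i\<le>n. psc f i * psc g (n - i))"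
  by transfer (simp add: fps_mult_nth atLeast0AtMost)

instantiation ps :: (banach_calg) real_vector
begin

lift_definition scaleR_ps :: "real \<Rightarrow> 'a ps \<Rightarrow> 'a ps" is
  "\<lambda>r f. Abs_fps (\<lambda>n. r *\<^sub>R fps_nth f n)"
  by (simp add: summable_mult)

lemma psc_scaleR [simp]: "psc (r *\<^sub>R f) n = r *\<^sub>R psc f n"
  by transfer simp

instance
proof
  fix f g :: "'a ps" and r s :: real
  show "r *\<^sub>R (f + g) = r *\<^sub>R f + r *\<^sub>R g" by (rule ps_eqI) (simp add: scaleR_add_right)
  show "(r + s) *\<^sub>R f = r *\<^sub>R f + s *\<^sub>R f" by (rule ps_eqI) (simp add: scaleR_add_left)
  show "r *\<^sub>R s *\<^sub>R f = (r * s) *\<^sub>R f" by (rule ps_eqI) simp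
  show "1 *\<^sub>R f = f" by (rule ps_eqI) simp
qed

end

instantiation ps :: (banach_calg) real_normed_algebra_1
begin

definition "norm f = (\<Sum>n. norm (psc f n))" for f :: "'a ps"
definition "dist f g = norm (f - g)" for f g :: "'a ps"
definition "sgn f = inverse (norm f) *\<^sub>R f" for f :: "'a ps"
definition "uniformity = (INF e\<in>{0<..}. principal {(x, y :: 'a ps). dist x y < e})"
definition "open U = (\<forall>x\<in>U. eventually (\<lambda>(x', y). x' = x \<longrightarrow> y \<in> U) uniformity)" for U :: "'a ps set"

instance
proof
  fix f g :: "'a ps" and r s :: real
  show "dist f g = norm (f - g)" by (fact dist_ps_def)
  show "sgn f = f /\<^sub>R norm f" by (fact sgn_ps_def)
  show "uniformity = (INF e\<in>{0<..}. principal {(x, y :: 'a ps). dist x y < e})"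
    by (fact uniformity_ps_def)
  show "open U = (\<forall>x\<in>U. eventually (\<lambda>(x', y). x' = x \<longrightarrow> y \<in> U) uniformity)" for U :: "'a ps set"
    by (fact open_ps_def)
  show "(norm f = 0) = (f = 0)"
    using suminf_eq_zero_iff[OF summable_psc[of f]] ps_eqI[of f 0] by (auto simp: norm_ps_def)
  show "norm (f + g) \<le> norm f + norm g"
    unfolding norm_ps_def suminf_add[OF summable_psc summable_psc]
    by (intro suminf_le summable_add summable_psc) (simp add: norm_triangle_ineq)
  show "norm (r *\<^sub>R f) = \<bar>r\<bar> * norm f"
    by (simp add: norm_ps_def suminf_mult summable_psc)
  show "r *\<^sub>R f * g = r *\<^sub>R (f * g)"
    by (rule ps_eqI) (simp add: psc_mult scaleR_sum_right)
  show "f * r *\<^sub>R g = r *\<^sub>R (f * g)"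
    by (rule ps_eqI) (simp add: psc_mult scaleR_sum_right)
  show "norm (1 :: 'a ps) = 1"
    using suminf_finite[of "{0}" "\<lambda>n. norm (psc (1 :: 'a ps) n)"] by (simp add: norm_ps_def)
  have P: "summable (\<lambda>n. \<Sum>i\<le>n. norm (psc f i) * norm (psc g (n - i)))"
    by (rule summable_Cauchy_product) (simp_all add: summable_psc)
  have "norm (f * g) \<le> (\<Sum>n. \<Sum>i\<le>n. norm (psc f i) * norm (psc g (n - i)))"
    unfolding norm_ps_def
    by (intro suminf_le P summable_psc)
      (auto simp: psc_mult intro!: order_trans[OF norm_sum] sum_mono norm_mult_ineq)
  also have "\<dots> = norm f * norm g"
    unfolding norm_ps_def by (rule Cauchy_product [symmetric]) (simp_all add: summable_psc)
  finally show "norm (f * g) \<le> norm f * norm g" .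
qed

end

lemma sum_norm_psc_le: "finite A \<Longrightarrow> (\<Sum>n\<in>A. norm (psc f n)) \<le> norm f"
  unfolding norm_ps_def by (rule sum_le_suminf) (simp_all add: summable_psc)

lemma norm_psc_le: "norm (psc f n) \<le> norm f"
  using sum_norm_psc_le[of "{n}" f] by simp

lemma bounded_linear_psc: "bounded_linear (\<lambda>f. psc f n)"
  by (rule bounded_linear_intro[of _ 1]) (simp_all add: norm_psc_le)

lemma norm_ps_boundI:
  fixes g :: "'a::banach_calg fps"
  assumes "\<And>N. (\<Sum>n<N. norm (fps_nth g n)) \<le> B"
  shows "summable (\<lambda>n. norm (fps_nth g n))" "norm (Abs_ps g) \<le> B"
proof -
  show s: "summable (\<lambda>n. norm (fps_nth g n))"
    using assms by (intro summableI_nonneg_bounded[of _ B]) auto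
  have "psc (Abs_ps g) = fps_nth g"
    using s by (simp add: psc.rep_eq Abs_ps_inverse)
  then show "norm (Abs_ps g) \<le> B"
    using s assms by (simp add: norm_ps_def suminf_le_const)
qed

text \<open>Completeness of l1: the candidate is the coefficientwise limit, and Cauchy bounds on
  finite sets of coefficients pass to it.\<close>

instance ps :: (banach_calg) banach
proof
  fix X :: "nat \<Rightarrow> 'a ps"
  assume X: "Cauchy X"
  have "Cauchy (\<lambda>m. psc (X m) n)" for n
    by (rule bounded_linear.Cauchy[OF bounded_linear_psc X])
  then have lim: "(\<lambda>m. psc (X m) n) \<longlonglongrightarrow> lim (\<lambda>m. psc (X m) n)" for n
    by (simp add: Cauchy_convergent_iff convergent_LIMSEQ_iff)
  define g where "g = Abs_fps (\<lambda>n. lim (\<lambda>m. psc (X m) n))"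
  \<comment> \<open>Only finitely many coefficients are involved, so the bound survives k to
    infinity. The bound 1 then makes \<open>g\<close> summable, the bound e / 2 gives convergence in
    norm.\<close>
  have le: "(\<Sum>n<N. norm (psc (X m) n - fps_nth g n)) \<le> e"
    if "\<And>k. k \<ge> M \<Longrightarrow> norm (X m - X k) \<le> e" for N e m M
  proof (rule Lim_bounded)
    show "(\<lambda>k. \<Sum>n<N. norm (psc (X m) n - psc (X k) n)) \<longlonglongrightarrow>
        (\<Sum>n<N. norm (psc (X m) n - fps_nth g n))"
      unfolding g_def fps_nth_Abs_fps by (intro tendsto_sum tendsto_norm tendsto_diff tendsto_const lim)
    show "\<forall>k\<ge>M. (\<Sum>n<N. norm (psc (X m) n - psc (X k) n)) \<le> e"
      using that sum_norm_psc_le[of "{..<N}" "X m - X _"] by (auto intro: order_trans)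
  qed
  have C: "\<exists>M. \<forall>m\<ge>M. \<forall>k\<ge>M. norm (X m - X k) \<le> e" if "e > 0" for e
    using CauchyD[OF X that] by (meson less_imp_le)
  obtain M where M: "\<And>m k. m \<ge> M \<Longrightarrow> k \<ge> M \<Longrightarrow> norm (X m - X k) \<le> 1"
    using C[of 1] by auto
  have "summable (\<lambda>n. norm (fps_nth (Rep_ps (X M) - g) n))"
    by (rule norm_ps_boundI(1)[of _ 1]) (use le[OF M] in \<open>simp add: psc.rep_eq\<close>)
  then have "summable (\<lambda>n. norm (fps_nth (Rep_ps (X M)) n) + norm (fps_nth (Rep_ps (X M) - g) n))"
    using summable_psc[of "X M"] by (intro summable_add) (simp_all add: psc.rep_eq)
  then have "summable (\<lambda>n. norm (fps_nth g n))"
  proof (rule summable_comparison_test')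
    show "norm (norm (fps_nth g n)) \<le>
        norm (fps_nth (Rep_ps (X M)) n) + norm (fps_nth (Rep_ps (X M) - g) n)" for n
      using norm_triangle_ineq4[of "fps_nth (Rep_ps (X M)) n" "fps_nth (Rep_ps (X M) - g) n"] by simp
  qed
  then have g: "psc (Abs_ps g) n = fps_nth g n" for n
    by (simp add: psc.rep_eq Abs_ps_inverse)
  have "\<exists>M. \<forall>m\<ge>M. norm (X m - Abs_ps g) < e" if "e > 0" for e
  proof -
    obtain M where M: "\<And>m k. m \<ge> M \<Longrightarrow> k \<ge> M \<Longrightarrow> norm (X m - X k) \<le> e / 2"
      using C[OF half_gt_zero[OF \<open>e > 0\<close>]] by blast
    have *: "norm (X m - Abs_ps g) \<le> e / 2" if "m \<ge> M" for m
      unfolding norm_ps_def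
      by (rule suminf_le_const[OF summable_psc]) (use le[OF M[OF that]] in \<open>simp add: g\<close>)
    show ?thesis
    proof (intro exI[of _ M] allI impI)
      show "norm (X m - Abs_ps g) < e" if "m \<ge> M" for m
        using *[OF that] \<open>e > 0\<close> by simp
    qed
  qed
  then have "X \<longlonglongrightarrow> Abs_ps g" by (simp add: LIMSEQ_iff)
  then show "convergent X" by (auto simp: convergent_def)
qed

instance ps :: (banach_calg) banach_calg ..

lift_definition psm :: "nat \<Rightarrow> 'a \<Rightarrow> 'a::banach_calg ps" is
  "\<lambda>n a. Abs_fps (\<lambda>k. if k = n then a else 0)"
  by (rule summable_finite[of "{_}"]) auto

lemma psc_psm: "psc (psm n a) k = (if k = n then a else 0)"
  by transfer simp

lemma norm_psm: "norm (psm n a) = norm a"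
  using suminf_finite[of "{n}" "\<lambda>k. norm (psc (psm n a) k)"] by (simp add: norm_ps_def psc_psm)

lemma bounded_linear_psm: "bounded_linear (psm n)"
  by (rule bounded_linear_intro[of _ 1]) (auto intro!: ps_eqI simp: psc_psm norm_psm)

lemma psm_mult: "psm n a * psm m b = psm (n + m) (a * b)"
proof (rule ps_eqI)
  fix k
  have "(\<Sum>i\<le>k. (if i = n then a else 0) * (if k - i = m then b else 0)) =
      (\<Sum>i\<le>k. if i = n then (if k - n = m then a * b else 0) else 0)"
    by (intro sum.cong) auto
  also have "\<dots> = (if k = n + m then a * b else 0)"
    by (subst sum.delta) auto
  finally show "psc (psm n a * psm m b) k = psc (psm (n + m) (a * b)) k"
    by (simp add: psc_mult psc_psm)
qed

lemma psm_sums: "(\<lambda>n. psm n (psc f n)) sums f"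
proof -
  have "psc (\<Sum>n<N. psm n (psc f n)) k = (if k < N then psc f k else 0)" for N k
    using sum.delta'[of "{..<N}" k "\<lambda>n. psc f n"]
    by (simp add: linear_sum[OF bounded_linear.linear[OF bounded_linear_psc]] psc_psm)
  then have L: "(\<lambda>N. psc (\<Sum>n<N. psm n (psc f n)) k) \<longlonglongrightarrow> psc f k" for k
    by (intro tendsto_eventually eventually_mono[OF eventually_gt_at_top[of k]]) simp
 have "summable (\<lambda>n. norm (psm n (psc f n)))"
    by (simp add: norm_psm summable_psc)
  then have S: "summable (\<lambda>n. psm n (psc f n))"
    by (rule summable_norm_cancel)
  have "psc (\<Sum>n. psm n (psc f n)) k = psc f k" for k
    using bounded_linear.tendsto[OF bounded_linear_psc summable_LIMSEQ[OF S]] L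
    by (rule LIMSEQ_unique)
  then have "(\<Sum>n. psm n (psc f n)) = f" by (rule ps_eqI)
  with S show ?thesis by (simp add: sums_iff)
qed

text \<open>The universal property of an l1 sum: operators on the single coefficients with a common
  bound assemble to one operator with the same bound.\<close>

definition psl :: "(nat \<Rightarrow> 'a \<Rightarrow> 'b) \<Rightarrow> 'a::banach_calg ps \<Rightarrow> 'b::banach" where
  "psl T f = (\<Sum>n. T n (psc f n))"

context
  fixes T :: "nat \<Rightarrow> 'a::banach_calg \<Rightarrow> 'b::banach" and C :: real
  assumes T: "\<And>n. bounded_linear (T n)" and bound: "\<And>n a. norm (T n a) \<le> C * norm a"
begin

lemma summable_psl: "summable (\<lambda>n. norm (T n (psc f n)))"
  by (rule summable_comparison_test'[OF summable_mult[OF summable_psc, of C f]]) (simp add: bound)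

lemma sums_psl: "(\<lambda>n. T n (psc f n)) sums psl T f"
  unfolding psl_def by (intro summable_sums summable_norm_cancel[OF summable_psl])

lemma norm_psl_le: "norm (psl T f) \<le> C * norm f"
proof -
  have "norm (psl T f) \<le> (\<Sum>n. norm (T n (psc f n)))"
    unfolding psl_def by (rule summable_norm[OF summable_psl])
  also have "\<dots> \<le> (\<Sum>n. C * norm (psc f n))"
    by (intro suminf_le summable_psl summable_mult summable_psc bound)
  also have "\<dots> = C * norm f"
    by (simp add: norm_ps_def suminf_mult summable_psc)
  finally show ?thesis .
qed

lemma bounded_linear_psl: "bounded_linear (psl T)"
proof (rule bounded_linear_intro[of _ C])
  interpret T: bounded_linear "T n" for n by (fact T)
  show "psl T (f + g) = psl T f + psl T g" for f g
    using sums_add[OF sums_psl[of f] sums_psl[of g]] by (intro sums_unique2[OF sums_psl]) (simp add: T.add)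
  show "psl T (r *\<^sub>R f) = r *\<^sub>R psl T f" for r f
    using sums_scaleR_right[OF sums_psl[of f], of r] by (intro sums_unique2[OF sums_psl]) (simp add: T.scaleR)
  show "norm (psl T f) \<le> norm f * C" for f
    using norm_psl_le[of f] by (simp add: mult.commute)
qed

lemma psl_psm: "psl T (psm n a) = T n a"
proof -
  have "(\<lambda>k. T k (psc (psm n a) k)) = (\<lambda>k. if k = n then T k a else 0)"
    using linear_0[OF bounded_linear.linear[OF T]] by (auto simp: psc_psm)
  then have "(\<lambda>k. T k (psc (psm n a) k)) sums T n a"
    using sums_single[of n "\<lambda>k. T k a"] by simp
  then show ?thesis
    using sums_psl sums_unique2 by blast
qed

end

text \<open>Monomials span a dense subspace. Most identities below are proved by comparing two
  bounded linear maps on monomials in this way.\<close>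

lemma bounded_linear_eq_psI:
  fixes S T :: "'a::banach_calg ps \<Rightarrow> 'b::real_normed_vector"
  assumes S: "bounded_linear S" and T: "bounded_linear T"
    and "\<And>n a. S (psm n a) = T (psm n a)"
  shows "S f = T f"
proof -
  have "(\<lambda>n. S (psm n (psc f n))) sums S f" "(\<lambda>n. T (psm n (psc f n))) sums T f"
    using bounded_linear.sums[OF _ psm_sums] S T by blast+
  with assms(3) show ?thesis by (simp add: sums_unique2)
qed

subsection \<open>Two variables\<close>

text \<open>The inner variable has exponent \<open>i\<close> and the outer one exponent
  \<open>j\<close>; the coefficient of \<open>pe i j\<close> in \<open>u\<close> is thus
  \<open>psc (psc u j) i\<close>.\<close>

definition pe :: "nat \<Rightarrow> nat \<Rightarrow> real ps ps" where
  "pe i j = psm j (psm i 1)"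

lemma pe_mult: "pe i j * pe k l = pe (i + k) (j + l)"
  by (simp add: pe_def psm_mult)

lemma pe_0: "pe 0 0 = 1"
  by (auto simp: pe_def psc_psm intro!: ps_eqI)

lemma norm_pe: "norm (pe i j) = 1"
  by (simp add: pe_def norm_psm)

lemma bounded_linear_eq_peI:
  fixes S T :: "real ps ps \<Rightarrow> 'b::real_normed_vector"
  assumes S: "bounded_linear S" and T: "bounded_linear T"
    and *: "\<And>i j. S (pe i j) = T (pe i j)"
  shows "S f = T f"
proof (rule bounded_linear_eq_psI[OF S T])
  fix n a
  show "S (psm n a) = T (psm n a)"
  proof (rule bounded_linear_eq_psI[where f = a])
    show "bounded_linear (\<lambda>a. S (psm n a))" "bounded_linear (\<lambda>a. T (psm n a))"
      by (intro bounded_linear_compose[OF S] bounded_linear_compose[OF T] bounded_linear_psm)+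
    fix m and r :: real
    have "psm n (psm m r) = r *\<^sub>R pe m n"
      by (auto simp: pe_def psc_psm intro!: ps_eqI)
    then show "S (psm n (psm m r)) = T (psm n (psm m r))"
      by (simp add: * linear_scale bounded_linear.linear S T)
  qed
qed

definition lin2 :: "(nat \<Rightarrow> nat \<Rightarrow> 'b) \<Rightarrow> real ps ps \<Rightarrow> 'b::banach" where
  "lin2 c = psl (\<lambda>j. psl (\<lambda>i r. r *\<^sub>R c i j))"

context
  fixes c :: "nat \<Rightarrow> nat \<Rightarrow> 'b::banach" and C :: real
  assumes c: "\<And>i j. norm (c i j) \<le> C"
begin

lemma lin2_aux:
  "bounded_linear (\<lambda>r::real. r *\<^sub>R c i j)" "norm (r *\<^sub>R c i j) \<le> C * norm r"
  using mult_right_mono[OF c[of i j], of "\<bar>r\<bar>"] by (auto intro: bounded_linear_scaleR_left simp: mult.commute)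

lemma bounded_linear_lin2: "bounded_linear (lin2 c)"
  unfolding lin2_def
  by (intro bounded_linear_psl[where C = C] norm_psl_le lin2_aux)

lemma norm_lin2_le: "norm (lin2 c f) \<le> C * norm f"
  unfolding lin2_def
  by (intro bounded_linear_psl[where C = C] norm_psl_le lin2_aux)

lemma lin2_pe: "lin2 c (pe i j) = c i j"
proof -
  have "psl (\<lambda>i r. r *\<^sub>R c i j) (psm i 1) = c i j"
    by (subst psl_psm[where C = C]) (auto intro: lin2_aux(1) lin2_aux(2)[simplified])
  then show ?thesis
    unfolding lin2_def pe_def
    by (subst psl_psm[where C = C])
      (auto intro!: bounded_linear_psl[where C = C] norm_psl_le lin2_aux(1) lin2_aux(2)[simplified])
qed

end

text \<open>Substitution of two elements of norm at most 1 of any Banach algebra. It serves three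
  times: reals give evaluation, the algebra itself gives the reflection \<open>flip\<close>, and
  series in three variables give the re-expansion about a point of the sphere.\<close>

definition hom2 :: "'b \<Rightarrow> 'b \<Rightarrow> real ps ps \<Rightarrow> 'b::banach_calg" where
  "hom2 x y = lin2 (\<lambda>i j. x ^ i * y ^ j)"

lemma norm_monom_le:
  fixes x y :: "'b::banach_calg"
  assumes "norm x \<le> 1" "norm y \<le> 1"
  shows "norm (x ^ i * y ^ j) \<le> 1"
proof -
  have "norm (x ^ i * y ^ j) \<le> norm x ^ i * norm y ^ j"
    by (intro order_trans[OF norm_mult_ineq] mult_mono norm_power_ineq) auto
  also have "\<dots> \<le> 1"
    using assms by (simp add: mult_le_one power_le_one)
  finally show ?thesis .
qed

context
  fixes x y :: "'b::banach_calg"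
  assumes x: "norm x \<le> 1" and y: "norm y \<le> 1"
begin

lemma bounded_linear_hom2: "bounded_linear (hom2 x y)"
  unfolding hom2_def by (rule bounded_linear_lin2[OF norm_monom_le[OF x y]])

lemma norm_hom2_le: "norm (hom2 x y f) \<le> norm f"
  using norm_lin2_le[OF norm_monom_le[OF x y], where f = f] unfolding hom2_def by simp

lemma hom2_pe: "hom2 x y (pe i j) = x ^ i * y ^ j"
  unfolding hom2_def by (rule lin2_pe[OF norm_monom_le[OF x y]])

lemma hom2_mult: "hom2 x y (f * g) = hom2 x y f * hom2 x y g"
proof -
  note B = bounded_linear_hom2
  have 1: "hom2 x y (pe i j * g) = hom2 x y (pe i j) * hom2 x y g" for i j g
  proof (rule bounded_linear_eq_peI[where f = g])
    show "bounded_linear (\<lambda>g. hom2 x y (pe i j * g))"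
      by (rule bounded_linear_compose[OF B bounded_linear_mult_right])
    show "bounded_linear (\<lambda>g. hom2 x y (pe i j) * hom2 x y g)"
      by (rule bounded_linear_compose[OF bounded_linear_mult_right B])
  qed (simp add: pe_mult hom2_pe power_add algebra_simps)
  show ?thesis
  proof (rule bounded_linear_eq_peI[where f = f])
    show "bounded_linear (\<lambda>f. hom2 x y (f * g))"
      by (rule bounded_linear_compose[OF B bounded_linear_mult_left])
    show "bounded_linear (\<lambda>f. hom2 x y f * hom2 x y g)"
      by (rule bounded_linear_compose[OF bounded_linear_mult_left B])
  qed (fact 1)
qed

lemma hom2_1: "hom2 x y 1 = 1"
  using hom2_pe[of 0 0] by (simp add: pe_0)

end

text \<open>
  \<open>ze i j\<close> stands for \<open>z\<^sup>i w\<^sup>j\<close> in the algebra with radii \<open>100\<close> and \<open>100\<^sup>2\<close>; \<open>pe i j\<close> is the same monomial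
  normalised to norm 1. The radii have to beat the crude bound \<open>10\<^sup>n\<close> for spherical harmonics of degree \<open>n\<close>
  used for the Gevrey norm.
\<close>

definition ze :: "nat \<Rightarrow> nat \<Rightarrow> real ps ps" where
  "ze i j = (100 ^ i * 10000 ^ j) *\<^sub>R pe i j"

abbreviation (input) wt :: "nat \<Rightarrow> nat \<Rightarrow> real" where
  "wt i j \<equiv> 100 ^ i * 10000 ^ j"

lemma norm_ze: "norm (ze i j) = wt i j"
  by (simp add: ze_def norm_pe)

lemma ze_mult: "ze i j * ze k l = ze (i + k) (j + l)"
  by (simp add: ze_def pe_mult power_add mult_ac)

lemma ze_0: "ze 0 0 = 1"
  by (simp add: ze_def pe_0)

lemma bounded_linear_eq_zeI:
  fixes S T :: "real ps ps \<Rightarrow> 'b::real_normed_vector"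
  assumes S: "bounded_linear S" and T: "bounded_linear T"
    and *: "\<And>i j. S (ze i j) = T (ze i j)"
  shows "S f = T f"
proof (rule bounded_linear_eq_peI[OF S T])
  fix i j
  have "pe i j = (1 / wt i j) *\<^sub>R ze i j"
    by (simp add: ze_def)
  then show "S (pe i j) = T (pe i j)"
    by (simp add: * linear_scale bounded_linear.linear S T)
qed

definition linz :: "(nat \<Rightarrow> nat \<Rightarrow> 'b) \<Rightarrow> real ps ps \<Rightarrow> 'b::banach" where
  "linz c = lin2 (\<lambda>i j. (1 / wt i j) *\<^sub>R c i j)"

context
  fixes c :: "nat \<Rightarrow> nat \<Rightarrow> 'b::banach" and C :: real
  assumes c: "\<And>i j. norm (c i j) \<le> C * wt i j"
begin

lemma linz_aux: "norm ((1 / wt i j) *\<^sub>R c i j) \<le> C"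
  using c[of i j] by (simp add: field_simps)

lemma bounded_linear_linz: "bounded_linear (linz c)"
  unfolding linz_def by (rule bounded_linear_lin2[OF linz_aux])

lemma norm_linz_le: "norm (linz c f) \<le> C * norm f"
  unfolding linz_def by (rule norm_lin2_le[OF linz_aux])

lemma linz_ze: "linz c (ze i j) = c i j"
  unfolding ze_def
  by (simp add: linear_scale bounded_linear.linear[OF bounded_linear_linz])
    (simp add: linz_def lin2_pe[OF linz_aux])

end

subsection \<open>Inverting the triangular operator\<close>

text \<open>The eigenvalue of \<Delta> + 6 on spherical harmonics of degree \<open>n\<close>, which
  is also the diagonal entry of the triangular operator.\<close>

definition dd :: "nat \<Rightarrow> real" where
  "dd n = 6 - real n * (real n + 1)"

text \<open>Off the resonance the diagonal stays away from 0 and dominates the coefficients of the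
  lower-order terms, which are quadratic in the degree. This is why inversion is bounded.\<close>

lemma dd_bounds:
  assumes "n \<noteq> 2"
  shows "\<bar>dd n\<bar> \<ge> 4" "real n * (real n - 1) \<le> 2 * \<bar>dd n\<bar>"
proof -
  consider "n = 0" | "n = 1" | "n \<ge> 3" using assms by linarith
  then have "\<bar>dd n\<bar> \<ge> 4 \<and> real n * (real n - 1) \<le> 2 * \<bar>dd n\<bar>"
  proof cases
    case 3
    then have *: "real n \<ge> 3" by simp
    then have "real n * real n \<ge> 3 * real n" by (intro mult_right_mono) auto
    with * have "real n * (real n + 1) \<ge> 12" "real n * (real n - 1) \<le> 2 * (real n * (real n + 1) - 6)"
      unfolding distrib_left right_diff_distrib by linarith+
    then show ?thesis by (simp add: dd_def)
  qed (auto simp: dd_def)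
  then show "\<bar>dd n\<bar> \<ge> 4" "real n * (real n - 1) \<le> 2 * \<bar>dd n\<bar>" by auto
qed

text \<open>
  The recursion inverts \<open>\<Delta> + 6\<close> on monomials by descending in the degree \<open>i + 2 j\<close>. It stops at degree 2, where
  \<open>dd\<close> vanishes; the coefficients that get stuck there are recorded by \<open>r1\<close> (for \<open>z\<^sup>2\<close>) and \<open>r2\<close> (for \<open>w\<close>) below.
\<close>

function tri :: "(nat \<Rightarrow> nat \<Rightarrow> 'b) \<Rightarrow> nat \<Rightarrow> nat \<Rightarrow> 'b::real_normed_vector" where
  "tri b i j = b i j -
    (if i + 2 * j = 2 then 0 else (1 / dd (i + 2 * j)) *\<^sub>R
      ((if i < 2 then 0 else (real i * (real i - 1)) *\<^sub>R tri b (i - 2) j) +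
       (if j < 2 then 0 else (4 * real j * (real j - 1)) *\<^sub>R (tri b i (j - 2) - tri b (i + 2) (j - 2)))))"
  by auto
termination
  by (relation "Wellfounded.measure (\<lambda>(b, i, j). i + 2 * j)") auto

declare tri.simps [simp del]

text \<open>Each descent step gains from the radii: replacing (i, j) by (i - 2, j) or (i + 2, j - 2)
  divides the weight by 10^4, by (i, j - 2) even by 10^8. After division by \<open>dd\<close> the
  corrections amount to at most 2/1000 of the weight, which fits into the half left free by the
  bound on \<open>b\<close>.\<close>

lemma norm_tri_le:
  assumes b: "\<And>i j. norm (b i j) \<le> wt i j / 2"
  shows "norm (tri b i j) \<le> wt i j"
proof (induction "i + 2 * j" arbitrary: i j rule: less_induct)
  case less
  let ?n = "i + 2 * j"
  show ?case
  proof (cases "?n = 2")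
    case True
    then have "norm (tri b i j) = norm (b i j)"
      by (subst tri.simps) simp
    also have "\<dots> \<le> wt i j / 2" by (rule b)
    also have "\<dots> \<le> wt i j" by simp
    finally show ?thesis .
  next
    case False
    let ?X = "if i < 2 then 0 else (real i * (real i - 1)) *\<^sub>R tri b (i - 2) j"
    let ?Y = "if j < 2 then 0 else (4 * real j * (real j - 1)) *\<^sub>R (tri b i (j - 2) - tri b (i + 2) (j - 2))"
    have X: "norm ?X \<le> real i * (real i - 1) * (wt i j / 10000)"
    proof (cases "i < 2")
      case True
      then have "i = 0 \<or> i = 1" by auto
      then show ?thesis by auto
    next
      case False
      then have "wt i j = 10000 * wt (i - 2) j"
        by (simp add: power_diff power2_eq_square field_simps)
      with False less[of "i - 2" j] show ?thesis
        by (auto simp: abs_mult intro!: mult_left_mono)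
    qed
    have Y: "norm ?Y \<le> 4 * real j * (real j - 1) * (wt i j / 1000)"
    proof (cases "j < 2")
      case True
      then have "j = 0 \<or> j = 1" by auto
      then show ?thesis by auto
    next
      case False
      have eq: "wt i j = 10 ^ 8 * wt i (j - 2)" "wt (i + 2) (j - 2) = 10000 * wt i (j - 2)"
        using False by (simp_all add: power_diff power2_eq_square power_add field_simps)
      have "norm (tri b i (j - 2) - tri b (i + 2) (j - 2)) \<le> wt i (j - 2) + wt (i + 2) (j - 2)"
        using False by (intro order_trans[OF norm_triangle_ineq4] add_mono less) auto
      also have "\<dots> \<le> wt i j / 1000"
        unfolding eq by simp
      finally show ?thesis
        using False by (auto simp: abs_mult intro!: mult_left_mono)
    qed
    have "norm (tri b i j) \<le> norm (b i j) + 1 / \<bar>dd ?n\<bar> * (norm ?X + norm ?Y)"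
      using False
      by (subst tri.simps)
        (auto intro!: order_trans[OF norm_triangle_ineq4] mult_left_mono order_trans[OF norm_triangle_ineq] divide_right_mono)
    also have "\<dots> \<le> wt i j / 2 + 1 / \<bar>dd ?n\<bar> * (real ?n * (real ?n - 1) * (wt i j / 1000))"
    proof (intro add_mono b mult_left_mono)
      have "norm ?X + norm ?Y \<le>
          real i * (real i - 1) * (wt i j / 10000) + 4 * real j * (real j - 1) * (wt i j / 1000)"
        by (rule add_mono[OF X Y])
      also have "\<dots> \<le> real i * (real i - 1) * (wt i j / 1000) + 4 * real j * (real j - 1) * (wt i j / 1000)"
        by (cases i) (auto intro!: mult_left_mono)
      also have "\<dots> = (real i * (real i - 1) + 4 * real j * (real j - 1)) * (wt i j / 1000)"
        by (simp only: distrib_right)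
      also have "\<dots> \<le> real ?n * (real ?n - 1) * (wt i j / 1000)"
        by (intro mult_right_mono) (auto simp: algebra_simps)
      finally show "norm ?X + norm ?Y \<le> real ?n * (real ?n - 1) * (wt i j / 1000)" .
    qed simp
    also have "\<dots> = wt i j / 2 + (real ?n * (real ?n - 1) / \<bar>dd ?n\<bar>) * (wt i j / 1000)"
      by simp
    also have "\<dots> \<le> wt i j / 2 + 2 * (wt i j / 1000)"
      using dd_bounds[OF False] by (intro add_left_mono mult_right_mono) (auto simp: divide_le_eq)
    also have "\<dots> \<le> wt i j" by simp
    finally show ?thesis .
  qed
qed

text \<open>The right inverse of \<Delta> + 6, up to resonances, normalised to have no component
  along \<open>ze 2 0\<close> and \<open>ze 0 1\<close>.\<close>

definition sol :: "real ps ps \<Rightarrow> real ps ps" where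
  "sol = linz (tri (\<lambda>i j. if i + 2 * j = 2 then 0 else (1 / dd (i + 2 * j)) *\<^sub>R ze i j))"

definition r1 :: "real ps ps \<Rightarrow> real" where
  "r1 = linz (tri (\<lambda>i j. if i = 2 \<and> j = 0 then 1 else 0))"

definition r2 :: "real ps ps \<Rightarrow> real" where
  "r2 = linz (tri (\<lambda>i j. if i = 0 \<and> j = 1 then 1 else 0))"

lemma sol_base: "norm (if i + 2 * j = 2 then 0 else (1 / dd (i + 2 * j)) *\<^sub>R ze i j) \<le> wt i j / 2"
  using dd_bounds(1)[of "i + 2 * j"] by (auto simp: norm_ze field_simps mult_right_mono)

lemma r1_base: "norm (if i = 2 \<and> j = 0 then 1 else (0::real)) \<le> wt i j / 2"
  by auto

lemma r2_base: "norm (if i = 0 \<and> j = 1 then 1 else (0::real)) \<le> wt i j / 2"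
  by auto

lemma bounded_linear_sol: "bounded_linear sol"
  and bounded_linear_r1: "bounded_linear r1"
  and bounded_linear_r2: "bounded_linear r2"
  unfolding sol_def r1_def r2_def
  by (rule bounded_linear_linz[of _ 1]; use norm_tri_le[OF sol_base] norm_tri_le[OF r1_base] norm_tri_le[OF r2_base] in simp)+

lemma tri_eq:
  "tri b i j = (if i + 2 * j = 2 then b i j else b i j - (1 / dd (i + 2 * j)) *\<^sub>R
      ((real i * (real i - 1)) *\<^sub>R tri b (i - 2) j +
       (4 * real j * (real j - 1)) *\<^sub>R (tri b i (j - 2) - tri b (i + 2) (j - 2))))"
proof -
  have "i < 2 \<Longrightarrow> real i * (real i - 1) = 0" "j < 2 \<Longrightarrow> 4 * real j * (real j - 1) = 0"
    by (cases i; auto)+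
  then show ?thesis
    by (subst tri.simps) auto
qed

lemma sol_ze:
  "sol (ze i j) = (if i + 2 * j = 2 then 0 else (1 / dd (i + 2 * j)) *\<^sub>R (ze i j -
      (real i * (real i - 1)) *\<^sub>R sol (ze (i - 2) j) -
      (4 * real j * (real j - 1)) *\<^sub>R (sol (ze i (j - 2)) - sol (ze (i + 2) (j - 2)))))"
proof -
  have *: "sol (ze i j) = tri (\<lambda>i j. if i + 2 * j = 2 then 0 else (1 / dd (i + 2 * j)) *\<^sub>R ze i j) i j" for i j
    unfolding sol_def by (rule linz_ze[of _ 1]) (use norm_tri_le[OF sol_base] in simp)
  show ?thesis
    unfolding * by (subst tri_eq) (simp add: scaleR_diff_right scaleR_add_right diff_diff_eq)
qed

lemma r1_ze:
  "r1 (ze i j) = (if i + 2 * j = 2 then if i = 2 then 1 else 0 else - (1 / dd (i + 2 * j)) * (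
      (real i * (real i - 1)) * r1 (ze (i - 2) j) +
      (4 * real j * (real j - 1)) * (r1 (ze i (j - 2)) - r1 (ze (i + 2) (j - 2)))))"
proof -
  have *: "r1 (ze i j) = tri (\<lambda>i j. if i = 2 \<and> j = 0 then 1 else 0) i j" for i j
    unfolding r1_def by (rule linz_ze[of _ 1]) (use norm_tri_le[OF r1_base] in simp)
  have P: "i = 2 \<and> j = 0 \<or> i = 0 \<and> j = 1" if "i + 2 * j = 2"
    using that by arith
  show ?thesis
  proof (cases "i + 2 * j = 2")
    case True
    from P[OF True] show ?thesis
      unfolding * by (elim disjE) (simp_all add: tri_eq[of _ 2 0] tri_eq[of _ 0 "Suc 0"])
  next
    case False
    then show ?thesis
      unfolding * by (subst tri_eq) auto
  qed
qed

lemma r2_ze: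
  "r2 (ze i j) = (if i + 2 * j = 2 then if i = 0 then 1 else 0 else - (1 / dd (i + 2 * j)) * (
      (real i * (real i - 1)) * r2 (ze (i - 2) j) +
      (4 * real j * (real j - 1)) * (r2 (ze i (j - 2)) - r2 (ze (i + 2) (j - 2)))))"
proof -
  have *: "r2 (ze i j) = tri (\<lambda>i j. if i = 0 \<and> j = 1 then 1 else 0) i j" for i j
    unfolding r2_def by (rule linz_ze[of _ 1]) (use norm_tri_le[OF r2_base] in simp)
  have P: "i = 2 \<and> j = 0 \<or> i = 0 \<and> j = 1" if "i + 2 * j = 2"
    using that by arith
  show ?thesis
  proof (cases "i + 2 * j = 2")
    case True
    from P[OF True] show ?thesis
      unfolding * by (elim disjE) (simp_all add: tri_eq[of _ 2 0] tri_eq[of _ 0 "Suc 0"])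
  next
    case False
    then show ?thesis
      unfolding * by (subst tri_eq) auto
  qed
qed

text \<open>\<open>E\<close> stands for evaluation at a point and \<open>\<Lambda>\<close> for
  \<Delta> + 6 followed by that evaluation; composed with evaluation, the operator becomes a bounded
  functional. On monomials both sides obey the same recursion, descending in the degree.\<close>

lemma triangular_solve:
  fixes \<Lambda> :: "real ps ps \<Rightarrow> 'b::real_normed_vector"
  assumes \<Lambda>: "bounded_linear \<Lambda>" and E: "bounded_linear E"
    and \<Lambda>_ze: "\<And>i j. \<Lambda> (ze i j) = dd (i + 2 * j) *\<^sub>R E (ze i j) +
      (real i * (real i - 1)) *\<^sub>R E (ze (i - 2) j) +
      (4 * real j * (real j - 1)) *\<^sub>R (E (ze i (j - 2)) - E (ze (i + 2) (j - 2)))"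
  shows "\<Lambda> (sol f) = E f - r1 f *\<^sub>R E (ze 2 0) - r2 f *\<^sub>R E (ze 0 1)"
proof (rule bounded_linear_eq_zeI[where f = f])
  show "bounded_linear (\<lambda>f. \<Lambda> (sol f))"
    by (rule bounded_linear_compose[OF \<Lambda> bounded_linear_sol])
  show "bounded_linear (\<lambda>f. E f - r1 f *\<^sub>R E (ze 2 0) - r2 f *\<^sub>R E (ze 0 1))"
    by (intro bounded_linear_sub E bounded_linear_compose[OF bounded_linear_scaleR_left]
        bounded_linear_r1 bounded_linear_r2)
next
  interpret \<Lambda>: bounded_linear \<Lambda> by fact
  show "\<Lambda> (sol (ze i j)) = E (ze i j) - r1 (ze i j) *\<^sub>R E (ze 2 0) - r2 (ze i j) *\<^sub>R E (ze 0 1)" for i j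
  proof (induction "i + 2 * j" arbitrary: i j rule: less_induct)
    case less
    show ?case
    proof (cases "i + 2 * j = 2")
      case True
      then have "(i = 2 \<and> j = 0) \<or> (i = 0 \<and> j = 1)" by arith
      with True show ?thesis
        unfolding sol_ze[of i j] r1_ze[of i j] r2_ze[of i j] by (auto simp: \<Lambda>.zero)
    next
      case False
      define R where "R i j = r1 (ze i j) *\<^sub>R E (ze 2 0) + r2 (ze i j) *\<^sub>R E (ze 0 1)" for i j
      have IH1: "(real i * (real i - 1)) *\<^sub>R \<Lambda> (sol (ze (i - 2) j)) =
          (real i * (real i - 1)) *\<^sub>R (E (ze (i - 2) j) - R (i - 2) j)"
      proof (cases "i < 2")
        case True
        then have "i = 0 \<or> i = 1" by auto
        then show ?thesis by auto
      next
        case False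
        then show ?thesis using less[of "i - 2" j] by (simp add: R_def)
      qed
      have IH2: "(4 * real j * (real j - 1)) *\<^sub>R (\<Lambda> (sol (ze i (j - 2))) - \<Lambda> (sol (ze (i + 2) (j - 2)))) =
          (4 * real j * (real j - 1)) *\<^sub>R (E (ze i (j - 2)) - R i (j - 2) - (E (ze (i + 2) (j - 2)) - R (i + 2) (j - 2)))"
      proof (cases "j < 2")
        case True
        then have "j = 0 \<or> j = 1" by auto
        then show ?thesis by auto
      next
        case False
        then show ?thesis using less[of i "j - 2"] less[of "i + 2" "j - 2"] by (simp add: R_def)
      qed
      have d: "dd (i + 2 * j) \<noteq> 0" using dd_bounds(1)[OF False] by auto
      have R: "R i j = - (1 / dd (i + 2 * j)) *\<^sub>R ((real i * (real i - 1)) *\<^sub>R R (i - 2) j +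
          (4 * real j * (real j - 1)) *\<^sub>R (R i (j - 2) - R (i + 2) (j - 2)))"
        unfolding R_def r1_ze[of i j] r2_ze[of i j] using False by (simp add: algebra_simps)
      have "\<Lambda> (sol (ze i j)) = (1 / dd (i + 2 * j)) *\<^sub>R (\<Lambda> (ze i j) -
          (real i * (real i - 1)) *\<^sub>R \<Lambda> (sol (ze (i - 2) j)) -
          (4 * real j * (real j - 1)) *\<^sub>R (\<Lambda> (sol (ze i (j - 2))) - \<Lambda> (sol (ze (i + 2) (j - 2)))))"
        using False by (simp add: sol_ze[of i j] \<Lambda>.scaleR \<Lambda>.diff)
      also have "\<dots> = E (ze i j) - R i j"
        unfolding IH1 IH2 \<Lambda>_ze unfolding R using d by (simp add: algebra_simps)
      finally show ?thesis by (simp add: R_def)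
    qed
  qed
qed

subsection \<open>Parity\<close>

text \<open>\<open>flip\<close> is \<open>w \<mapsto> - w\<close>, the rotation by \<open>\<pi>/2\<close> about the axis.\<close>

definition flip :: "real ps ps \<Rightarrow> real ps ps" where
  "flip = hom2 (pe 1 0) (- pe 0 1)"

lemma bounded_linear_flip: "bounded_linear flip"
  and flip_mult: "flip (f * g) = flip f * flip g"
  and flip_1: "flip 1 = 1"
  unfolding flip_def
  by (intro bounded_linear_hom2 hom2_mult hom2_1; simp add: norm_pe)+

lemma pe_power: "pe i j ^ n = pe (n * i) (n * j)"
  by (induction n) (simp_all add: pe_0 pe_mult)

lemma flip_ze: "flip (ze i j) = (-1) ^ j *\<^sub>R ze i j"
proof -
  have "flip (pe i j) = pe 1 0 ^ i * (- pe 0 1) ^ j"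
    unfolding flip_def by (rule hom2_pe) (simp_all add: norm_pe)
  also have "\<dots> = (-1) ^ j *\<^sub>R pe i j"
    by (subst power_minus) (cases "even j"; simp add: pe_power pe_mult)
  finally show ?thesis
    by (simp add: ze_def linear_scale bounded_linear.linear[OF bounded_linear_flip])
qed

text \<open>The recursion changes \<open>j\<close> only in steps of 2 and therefore respects parity
  in w.\<close>

lemma flip_sol: "flip (sol f) = sol (flip f)"
proof (rule bounded_linear_eq_zeI[where f = f])
  show "bounded_linear (\<lambda>f. flip (sol f))" "bounded_linear (\<lambda>f. sol (flip f))"
    by (intro bounded_linear_compose[OF bounded_linear_flip] bounded_linear_compose[OF bounded_linear_sol]
        bounded_linear_sol bounded_linear_flip)+
  interpret F: bounded_linear flip by (rule bounded_linear_flip)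
  interpret S: bounded_linear sol by (rule bounded_linear_sol)
  have "flip (sol (ze i j)) = (-1) ^ j *\<^sub>R sol (ze i j)" for i j
  proof (induction "i + 2 * j" arbitrary: i j rule: less_induct)
    case less
    have IH1: "(real i * (real i - 1)) *\<^sub>R flip (sol (ze (i - 2) j)) =
        (-1) ^ j *\<^sub>R (real i * (real i - 1)) *\<^sub>R sol (ze (i - 2) j)"
    proof (cases "i < 2")
      case True
      then have "i = 0 \<or> i = 1" by auto
      then show ?thesis by auto
    next
      case False
      then show ?thesis using less[of "i - 2" j] by simp
    qed
    have IH2: "(4 * real j * (real j - 1)) *\<^sub>R (flip (sol (ze i (j - 2))) - flip (sol (ze (i + 2) (j - 2)))) =
        (-1) ^ j *\<^sub>R (4 * real j * (real j - 1)) *\<^sub>R (sol (ze i (j - 2)) - sol (ze (i + 2) (j - 2)))"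
    proof (cases "j < 2")
      case True
      then have "j = 0 \<or> j = 1" by auto
      then show ?thesis by auto
    next
      case False
      then have "(-1::real) ^ (j - 2) = (-1) ^ j"
        by (simp add: minus_one_power_iff)
      with False show ?thesis
        using less[of i "j - 2"] less[of "i + 2" "j - 2"] by (simp add: scaleR_diff_right mult_ac)
    qed
    show ?case
    proof (cases "i + 2 * j = 2")
      case False
      then have "flip (sol (ze i j)) = (1 / dd (i + 2 * j)) *\<^sub>R ((-1) ^ j *\<^sub>R ze i j -
          (real i * (real i - 1)) *\<^sub>R flip (sol (ze (i - 2) j)) -
          (4 * real j * (real j - 1)) *\<^sub>R (flip (sol (ze i (j - 2))) - flip (sol (ze (i + 2) (j - 2)))))"
        by (simp add: sol_ze[of i j] F.scaleR F.diff flip_ze)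
      also have "\<dots> = (-1) ^ j *\<^sub>R sol (ze i j)"
        unfolding IH1 IH2 using False by (simp add: sol_ze[of i j] scaleR_diff_right)
      finally show ?thesis .
    qed (simp add: sol_ze[of i j] F.zero)
  qed
  then show "flip (sol (ze i j)) = sol (flip (ze i j))" for i j
    by (simp add: flip_ze S.scaleR)
qed

text \<open>The descent preserves the parity of \<open>j\<close>, so from an odd \<open>j\<close> it
  never arrives at z^2. Together with \<open>r2_ze_even\<close>, each resonance condition concerns
  one parity only.\<close>

lemma r1_ze_odd: "odd j \<Longrightarrow> r1 (ze i j) = 0"
proof (induction "i + 2 * j" arbitrary: i j rule: less_induct)
  case less
  have "real i * (real i - 1) * r1 (ze (i - 2) j) = 0"
  proof (cases "i < 2")
    case True
    then have "i = 0 \<or> i = 1" by auto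
    then show ?thesis by auto
  next
    case False
    then show ?thesis using less(1)[of "i - 2" j] less(2) by simp
  qed
  moreover have "real j * (real j - 1) * (r1 (ze i (j - 2)) - r1 (ze (i + 2) (j - 2))) = 0"
  proof (cases "j < 2")
    case True
    then have "j = 0 \<or> j = 1" by auto
    then show ?thesis by auto
  next
    case False
    then show ?thesis using less(1)[of i "j - 2"] less(1)[of "i + 2" "j - 2"] less(2) by simp
  qed
  ultimately show ?case
    using less(2) odd_pos[of j] by (auto simp: r1_ze[of i j])
qed

lemma r2_ze_even: "even j \<Longrightarrow> r2 (ze i j) = 0"
proof (induction "i + 2 * j" arbitrary: i j rule: less_induct)
  case less
  have "real i * (real i - 1) * r2 (ze (i - 2) j) = 0"
  proof (cases "i < 2")
    case True
    then have "i = 0 \<or> i = 1" by auto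
    then show ?thesis by auto
  next
    case False
    then show ?thesis using less(1)[of "i - 2" j] less(2) by simp
  qed
  moreover have "real j * (real j - 1) * (r2 (ze i (j - 2)) - r2 (ze (i + 2) (j - 2))) = 0"
  proof (cases "j < 2")
    case True
    then have "j = 0 \<or> j = 1" by auto
    then show ?thesis by auto
  next
    case False
    then show ?thesis using less(1)[of i "j - 2"] less(1)[of "i + 2" "j - 2"] less(2) by simp
  qed
  ultimately show ?case
    using less(2) by (auto simp: r2_ze[of i j])
qed

lemma r1_flip: "r1 (flip f) = r1 f"
proof (rule bounded_linear_eq_zeI[where f = f])
  show "bounded_linear (\<lambda>f. r1 (flip f))"
    by (rule bounded_linear_compose[OF bounded_linear_r1 bounded_linear_flip])
  show "r1 (flip (ze i j)) = r1 (ze i j)" for i j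
    by (cases "even j")
      (simp_all add: flip_ze linear_neg bounded_linear.linear[OF bounded_linear_r1] r1_ze_odd)
qed (rule bounded_linear_r1)

lemma r2_flip: "r2 (flip f) = - r2 f"
proof (rule bounded_linear_eq_zeI[where f = f])
  show "bounded_linear (\<lambda>f. r2 (flip f))"
    by (rule bounded_linear_compose[OF bounded_linear_r2 bounded_linear_flip])
  show "r2 (flip (ze i j)) = - r2 (ze i j)" for i j
    by (cases "even j")
      (simp_all add: flip_ze linear_neg bounded_linear.linear[OF bounded_linear_r2] r2_ze_even)
qed (intro bounded_linear_minus bounded_linear_r2)

section \<open>Evaluation of series at a point\<close>

text \<open>The divisions convert the coordinates to those of the monomials of norm 1, whence
  \<open>ev_ze\<close>.\<close>

definition ev :: "real ps ps \<Rightarrow> real \<Rightarrow> real \<Rightarrow> real" where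
  "ev u z w = hom2 (z / 100) (w / 10000) u"

lemma ev_props:
  assumes "\<bar>z\<bar> \<le> 100" "\<bar>w\<bar> \<le> 10000"
  shows bounded_linear_ev: "bounded_linear (\<lambda>u. ev u z w)"
    and ev_bound: "\<bar>ev u z w\<bar> \<le> norm u"
    and ev_mult: "ev (u * v) z w = ev u z w * ev v z w"
    and ev_1: "ev 1 z w = 1"
  unfolding ev_def using assms norm_hom2_le[of "z / 100" "w / 10000" u]
  by (auto intro!: bounded_linear_hom2 simp: hom2_mult hom2_1)

lemma ev_ze:
  assumes "\<bar>z\<bar> \<le> 100" "\<bar>w\<bar> \<le> 10000"
  shows "ev (ze i j) z w = z ^ i * w ^ j"
proof -
  interpret bounded_linear "\<lambda>u. ev u z w" by (rule bounded_linear_ev[OF assms])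
  have "ev (pe i j) z w = (z / 100) ^ i * (w / 10000) ^ j"
    unfolding ev_def by (rule hom2_pe) (use assms in auto)
  then show ?thesis by (simp add: ze_def scaleR power_divide)
qed

lemma ev_arith:
  assumes "\<bar>z\<bar> \<le> 100" "\<bar>w\<bar> \<le> 10000"
  shows "ev (u + v) z w = ev u z w + ev v z w" "ev (u - v) z w = ev u z w - ev v z w"
    "ev (- u) z w = - ev u z w" "ev (r *\<^sub>R u) z w = r * ev u z w" "ev 0 z w = 0"
    "ev (u ^ n) z w = ev u z w ^ n"
proof -
  interpret bounded_linear "\<lambda>u. ev u z w" by (rule bounded_linear_ev[OF assms])
  show "ev (u + v) z w = ev u z w + ev v z w" "ev (u - v) z w = ev u z w - ev v z w"
    "ev (- u) z w = - ev u z w" "ev (r *\<^sub>R u) z w = r * ev u z w" "ev 0 z w = 0"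
    by (simp_all add: add diff neg scaleR zero)
  show "ev (u ^ n) z w = ev u z w ^ n"
    by (induction n) (simp_all add: ev_1[OF assms] ev_mult[OF assms])
qed

subsection \<open>Evaluation as an enumerated series\<close>

text \<open>Coefficients with respect to \<open>ze\<close>, listed along the pairing of naturals so
  that the Weierstrass test and termwise differentiation apply to a series with a single
  index.\<close>

definition zcoef :: "real ps ps \<Rightarrow> nat \<Rightarrow> real" where
  "zcoef u k = (case prod_decode k of (i, j) \<Rightarrow> psc (psc u j) i / wt i j)"

abbreviation (input) wtk :: "nat \<Rightarrow> real" where
  "wtk k \<equiv> (case prod_decode k of (i, j) \<Rightarrow> wt i j)"

lemma sum_zcoef_le: "(\<Sum>k<N. \<bar>zcoef u k\<bar> * wtk k) \<le> norm u"
proof -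
  let ?A = "prod_decode ` {..<N}"
  define M where "M = (MAX p\<in>insert (0, 0) ?A. max (fst p) (snd p))"
  have M: "?A \<subseteq> {..M} \<times> {..M}"
  proof
    fix p assume "p \<in> ?A"
    then have "max (fst p) (snd p) \<le> M"
      unfolding M_def by (intro Max_ge) auto
    then show "p \<in> {..M} \<times> {..M}" by (cases p) auto
  qed
  have "(\<Sum>k<N. \<bar>zcoef u k\<bar> * wtk k) = (\<Sum>p\<in>?A. case p of (i, j) \<Rightarrow> \<bar>psc (psc u j) i\<bar>)"
    by (subst sum.reindex) (auto simp: inj_on_def zcoef_def split: prod.splits intro!: sum.cong)
  also have "\<dots> \<le> (\<Sum>p\<in>{..M} \<times> {..M}. case p of (i, j) \<Rightarrow> \<bar>psc (psc u j) i\<bar>)"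
    by (rule sum_mono2) (use M in auto)
  also have "\<dots> = (\<Sum>j\<le>M. \<Sum>i\<le>M. norm (psc (psc u j) i))"
    unfolding sum.cartesian_product[symmetric] by (subst sum.swap) simp
  also have "\<dots> \<le> (\<Sum>j\<le>M. norm (psc u j))"
    by (intro sum_mono sum_norm_psc_le) auto
  also have "\<dots> \<le> norm u"
    by (rule sum_norm_psc_le) auto
  finally show ?thesis .
qed

lemma summable_zcoef: "summable (\<lambda>k. \<bar>zcoef u k\<bar> * wtk k)"
  by (rule summableI_nonneg_bounded[OF _ sum_zcoef_le]) (auto split: prod.splits)

lemma suminf_zcoef_le: "(\<Sum>k. \<bar>zcoef u k\<bar> * wtk k) \<le> norm u"
  by (rule suminf_le_const[OF summable_zcoef sum_zcoef_le])

lemma zcoef_linear: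
  "zcoef (u + v) k = zcoef u k + zcoef v k" "zcoef (r *\<^sub>R u) k = r * zcoef u k"
  by (auto simp: zcoef_def add_divide_distrib split: prod.splits)

lemma zcoef_ze: "zcoef (ze i j) k = (if k = prod_encode (i, j) then 1 else 0)"
proof -
  obtain i' j' where k: "prod_decode k = (i', j')" by fastforce
  then have "k = prod_encode (i', j')" by (metis prod_decode_inverse)
  with k show ?thesis
    by (auto simp: zcoef_def ze_def pe_def psc_psm)
qed

text \<open>The enumerated sum is itself a bounded functional and agrees with \<open>linz c\<close>
  on monomials; this turns the abstract extension into a concrete series.\<close>

lemma linz_sums:
  fixes c :: "nat \<Rightarrow> nat \<Rightarrow> real"
  assumes c: "\<And>i j. \<bar>c i j\<bar> \<le> C * wt i j"
  shows "summable (\<lambda>k. \<bar>zcoef u k * (case prod_decode k of (i, j) \<Rightarrow> c i j)\<bar>)" (is "summable (?f u)")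
    and "(\<lambda>k. zcoef u k * (case prod_decode k of (i, j) \<Rightarrow> c i j)) sums linz c u"
proof -
  let ?c = "\<lambda>k. case prod_decode k of (i, j) \<Rightarrow> c i j"
  have le: "\<bar>zcoef u k * ?c k\<bar> \<le> C * (\<bar>zcoef u k\<bar> * wtk k)" for u k
    using mult_left_mono[OF c, of "\<bar>zcoef u k\<bar>"] by (auto simp: abs_mult mult_ac split: prod.splits)
  have S: "summable (?f u)" for u
    by (rule summable_comparison_test'[OF summable_mult[OF summable_zcoef, of C u]]) (use le in simp)
  then show "summable (?f u)" .
  have S': "summable (\<lambda>k. zcoef u k * ?c k)" for u
    by (rule summable_rabs_cancel[OF S])
  define U where "U u = (\<Sum>k. zcoef u k * ?c k)" for u
  have "bounded_linear U"
  proof (rule bounded_linear_intro[of _ C])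
    show "U (u + v) = U u + U v" for u v
      unfolding U_def by (simp add: zcoef_linear distrib_right suminf_add[OF S' S', symmetric])
    show "U (r *\<^sub>R u) = r *\<^sub>R U u" for r u
      unfolding U_def by (simp add: zcoef_linear mult.assoc suminf_mult[OF S'])
    fix u
    have "norm (U u) \<le> (\<Sum>k. ?f u k)"
      unfolding U_def using summable_rabs[OF S] by simp
    also have "\<dots> \<le> (\<Sum>k. C * (\<bar>zcoef u k\<bar> * wtk k))"
      by (intro suminf_le le S summable_mult summable_zcoef)
    also have "\<dots> = C * (\<Sum>k. \<bar>zcoef u k\<bar> * wtk k)"
      by (rule suminf_mult[OF summable_zcoef])
    also have "\<dots> \<le> C * norm u"
      using c[of 0 0] by (intro mult_left_mono suminf_zcoef_le) auto
    finally show "norm (U u) \<le> norm u * C" by (simp add: mult.commute)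
  qed
  moreover have "bounded_linear (linz c)"
    by (rule bounded_linear_linz) (use c in simp)
  moreover have "U (ze i j) = linz c (ze i j)" for i j
  proof -
    have "(\<lambda>k. zcoef (ze i j) k * ?c k) = (\<lambda>k. if k = prod_encode (i, j) then ?c k else 0)"
      by (auto simp: zcoef_ze)
    then have "(\<lambda>k. zcoef (ze i j) k * ?c k) sums c i j"
      using sums_single[of "prod_encode (i, j)" ?c] by simp
    then have "U (ze i j) = c i j"
      unfolding U_def by (rule sums_unique[symmetric])
    moreover have "linz c (ze i j) = c i j"
      by (rule linz_ze) (use c in simp)
    ultimately show ?thesis by simp
  qed
  ultimately have "U u = linz c u"
    by (rule bounded_linear_eq_zeI)
  with S'[of u] show "(\<lambda>k. zcoef u k * ?c k) sums linz c u"
    by (simp add: U_def sums_iff)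
qed

lemma ev_eq_linz:
  assumes "\<bar>z\<bar> \<le> 100" "\<bar>w\<bar> \<le> 10000"
  shows "ev u z w = linz (\<lambda>i j. z ^ i * w ^ j) u"
proof (rule bounded_linear_eq_zeI[where f = u])
  have *: "\<bar>z ^ i * w ^ j\<bar> \<le> 1 * wt i j" for i j
    using assms by (simp add: abs_mult power_abs power_mono mult_mono)
  show "bounded_linear (linz (\<lambda>i j. z ^ i * w ^ j))"
    by (rule bounded_linear_linz[of _ 1]) (use * in simp)
  show "ev (ze i j) z w = linz (\<lambda>i j. z ^ i * w ^ j) (ze i j)" for i j
    by (subst linz_ze[of _ 1]) (use * ev_ze assms in simp_all)
qed (rule bounded_linear_ev[OF assms])

subsection \<open>Second derivatives along curves\<close>

text \<open>First and second derivative of \<open>p ^ i * q ^ j\<close> along a curve with velocity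
  \<open>(p1, q1)\<close> and acceleration \<open>(p2, q2)\<close>.\<close>

definition mono_d1 :: "nat \<Rightarrow> nat \<Rightarrow> real \<Rightarrow> real \<Rightarrow> real \<Rightarrow> real \<Rightarrow> real" where
  "mono_d1 i j p q p1 q1 =
     real i * p ^ (i - 1) * p1 * q ^ j + p ^ i * (real j * q ^ (j - 1) * q1)"

definition mono_d2 ::
  "nat \<Rightarrow> nat \<Rightarrow> real \<Rightarrow> real \<Rightarrow> real \<Rightarrow> real \<Rightarrow> real \<Rightarrow> real \<Rightarrow> real" where
  "mono_d2 i j p q p1 q1 p2 q2 =
     real i * (real i - 1) * p ^ (i - 2) * q ^ j * p1\<^sup>2 +
     2 * real i * real j * p ^ (i - 1) * q ^ (j - 1) * p1 * q1 +
     real j * (real j - 1) * p ^ i * q ^ (j - 2) * q1\<^sup>2 +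
     real i * p ^ (i - 1) * q ^ j * p2 + real j * p ^ i * q ^ (j - 1) * q2"

lemma wt_ge: "real (i + j) * (real (i + j) + 1) \<le> wt i j" "real (i + j) \<le> wt i j" "1 \<le> wt i j"
proof -
  have 1: "real n * (real n + 1) \<le> 4 ^ n" for n
  proof -
    have "real (Suc n) \<le> real (2 ^ n)"
      by (intro of_nat_mono Suc_leI less_exp)
    then have "real n \<le> 2 ^ n" "real n + 1 \<le> 2 ^ n" by simp_all
    then have "real n * (real n + 1) \<le> 2 ^ n * 2 ^ n" by (intro mult_mono) auto
    then show ?thesis by (simp add: power_mult_distrib[symmetric])
  qed
  have "(4::real) ^ (i + j) \<le> wt i j"
    unfolding power_add by (intro mult_mono power_mono) auto
  with 1[of "i + j"] show *: "real (i + j) * (real (i + j) + 1) \<le> wt i j" by linarith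
  have "real (i + j) \<le> real (i + j) * (real (i + j) + 1)" by (simp add: distrib_left)
  then show "real (i + j) \<le> wt i j" using * by (rule order_trans)
  show "1 \<le> wt i j" using mult_mono[of 1 "100 ^ i :: real" 1 "10000 ^ j"] by simp
qed

context
  fixes p q p1 q1 p2 q2 C :: real
  assumes bnd: "\<bar>p\<bar> \<le> 1" "\<bar>q\<bar> \<le> 1" "\<bar>p1\<bar> \<le> C" "\<bar>q1\<bar> \<le> C" "\<bar>p2\<bar> \<le> C" "\<bar>q2\<bar> \<le> C" "1 \<le> C"
begin

lemma mono_pq: "\<bar>p ^ i * q ^ j\<bar> \<le> 1"
  using bnd by (simp add: abs_mult power_abs mult_le_one power_le_one)

lemma mono_d1_le: "\<bar>mono_d1 i j p q p1 q1\<bar> \<le> C * wt i j"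
proof -
  have "\<bar>mono_d1 i j p q p1 q1\<bar> \<le> \<bar>real i * p1 * (p ^ (i - 1) * q ^ j)\<bar> + \<bar>real j * q1 * (p ^ i * q ^ (j - 1))\<bar>"
    unfolding mono_d1_def by (rule order_trans[OF _ abs_triangle_ineq]) (simp add: mult_ac)
  also have "\<dots> \<le> real i * C * 1 + real j * C * 1"
    unfolding abs_mult[of "_ * _" "_ ^ _ * _"]
    by (intro add_mono mult_mono mono_pq) (use bnd in \<open>auto simp: abs_mult intro!: mult_left_mono\<close>)
  also have "\<dots> = C * real (i + j)" by (simp add: algebra_simps)
  also have "\<dots> \<le> C * wt i j"
    using bnd by (intro mult_left_mono wt_ge) auto
  finally show ?thesis .
qed

lemma mono_d2_le: "\<bar>mono_d2 i j p q p1 q1 p2 q2\<bar> \<le> C\<^sup>2 * wt i j"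
proof -
  have C: "C \<le> C\<^sup>2" using bnd by (simp add: power2_eq_square)
  have p1: "p1\<^sup>2 \<le> C\<^sup>2" "q1\<^sup>2 \<le> C\<^sup>2" "\<bar>p1 * q1\<bar> \<le> C\<^sup>2"
    using bnd power_mono[of "\<bar>p1\<bar>" C 2] power_mono[of "\<bar>q1\<bar>" C 2] mult_mono[of "\<bar>p1\<bar>" C "\<bar>q1\<bar>" C]
    by (auto simp: abs_mult power2_eq_square)
  have T: "\<bar>a * x * (p ^ k * q ^ l)\<bar> \<le> a * C\<^sup>2" if "0 \<le> a" "\<bar>x\<bar> \<le> C\<^sup>2" for a x k l
  proof -
    have "\<bar>a * x * (p ^ k * q ^ l)\<bar> = a * (\<bar>x\<bar> * \<bar>p ^ k * q ^ l\<bar>)"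
      using that by (simp add: abs_mult mult_ac)
    also have "\<dots> \<le> a * (C\<^sup>2 * 1)"
      using that by (intro mult_left_mono mult_mono mono_pq) auto
    finally show ?thesis by simp
  qed
  have nn: "0 \<le> real n * (real n - 1)" for n by (cases n) auto
  have "\<bar>mono_d2 i j p q p1 q1 p2 q2\<bar> \<le>
      \<bar>(real i * (real i - 1)) * p1\<^sup>2 * (p ^ (i - 2) * q ^ j)\<bar> +
      \<bar>(2 * real i * real j) * (p1 * q1) * (p ^ (i - 1) * q ^ (j - 1))\<bar> +
      \<bar>(real j * (real j - 1)) * q1\<^sup>2 * (p ^ i * q ^ (j - 2))\<bar> +
      \<bar>real i * p2 * (p ^ (i - 1) * q ^ j)\<bar> + \<bar>real j * q2 * (p ^ i * q ^ (j - 1))\<bar>"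
    unfolding mono_d2_def
    by (intro order_trans[OF abs_triangle_ineq] add_mono) (simp_all add: mult_ac)
  also have "\<dots> \<le> (real i * (real i - 1)) * C\<^sup>2 + (2 * real i * real j) * C\<^sup>2 +
      (real j * (real j - 1)) * C\<^sup>2 + real i * C\<^sup>2 + real j * C\<^sup>2"
    using C bnd p1 by (intro add_mono T nn) auto
  also have "\<dots> \<le> C\<^sup>2 * (real (i + j) * (real (i + j) + 1))"
    by (simp add: algebra_simps)
  also have "\<dots> \<le> C\<^sup>2 * wt i j"
    by (intro mult_left_mono wt_ge) auto
  finally show ?thesis .
qed

end

text \<open>The curve stays in |z|, |w| <= 1, far inside the polydisc, so the weights absorb the
  quadratic growth of the derivatives of monomials. The M-test then allows differentiating the
  series term by term twice.\<close>

lemma deriv2_ev_curve: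
  fixes p q p1 q1 p2 q2 :: "real \<Rightarrow> real"
  assumes r: "r > 0"
    and D: "\<And>t. \<bar>t\<bar> < r \<Longrightarrow> (p has_field_derivative p1 t) (at t)"
      "\<And>t. \<bar>t\<bar> < r \<Longrightarrow> (q has_field_derivative q1 t) (at t)"
      "\<And>t. \<bar>t\<bar> < r \<Longrightarrow> (p1 has_field_derivative p2 t) (at t)"
      "\<And>t. \<bar>t\<bar> < r \<Longrightarrow> (q1 has_field_derivative q2 t) (at t)"
    and B: "\<And>t. \<bar>t\<bar> < r \<Longrightarrow> \<bar>p t\<bar> \<le> 1" "\<And>t. \<bar>t\<bar> < r \<Longrightarrow> \<bar>q t\<bar> \<le> 1"
      "\<And>t. \<bar>t\<bar> < r \<Longrightarrow> \<bar>p1 t\<bar> \<le> C" "\<And>t. \<bar>t\<bar> < r \<Longrightarrow> \<bar>q1 t\<bar> \<le> C"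
      "\<And>t. \<bar>t\<bar> < r \<Longrightarrow> \<bar>p2 t\<bar> \<le> C" "\<And>t. \<bar>t\<bar> < r \<Longrightarrow> \<bar>q2 t\<bar> \<le> C"
    and C: "1 \<le> C"
  shows "(deriv ^^ 2) (\<lambda>t. ev u (p t) (q t)) 0 =
    linz (\<lambda>i j. mono_d2 i j (p 0) (q 0) (p1 0) (q1 0) (p2 0) (q2 0)) u"
proof -
  define S where "S = {-r<..<r}"
  have S: "t \<in> S \<longleftrightarrow> \<bar>t\<bar> < r" for t by (auto simp: S_def)
  have S0: "0 \<in> S" "convex S" "interior S = S" "open S" using r by (auto simp: S_def)
  have m0: "\<bar>p t ^ i * q t ^ j\<bar> \<le> 1" if "\<bar>t\<bar> < r" for t i j
    by (rule mono_pq[of "p t" "q t" "p1 t" C "q1 t" "p2 t" "q2 t"]) (use B[OF that] C in simp_all)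
  have m1: "\<bar>mono_d1 i j (p t) (q t) (p1 t) (q1 t)\<bar> \<le> C * wt i j" if "\<bar>t\<bar> < r" for t i j
    by (rule mono_d1_le[of "p t" "q t" "p1 t" C "q1 t" "p2 t" "q2 t"]) (use B[OF that] C in simp_all)
  have m2: "\<bar>mono_d2 i j (p t) (q t) (p1 t) (q1 t) (p2 t) (q2 t)\<bar> \<le> C\<^sup>2 * wt i j" if "\<bar>t\<bar> < r" for t i j
    by (rule mono_d2_le) (use B[OF that] C in simp_all)
  define f0 where "f0 k t = zcoef u k * (case prod_decode k of (i, j) \<Rightarrow> p t ^ i * q t ^ j)" for k t
  define f1 where "f1 k t = zcoef u k * (case prod_decode k of (i, j) \<Rightarrow> mono_d1 i j (p t) (q t) (p1 t) (q1 t))" for k t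
  define f2 where "f2 k t = zcoef u k * (case prod_decode k of (i, j) \<Rightarrow>
      mono_d2 i j (p t) (q t) (p1 t) (q1 t) (p2 t) (q2 t))" for k t
  have d1: "(f0 k has_field_derivative f1 k t) (at t)" if "\<bar>t\<bar> < r" for k t
  proof -
    obtain i j where k: "prod_decode k = (i, j)" by fastforce
    show ?thesis
      unfolding f0_def f1_def k prod.case mono_d1_def
      by (rule derivative_eq_intros D[OF that] refl)+ (simp add: algebra_simps)
  qed
  have d2: "(f1 k has_field_derivative f2 k t) (at t)" if "\<bar>t\<bar> < r" for k t
  proof -
    obtain i j where k: "prod_decode k = (i, j)" by fastforce
    have i: "real i * real (i - Suc 0) = real i * (real i - 1)" for i by (cases i) auto
    have ii: "x * (real (i - Suc 0) * y) * z * real i = x * y * z * (real i * real (i - Suc 0))" for x y z i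
      by simp
    show ?thesis
      unfolding f1_def f2_def k prod.case mono_d1_def mono_d2_def
      apply (rule derivative_eq_intros D[OF that] refl)+
      apply (cases i; cases j)
      apply (simp_all add: algebra_simps power2_eq_square)
      done
  qed
  have b1: "norm (f1 k t) \<le> C * (\<bar>zcoef u k\<bar> * wtk k)" if "\<bar>t\<bar> < r" for k t
  proof -
    obtain i j where k: "prod_decode k = (i, j)" by fastforce
    show ?thesis
      using mult_left_mono[OF m1[OF that, of i j], of "\<bar>zcoef u k\<bar>"]
      by (simp add: f1_def k abs_mult mult_ac)
  qed
  have b2: "norm (f2 k t) \<le> C\<^sup>2 * (\<bar>zcoef u k\<bar> * wtk k)" if "\<bar>t\<bar> < r" for k t
  proof -
    obtain i j where k: "prod_decode k = (i, j)" by fastforce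
    show ?thesis
      using mult_left_mono[OF m2[OF that, of i j], of "\<bar>zcoef u k\<bar>"]
      by (simp add: f2_def k abs_mult mult_ac)
  qed
  have u1: "uniformly_convergent_on S (\<lambda>n x. \<Sum>i<n. f1 i x)"
    by (rule Weierstrass_m_test'[OF _ summable_mult[OF summable_zcoef]]) (use b1 S in blast)
  have u2: "uniformly_convergent_on S (\<lambda>n x. \<Sum>i<n. f2 i x)"
    by (rule Weierstrass_m_test'[OF _ summable_mult[OF summable_zcoef]]) (use b2 S in blast)
  have s0: "(\<lambda>k. f0 k t) sums ev u (p t) (q t)" if "\<bar>t\<bar> < r" for t
  proof -
    have "\<bar>p t ^ i * q t ^ j\<bar> \<le> 1 * wt i j" for i j
      using m0[OF that, of i j] wt_ge(3)[of i j] by linarith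
    note linz_sums(2)[OF this, of u]
    moreover have "ev u (p t) (q t) = linz (\<lambda>i j. p t ^ i * q t ^ j) u"
      by (rule ev_eq_linz) (use B(1,2)[OF that] in auto)
    ultimately show ?thesis by (simp add: f0_def)
  qed
  have s1: "summable (\<lambda>k. f1 k 0)"
    by (rule summable_comparison_test'[OF summable_mult[OF summable_zcoef]]) (use b1[of 0] r in auto)
  have D1: "((\<lambda>t. ev u (p t) (q t)) has_field_derivative (\<Sum>k. f1 k t)) (at t)" if "\<bar>t\<bar> < r" for t
  proof -
    have "((\<lambda>t. \<Sum>k. f0 k t) has_field_derivative (\<Sum>k. f1 k t)) (at t)"
      by (rule has_field_derivative_series'(2)[of S f0 f1 0])
        (use S0 S that d1 u1 sums_summable[OF s0[of 0]] r in \<open>auto intro: has_field_derivative_at_within\<close>)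
    moreover have "eventually (\<lambda>t. ev u (p t) (q t) = (\<Sum>k. f0 k t)) (nhds t)"
      using eventually_nhds_in_open[OF \<open>open S\<close>, of t] that
      by (auto simp: S elim!: eventually_mono intro: sums_unique s0)
    ultimately show ?thesis
      by (subst DERIV_cong_ev[where g = "\<lambda>t. \<Sum>k. f0 k t"]) simp_all
  qed
  have D2: "((\<lambda>t. \<Sum>k. f1 k t) has_field_derivative (\<Sum>k. f2 k 0)) (at 0)"
    by (rule has_field_derivative_series'(2)[of S f1 f2 0])
      (use S0 S d2 u2 s1 r in \<open>auto intro: has_field_derivative_at_within\<close>)
  have "deriv (deriv (\<lambda>t. ev u (p t) (q t))) 0 = deriv (\<lambda>t. \<Sum>k. f1 k t) 0"
  proof (rule deriv_cong_ev)
    show "eventually (\<lambda>t. deriv (\<lambda>t. ev u (p t) (q t)) t = (\<Sum>k. f1 k t)) (nhds 0)"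
      using eventually_nhds_in_open[OF \<open>open S\<close> \<open>0 \<in> S\<close>]
      by (auto simp: S elim!: eventually_mono intro: DERIV_imp_deriv D1)
  qed simp
  also have "\<dots> = (\<Sum>k. f2 k 0)" by (rule DERIV_imp_deriv[OF D2])
  also have "\<dots> = linz (\<lambda>i j. mono_d2 i j (p 0) (q 0) (p1 0) (q1 0) (p2 0) (q2 0)) u"
  proof -
    have "\<bar>mono_d2 i j (p 0) (q 0) (p1 0) (q1 0) (p2 0) (q2 0)\<bar> \<le> C\<^sup>2 * wt i j" for i j
      using m2[of 0] r by simp
    from linz_sums(2)[OF this, of u] show ?thesis
      unfolding f2_def by (rule sums_unique[symmetric])
  qed
  finally show ?thesis by (simp add: numeral_2_eq_2)
qed

section \<open>The Laplace-Beltrami operator on functions of (z, w)\<close>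

definition evS :: "real ps ps \<Rightarrow> real^3 \<Rightarrow> real" where
  "evS u x = ev u (x $ 3) ((x $ 1)\<^sup>2 - (x $ 2)\<^sup>2)"

lemma norm3: "(norm (x :: real^3))\<^sup>2 = (x $ 1)\<^sup>2 + (x $ 2)\<^sup>2 + (x $ 3)\<^sup>2"
  unfolding power2_norm_eq_inner inner_vec_def by (simp add: sum_3 power2_eq_square)

lemma S2_iff: "x \<in> S2 \<longleftrightarrow> (x $ 1)\<^sup>2 + (x $ 2)\<^sup>2 + (x $ 3)\<^sup>2 = 1"
proof -
  have "x \<in> S2 \<longleftrightarrow> (norm x)\<^sup>2 = 1" using norm_ge_zero[of x] by (auto simp: power2_eq_1_iff simp del: norm_ge_zero)
  then show ?thesis by (simp add: norm3)
qed

lemma S2_bounds: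
  assumes "x \<in> S2"
  shows "\<bar>x $ 3\<bar> \<le> 1" "\<bar>(x $ 1)\<^sup>2 - (x $ 2)\<^sup>2\<bar> \<le> 1"
proof -
  have *: "(x $ 1)\<^sup>2 + (x $ 2)\<^sup>2 + (x $ 3)\<^sup>2 = 1" using assms S2_iff by blast
  then have "(x $ 3)\<^sup>2 \<le> 1" using zero_le_power2[of "x $ 1"] zero_le_power2[of "x $ 2"] by linarith
  then show "\<bar>x $ 3\<bar> \<le> 1" by (simp add: abs_square_le_1)
  show "\<bar>(x $ 1)\<^sup>2 - (x $ 2)\<^sup>2\<bar> \<le> 1"
    using * zero_le_power2[of "x $ 1"] zero_le_power2[of "x $ 2"] zero_le_power2[of "x $ 3"] by linarith
qed

text \<open>The curve is the radial projection of a coordinate line through \<open>x\<close>, as in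
  the definition of \<open>laplace_beltrami\<close>. The arguments of \<open>mono_d2\<close> are the
  values, velocities and accelerations at 0 of z and w along it; \<open>\<delta>\<close> is the
  Kronecker symbol of the direction.\<close>

lemma deriv2_evS_line:
  fixes x :: "real^3" and k :: 3
  assumes x: "x \<in> S2"
  defines "\<delta> \<equiv> \<lambda>l. if l = k then 1 else (0::real)"
  defines "w \<equiv> (x $ 1)\<^sup>2 - (x $ 2)\<^sup>2"
  defines "w1 \<equiv> 2 * \<delta> 1 * x $ 1 - 2 * \<delta> 2 * x $ 2"
  shows "(deriv ^^ 2) (\<lambda>t. evS u ((x + t *\<^sub>R axis k 1) /\<^sub>R norm (x + t *\<^sub>R axis k 1))) 0 =
    linz (\<lambda>i j. mono_d2 i j (x $ 3) w (\<delta> 3 - x $ 3 * x $ k) (w1 - 2 * w * x $ k)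
      (x $ 3 * (3 * (x $ k)\<^sup>2 - 1) - 2 * \<delta> 3 * x $ k)
      (2 * \<delta> 1 - 2 * \<delta> 2 - 4 * w1 * x $ k + 2 * w * (4 * (x $ k)\<^sup>2 - 1))) u"
proof -
  \<comment> \<open>\<open>N t\<close> is the squared length of
    \<open>x + t *\<^sub>R axis k 1\<close> and \<open>h t\<close> the inverse length, so that along
    the projected line z is \<open>y3 * h\<close> and w is \<open>Q * h\<^sup>2\<close>.\<close>
  define N where "N t = 1 + 2 * t * x $ k + t\<^sup>2" for t
  define h where "h t = 1 / sqrt (N t)" for t
  define y where "y t = x + t *\<^sub>R axis k 1" for t
  have y: "y t $ l = x $ l + t * \<delta> l" for t l
    by (simp add: y_def axis_def \<delta>_def)
  have xk: "\<bar>x $ k\<bar> \<le> 1"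
    using component_le_norm_cart[of x k] x by simp
  have Npos: "N t > 0" if "\<bar>t\<bar> < 1" for t
  proof -
    have "\<bar>t * x $ k\<bar> \<le> \<bar>t\<bar> * 1" unfolding abs_mult by (intro mult_left_mono xk) auto
    then have "N t \<ge> 1 - 2 * \<bar>t\<bar> + \<bar>t\<bar>\<^sup>2" unfolding N_def by simp
    also have "1 - 2 * \<bar>t\<bar> + \<bar>t\<bar>\<^sup>2 = (1 - \<bar>t\<bar>)\<^sup>2" by (simp add: power2_eq_square algebra_simps)
    finally show ?thesis using that zero_less_power[of "1 - \<bar>t\<bar>" 2] by linarith
  qed
  have S: "(x $ 1)\<^sup>2 + (x $ 2)\<^sup>2 + (x $ 3)\<^sup>2 = 1" using x S2_iff by blast
  have ny2: "(norm (y t))\<^sup>2 = N t" for t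
  proof -
    have "(norm (y t))\<^sup>2 = (x $ 1)\<^sup>2 + (x $ 2)\<^sup>2 + (x $ 3)\<^sup>2 +
        2 * t * (\<delta> 1 * x $ 1 + \<delta> 2 * x $ 2 + \<delta> 3 * x $ 3) + t\<^sup>2 * ((\<delta> 1)\<^sup>2 + (\<delta> 2)\<^sup>2 + (\<delta> 3)\<^sup>2)"
      unfolding norm3 y by (simp add: power2_eq_square algebra_simps)
    moreover have "\<delta> 1 * x $ 1 + \<delta> 2 * x $ 2 + \<delta> 3 * x $ 3 = x $ k" "(\<delta> 1)\<^sup>2 + (\<delta> 2)\<^sup>2 + (\<delta> 3)\<^sup>2 = 1"
      using exhaust_3[of k] by (auto simp: \<delta>_def)
    ultimately show ?thesis by (simp add: S N_def)
  qed
  have ny: "norm (y t) = sqrt (N t)" for t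
    using ny2[of t] by (metis norm_ge_zero real_sqrt_unique)
  define h1 where "h1 t = - (x $ k + t) * h t ^ 3" for t
  define h2 where "h2 t = - (h t ^ 3) + 3 * (x $ k + t)\<^sup>2 * h t ^ 5" for t
  have dh: "(h has_field_derivative h1 t) (at t)" if "\<bar>t\<bar> < 1" for t
  proof -
    have dN: "(N has_field_derivative 2 * (x $ k + t)) (at t)"
      unfolding N_def[abs_def] by (auto intro!: derivative_eq_intros)
    have s: "sqrt (N t) \<noteq> 0" using Npos[OF that] by simp
    have "((\<lambda>t. inverse (sqrt (N t))) has_field_derivative
        - (inverse (sqrt (N t)) * (inverse (sqrt (N t)) / 2 * (2 * (x $ k + t))) * inverse (sqrt (N t)))) (at t)"
      by (rule DERIV_inverse'[OF DERIV_chain2[OF DERIV_real_sqrt[OF Npos[OF that]] dN] s])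
    moreover have "- (inverse (sqrt (N t)) * (inverse (sqrt (N t)) / 2 * (2 * (x $ k + t))) * inverse (sqrt (N t))) = h1 t"
    proof -
      have "- (inverse s * (inverse s / 2 * (2 * a)) * inverse s) = - a * (1 / s) ^ 3" for s a :: real
        by (simp add: power3_eq_cube inverse_eq_divide)
      then show ?thesis by (simp only: h1_def h_def)
    qed
    ultimately show ?thesis by (simp add: h_def[abs_def] inverse_eq_divide)
  qed
  have dh1: "(h1 has_field_derivative h2 t) (at t)" if "\<bar>t\<bar> < 1" for t
  proof -
    have "(h1 has_field_derivative - 1 * (h t ^ 3) + - (x $ k + t) * (3 * h t ^ 2 * h1 t)) (at t)"
      unfolding h1_def[abs_def] by (auto intro!: derivative_eq_intros dh[OF that] simp: h1_def)
    moreover have "- 1 * (h t ^ 3) + - (x $ k + t) * (3 * h t ^ 2 * h1 t) = h2 t"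
      by (simp add: h1_def h2_def power2_eq_square eval_nat_numeral algebra_simps)
    ultimately show ?thesis by simp
  qed
  define y3 where "y3 t = x $ 3 + t * \<delta> 3" for t
  define Q where "Q t = (x $ 1 + t * \<delta> 1)\<^sup>2 - (x $ 2 + t * \<delta> 2)\<^sup>2" for t
  define Q1 where "Q1 t = 2 * \<delta> 1 * (x $ 1 + t * \<delta> 1) - 2 * \<delta> 2 * (x $ 2 + t * \<delta> 2)" for t
  have d2: "\<delta> l * (2 * \<delta> l) = 2 * \<delta> l" for l by (simp add: \<delta>_def)
  have dy3: "(y3 has_field_derivative \<delta> 3) (at t)" for t
    unfolding y3_def[abs_def] by (auto intro!: derivative_eq_intros)
  have dQ: "(Q has_field_derivative Q1 t) (at t)" for t
    unfolding Q_def[abs_def] Q1_def by (auto intro!: derivative_eq_intros simp: algebra_simps)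
  have dQ1: "(Q1 has_field_derivative 2 * \<delta> 1 - 2 * \<delta> 2) (at t)" for t
    unfolding Q1_def[abs_def] by (auto intro!: derivative_eq_intros simp: d2)
  define p where "p t = y3 t * h t" for t
  define p1 where "p1 t = \<delta> 3 * h t + y3 t * h1 t" for t
  define p2 where "p2 t = 2 * \<delta> 3 * h1 t + y3 t * h2 t" for t
  define q where "q t = Q t * (h t)\<^sup>2" for t
  define q1 where "q1 t = Q1 t * (h t)\<^sup>2 + 2 * Q t * h t * h1 t" for t
  define q2 where "q2 t = (2 * \<delta> 1 - 2 * \<delta> 2) * (h t)\<^sup>2 + 4 * Q1 t * h t * h1 t + 2 * Q t * ((h1 t)\<^sup>2 + h t * h2 t)" for t
  note ds = dh dh1 dy3 dQ dQ1
  have dp: "(p has_field_derivative p1 t) (at t)" "(p1 has_field_derivative p2 t) (at t)"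
    "(q has_field_derivative q1 t) (at t)" "(q1 has_field_derivative q2 t) (at t)" if "\<bar>t\<bar> < 1" for t
    unfolding p_def[abs_def] p1_def[abs_def] p2_def q_def[abs_def] q1_def[abs_def] q2_def
    by (auto intro!: derivative_eq_intros ds that simp: algebra_simps power2_eq_square)
  have in01: "\<bar>t\<bar> < 1" if "t \<in> {-1/2..1/2}" for t :: real using that by auto
  \<comment> \<open>The projected line is smooth for |t| < 1; the compact interval inside supplies
    the uniform constant for \<open>deriv2_ev_curve\<close>.\<close>
  have bd: "\<exists>C. \<forall>t\<in>{-1/2..1/2}. \<bar>f t\<bar> \<le> C" if f: "continuous_on {-1/2..1/2} f" for f :: "real \<Rightarrow> real"
    using compact_imp_bounded[OF compact_continuous_image[OF f]] by (auto simp: bounded_iff)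
  have ch: "continuous_on {-1/2..1/2} h" "continuous_on {-1/2..1/2} h1"
    using DERIV_isCont[OF dh[OF in01]] DERIV_isCont[OF dh1[OF in01]]
    by (auto intro!: continuous_at_imp_continuous_on)
  have cQ: "continuous_on {-1/2..1/2} y3" "continuous_on {-1/2..1/2} Q" "continuous_on {-1/2..1/2} Q1"
    "continuous_on {-1/2..1/2} h2"
    unfolding y3_def[abs_def] Q_def[abs_def] Q1_def[abs_def] h2_def[abs_def]
    by (intro continuous_intros ch)+
  have cc: "continuous_on {-1/2..1/2} p1" "continuous_on {-1/2..1/2} q1"
    "continuous_on {-1/2..1/2} p2" "continuous_on {-1/2..1/2} q2"
    unfolding p1_def[abs_def] q1_def[abs_def] p2_def[abs_def] q2_def[abs_def]
    by (intro continuous_intros ch cQ)+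
  obtain C1 C2 C3 C4 where C: "\<And>t. t \<in> {-1/2..1/2} \<Longrightarrow> \<bar>p1 t\<bar> \<le> C1" "\<And>t. t \<in> {-1/2..1/2} \<Longrightarrow> \<bar>q1 t\<bar> \<le> C2"
    "\<And>t. t \<in> {-1/2..1/2} \<Longrightarrow> \<bar>p2 t\<bar> \<le> C3" "\<And>t. t \<in> {-1/2..1/2} \<Longrightarrow> \<bar>q2 t\<bar> \<le> C4"
    using cc[THEN bd] by metis
  define C where "C = max 1 (max (max C1 C2) (max C3 C4))"
  have hny: "h t = inverse (norm (y t))" for t by (simp add: h_def ny inverse_eq_divide)
  have nyp: "norm (y t) > 0" if "\<bar>t\<bar> < 1" for t using Npos[OF that] by (simp add: ny)
  have S2y: "y t /\<^sub>R norm (y t) \<in> S2" if "\<bar>t\<bar> < 1" for t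
    using nyp[OF that] by auto
  have pq: "(y t /\<^sub>R norm (y t)) $ 3 = p t"
    "((y t /\<^sub>R norm (y t)) $ 1)\<^sup>2 - ((y t /\<^sub>R norm (y t)) $ 2)\<^sup>2 = q t" for t
    by (simp_all add: p_def q_def y3_def Q_def hny y power2_eq_square algebra_simps)
  have "(deriv ^^ 2) (\<lambda>t. ev u (p t) (q t)) 0 =
      linz (\<lambda>i j. mono_d2 i j (p 0) (q 0) (p1 0) (q1 0) (p2 0) (q2 0)) u"
  proof (rule deriv2_ev_curve[where r = "1/2" and C = C])
    fix t :: real assume t: "\<bar>t\<bar> < 1 / 2"
    then have t1: "\<bar>t\<bar> < 1" and tt: "t \<in> {-1/2..1/2}" by auto
    show "(p has_field_derivative p1 t) (at t)" "(p1 has_field_derivative p2 t) (at t)"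
      "(q has_field_derivative q1 t) (at t)" "(q1 has_field_derivative q2 t) (at t)"
      by (rule dp[OF t1])+
    show "\<bar>p t\<bar> \<le> 1" "\<bar>q t\<bar> \<le> 1"
      using S2_bounds[OF S2y[OF t1]] unfolding pq by auto
    show "\<bar>p1 t\<bar> \<le> C" "\<bar>q1 t\<bar> \<le> C" "\<bar>p2 t\<bar> \<le> C" "\<bar>q2 t\<bar> \<le> C"
      using C(1)[OF tt] C(2)[OF tt] C(3)[OF tt] C(4)[OF tt] by (simp_all add: C_def)
  qed (simp_all add: C_def)
  moreover have "(\<lambda>t. ev u (p t) (q t)) = (\<lambda>t. evS u ((x + t *\<^sub>R axis k 1) /\<^sub>R norm (x + t *\<^sub>R axis k 1)))"
    unfolding evS_def y_def[symmetric] pq ..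
  moreover have h0: "h 0 = 1" "h1 0 = - x $ k" "h2 0 = 3 * (x $ k)\<^sup>2 - 1"
    by (simp_all add: h_def N_def h1_def h2_def)
  moreover have "p 0 = x $ 3" "q 0 = w" "p1 0 = \<delta> 3 - x $ 3 * x $ k" "q1 0 = w1 - 2 * w * x $ k"
    "p2 0 = x $ 3 * (3 * (x $ k)\<^sup>2 - 1) - 2 * \<delta> 3 * x $ k"
    "q2 0 = 2 * \<delta> 1 - 2 * \<delta> 2 - 4 * w1 * x $ k + 2 * w * (4 * (x $ k)\<^sup>2 - 1)"
    by (simp_all add: p_def q_def p1_def q1_def p2_def q2_def h0 y3_def Q_def Q1_def w_def w1_def algebra_simps)
  ultimately show ?thesis by simp
qed

text \<open>The Laplace-Beltrami operator applied to z^i w^j, again as a polynomial in (z,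
  w).\<close>

definition lapm :: "nat \<Rightarrow> nat \<Rightarrow> real \<Rightarrow> real \<Rightarrow> real" where
  "lapm i j z w = - (real (i + 2 * j) * (real (i + 2 * j) + 1)) * (z ^ i * w ^ j) +
     real i * (real i - 1) * (z ^ (i - 2) * w ^ j) +
     4 * real j * (real j - 1) * (z ^ i * w ^ (j - 2) - z ^ (i + 2) * w ^ (j - 2))"

text \<open>By the chain rule the sum over the three directions depends only on the inner products
  of the gradients of z and w and on their Laplacians. Facts 1 to 5 are |grad z|^2, grad z . grad w,
  |grad w|^2, \<Delta> z and \<Delta> w, in this order.\<close>

lemma sum_mono_d2_eq_lapm:
  fixes x1 x2 x3 :: real
  assumes S: "x1\<^sup>2 + x2\<^sup>2 + x3\<^sup>2 = 1" and w: "w = x1\<^sup>2 - x2\<^sup>2"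
  shows "mono_d2 i j x3 w (- x3 * x1) (2 * x1 - 2 * w * x1) (x3 * (3 * x1\<^sup>2 - 1))
      (2 - 8 * x1 * x1 + 2 * w * (4 * x1\<^sup>2 - 1)) +
    mono_d2 i j x3 w (- x3 * x2) (- 2 * x2 - 2 * w * x2) (x3 * (3 * x2\<^sup>2 - 1))
      (- 2 + 8 * x2 * x2 + 2 * w * (4 * x2\<^sup>2 - 1)) +
    mono_d2 i j x3 w (1 - x3 * x3) (- 2 * w * x3) (x3 * (3 * x3\<^sup>2 - 1) - 2 * x3)
      (2 * w * (4 * x3\<^sup>2 - 1)) = lapm i j x3 w"
proof -
  have 1: "(- x3 * x1)\<^sup>2 + (- x3 * x2)\<^sup>2 + (1 - x3 * x3)\<^sup>2 = 1 - x3\<^sup>2"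
    using S by algebra
  have 2: "(- x3 * x1) * (2 * x1 - 2 * w * x1) + (- x3 * x2) * (- 2 * x2 - 2 * w * x2) +
      (1 - x3 * x3) * (- 2 * w * x3) = - 2 * w * x3"
    using S w by algebra
  have 3: "(2 * x1 - 2 * w * x1)\<^sup>2 + (- 2 * x2 - 2 * w * x2)\<^sup>2 + (- 2 * w * x3)\<^sup>2 = 4 * (1 - x3\<^sup>2) - 4 * w\<^sup>2"
    using S w by algebra
  have 4: "x3 * (3 * x1\<^sup>2 - 1) + x3 * (3 * x2\<^sup>2 - 1) + (x3 * (3 * x3\<^sup>2 - 1) - 2 * x3) = - 2 * x3"
    using S w by algebra
  have 5: "(2 - 8 * x1 * x1 + 2 * w * (4 * x1\<^sup>2 - 1)) + (- 2 + 8 * x2 * x2 + 2 * w * (4 * x2\<^sup>2 - 1)) +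
      2 * w * (4 * x3\<^sup>2 - 1) = - 6 * w"
    using S w by algebra
  have "mono_d2 i j x3 w a1 b1 c1 e1 + mono_d2 i j x3 w a2 b2 c2 e2 + mono_d2 i j x3 w a3 b3 c3 e3 =
      real i * (real i - 1) * x3 ^ (i - 2) * w ^ j * (a1\<^sup>2 + a2\<^sup>2 + a3\<^sup>2) +
      2 * real i * real j * x3 ^ (i - 1) * w ^ (j - 1) * (a1 * b1 + a2 * b2 + a3 * b3) +
      real j * (real j - 1) * x3 ^ i * w ^ (j - 2) * (b1\<^sup>2 + b2\<^sup>2 + b3\<^sup>2) +
      real i * x3 ^ (i - 1) * w ^ j * (c1 + c2 + c3) + real j * x3 ^ i * w ^ (j - 1) * (e1 + e2 + e3)"
    for a1 b1 c1 e1 a2 b2 c2 e2 a3 b3 c3 e3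
    unfolding mono_d2_def by (simp add: algebra_simps)
  note this[of "- x3 * x1" "2 * x1 - 2 * w * x1" "x3 * (3 * x1\<^sup>2 - 1)" "2 - 8 * x1 * x1 + 2 * w * (4 * x1\<^sup>2 - 1)"
      "- x3 * x2" "- 2 * x2 - 2 * w * x2" "x3 * (3 * x2\<^sup>2 - 1)" "- 2 + 8 * x2 * x2 + 2 * w * (4 * x2\<^sup>2 - 1)"
      "1 - x3 * x3" "- 2 * w * x3" "x3 * (3 * x3\<^sup>2 - 1) - 2 * x3" "2 * w * (4 * x3\<^sup>2 - 1)", unfolded 1 2 3 4 5]
  also have "real i * (real i - 1) * x3 ^ (i - 2) * w ^ j * (1 - x3\<^sup>2) +
      2 * real i * real j * x3 ^ (i - 1) * w ^ (j - 1) * (- 2 * w * x3) +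
      real j * (real j - 1) * x3 ^ i * w ^ (j - 2) * (4 * (1 - x3\<^sup>2) - 4 * w\<^sup>2) +
      real i * x3 ^ (i - 1) * w ^ j * (- 2 * x3) + real j * x3 ^ i * w ^ (j - 1) * (- 6 * w) = lapm i j x3 w"
  proof -
    \<comment> \<open>These identities absorb one or two factors into truncated exponents; where
      truncation occurs the prefactor is 0.\<close>
    have a: "real i * x3 ^ (i - 1) * x3 = real i * x3 ^ i"
      by (cases i) auto
    have b: "real j * w ^ (j - 1) * w = real j * w ^ j"
      by (cases j) auto
    have c: "real i * (real i - 1) * x3 ^ (i - 2) * x3\<^sup>2 = real i * (real i - 1) * x3 ^ i"
      by (cases i; cases "i - 1") (auto simp: power2_eq_square)
    have d: "real j * (real j - 1) * w ^ (j - 2) * w\<^sup>2 = real j * (real j - 1) * w ^ j"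
      by (cases j; cases "j - 1") (auto simp: power2_eq_square)
    have e1: "real i * (real i - 1) * x3 ^ (i - 2) * w ^ j * (1 - x3\<^sup>2) =
        real i * (real i - 1) * x3 ^ (i - 2) * w ^ j - (real i * (real i - 1) * x3 ^ (i - 2) * x3\<^sup>2) * w ^ j"
      by (simp add: algebra_simps)
    have e2: "2 * real i * real j * x3 ^ (i - 1) * w ^ (j - 1) * (- 2 * w * x3) =
        - 4 * (real i * x3 ^ (i - 1) * x3) * (real j * w ^ (j - 1) * w)"
      by (simp add: algebra_simps)
    have e3: "real j * (real j - 1) * x3 ^ i * w ^ (j - 2) * (4 * (1 - x3\<^sup>2) - 4 * w\<^sup>2) =
        4 * real j * (real j - 1) * (x3 ^ i * w ^ (j - 2) - x3 ^ (i + 2) * w ^ (j - 2)) -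
        4 * x3 ^ i * (real j * (real j - 1) * w ^ (j - 2) * w\<^sup>2)"
      by (simp add: algebra_simps power2_eq_square)
    have e4: "real i * x3 ^ (i - 1) * w ^ j * (- 2 * x3) = - 2 * (real i * x3 ^ (i - 1) * x3) * w ^ j"
      by (simp add: algebra_simps)
    have e5: "real j * x3 ^ i * w ^ (j - 1) * (- 6 * w) = - 6 * x3 ^ i * (real j * w ^ (j - 1) * w)"
      by (simp add: algebra_simps)
    show ?thesis
      unfolding e1[unfolded c] e2[unfolded a b] e3[unfolded d] e4[unfolded a] e5[unfolded b] lapm_def
      by (simp add: algebra_simps)
  qed
  finally show ?thesis .
qed

lemma laplace_beltrami_evS_aux:
  assumes x: "x \<in> S2"
  shows "bounded_linear (\<lambda>u. laplace_beltrami (evS u) x)"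
    and "laplace_beltrami (evS (ze i j)) x = lapm i j (x $ 3) ((x $ 1)\<^sup>2 - (x $ 2)\<^sup>2)"
proof -
  define w where "w = (x $ 1)\<^sup>2 - (x $ 2)\<^sup>2"
  have S: "(x $ 1)\<^sup>2 + (x $ 2)\<^sup>2 + (x $ 3)\<^sup>2 = 1" using x S2_iff by blast
  have bw: "\<bar>x $ 3\<bar> \<le> 1" "\<bar>w\<bar> \<le> 1" using S2_bounds[OF x] by (simp_all add: w_def)
  define m where "m a b c e i j = mono_d2 i j (x $ 3) w a b c e" for a b c e i j
  have m: "\<bar>m a b c e i j\<bar> \<le> (1 + \<bar>a\<bar> + \<bar>b\<bar> + \<bar>c\<bar> + \<bar>e\<bar>)\<^sup>2 * wt i j" for a b c e i j
    unfolding m_def by (rule mono_d2_le) (use bw in linarith)+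
  define M1 where "M1 = m (- x $ 3 * x $ 1) (2 * x $ 1 - 2 * w * x $ 1) (x $ 3 * (3 * (x $ 1)\<^sup>2 - 1))
      (2 - 8 * x $ 1 * x $ 1 + 2 * w * (4 * (x $ 1)\<^sup>2 - 1))"
  define M2 where "M2 = m (- x $ 3 * x $ 2) (- 2 * x $ 2 - 2 * w * x $ 2) (x $ 3 * (3 * (x $ 2)\<^sup>2 - 1))
      (- 2 + 8 * x $ 2 * x $ 2 + 2 * w * (4 * (x $ 2)\<^sup>2 - 1))"
  define M3 where "M3 = m (1 - x $ 3 * x $ 3) (- 2 * w * x $ 3) (x $ 3 * (3 * (x $ 3)\<^sup>2 - 1) - 2 * x $ 3)
      (2 * w * (4 * (x $ 3)\<^sup>2 - 1))"
  obtain C1 C2 C3 where C: "\<And>i j. norm (M1 i j) \<le> C1 * wt i j" "\<And>i j. norm (M2 i j) \<le> C2 * wt i j"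
    "\<And>i j. norm (M3 i j) \<le> C3 * wt i j"
    unfolding M1_def M2_def M3_def real_norm_def using m that by meson
  have B: "(Basis :: (real^3) set) = {axis 1 1, axis 2 1, axis 3 1}"
    by (auto simp: Basis_vec_def UNIV_3)
  have ne: "axis 1 1 \<noteq> (axis 2 1 :: real^3)" "axis 1 1 \<noteq> (axis 3 1 :: real^3)" "axis 2 1 \<noteq> (axis 3 1 :: real^3)"
    by (auto simp: axis_eq_axis)
  have eq: "laplace_beltrami (evS u) x = linz M1 u + linz M2 u + linz M3 u" for u
    unfolding laplace_beltrami_def laplacian_def B
    using ne deriv2_evS_line[OF x, of u 1] deriv2_evS_line[OF x, of u 2] deriv2_evS_line[OF x, of u 3]
    by (simp add: M1_def M2_def M3_def m_def[abs_def] w_def[symmetric] algebra_simps)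
  show "bounded_linear (\<lambda>u. laplace_beltrami (evS u) x)"
    unfolding eq by (intro bounded_linear_add bounded_linear_linz[OF C(1)] bounded_linear_linz[OF C(2)]
        bounded_linear_linz[OF C(3)])
  show "laplace_beltrami (evS (ze i j)) x = lapm i j (x $ 3) ((x $ 1)\<^sup>2 - (x $ 2)\<^sup>2)"
    unfolding eq linz_ze[OF C(1)] linz_ze[OF C(2)] linz_ze[OF C(3)] w_def[symmetric]
    unfolding M1_def M2_def M3_def m_def by (rule sum_mono_d2_eq_lapm[OF S w_def])
qed

lemma bounded_linear_evS: "x \<in> S2 \<Longrightarrow> bounded_linear (\<lambda>u. evS u x)"
  unfolding evS_def by (rule bounded_linear_ev) (use S2_bounds[of x] in auto)

lemma evS_ze: "x \<in> S2 \<Longrightarrow> evS (ze i j) x = (x $ 3) ^ i * ((x $ 1)\<^sup>2 - (x $ 2)\<^sup>2) ^ j"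
  unfolding evS_def by (rule ev_ze) (use S2_bounds[of x] in auto)

lemma evS_bound: "x \<in> S2 \<Longrightarrow> \<bar>evS u x\<bar> \<le> norm u"
  unfolding evS_def by (rule ev_bound) (use S2_bounds[of x] in auto)

text \<open>Once \<open>r1 f\<close> and \<open>r2 f\<close> vanish, \<open>sol f\<close> solves
  (\<Delta> + 6) u = f on the sphere: these are the two solvability conditions of the
  reduction.\<close>

lemma laplace_beltrami_sol:
  assumes x: "x \<in> S2"
  shows "laplace_beltrami (evS (sol f)) x + 6 * evS (sol f) x =
    evS f x - r1 f * evS (ze 2 0) x - r2 f * evS (ze 0 1) x"
proof -
  have "bounded_linear (\<lambda>u. laplace_beltrami (evS u) x + 6 *\<^sub>R evS u x)"
    by (intro bounded_linear_add laplace_beltrami_evS_aux[OF x] bounded_linear_scaleR_right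
        bounded_linear_compose[OF bounded_linear_scaleR_right bounded_linear_evS[OF x]])
  from triangular_solve[OF this bounded_linear_evS[OF x], of f] show ?thesis
    by (simp add: laplace_beltrami_evS_aux[OF x] evS_ze[OF x] lapm_def dd_def algebra_simps)
qed

section \<open>Lipschitz families depending on \<epsilon> and the perturbed fixed point\<close>

definition lipf :: "'x::real_normed_vector set \<Rightarrow> (real \<Rightarrow> 'x \<Rightarrow> 'b::real_normed_vector) \<Rightarrow> bool" where
  "lipf D h \<longleftrightarrow> (\<exists>C\<ge>0. \<forall>\<epsilon>\<in>{0..1}. \<forall>x\<in>D. \<forall>y\<in>D.
     norm (h \<epsilon> x) \<le> C \<and> norm (h \<epsilon> x - h \<epsilon> y) \<le> C * norm (x - y))"

lemma lipfI:
  assumes "C \<ge> 0" "\<And>\<epsilon> x. \<epsilon> \<in> {0..1} \<Longrightarrow> x \<in> D \<Longrightarrow> norm (h \<epsilon> x) \<le> C"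
    "\<And>\<epsilon> x y. \<epsilon> \<in> {0..1} \<Longrightarrow> x \<in> D \<Longrightarrow> y \<in> D \<Longrightarrow> norm (h \<epsilon> x - h \<epsilon> y) \<le> C * norm (x - y)"
  shows "lipf D h"
  unfolding lipf_def using assms by blast

lemma lipfE:
  assumes "lipf D h"
  obtains C where "C \<ge> 0" "\<And>\<epsilon> x. \<epsilon> \<in> {0..1} \<Longrightarrow> x \<in> D \<Longrightarrow> norm (h \<epsilon> x) \<le> C"
    "\<And>\<epsilon> x y. \<epsilon> \<in> {0..1} \<Longrightarrow> x \<in> D \<Longrightarrow> y \<in> D \<Longrightarrow> norm (h \<epsilon> x - h \<epsilon> y) \<le> C * norm (x - y)"
  using assms unfolding lipf_def by blast

lemma lipf_const: "lipf D (\<lambda>\<epsilon> x. c)"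
  by (rule lipfI[of "norm c"]) auto

lemma lipf_eps: "lipf D (\<lambda>\<epsilon> x. \<epsilon>)"
  by (rule lipfI[of 1]) auto

lemma lipf_add:
  assumes "lipf D h" "lipf D k"
  shows "lipf D (\<lambda>\<epsilon> x. h \<epsilon> x + k \<epsilon> x)"
proof -
  obtain A where A: "A \<ge> 0" "\<And>\<epsilon> x. \<epsilon> \<in> {0..1} \<Longrightarrow> x \<in> D \<Longrightarrow> norm (h \<epsilon> x) \<le> A"
    "\<And>\<epsilon> x y. \<epsilon> \<in> {0..1} \<Longrightarrow> x \<in> D \<Longrightarrow> y \<in> D \<Longrightarrow> norm (h \<epsilon> x - h \<epsilon> y) \<le> A * norm (x - y)"
    using assms(1) by (rule lipfE) blast
  obtain B where B: "B \<ge> 0" "\<And>\<epsilon> x. \<epsilon> \<in> {0..1} \<Longrightarrow> x \<in> D \<Longrightarrow> norm (k \<epsilon> x) \<le> B"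
    "\<And>\<epsilon> x y. \<epsilon> \<in> {0..1} \<Longrightarrow> x \<in> D \<Longrightarrow> y \<in> D \<Longrightarrow> norm (k \<epsilon> x - k \<epsilon> y) \<le> B * norm (x - y)"
    using assms(2) by (rule lipfE) blast
  show ?thesis
  proof (rule lipfI[of "A + B"])
    show "norm (h \<epsilon> x + k \<epsilon> x) \<le> A + B" if "\<epsilon> \<in> {0..1}" "x \<in> D" for \<epsilon> x
      using that by (intro order_trans[OF norm_triangle_ineq] add_mono A B)
    show "norm (h \<epsilon> x + k \<epsilon> x - (h \<epsilon> y + k \<epsilon> y)) \<le> (A + B) * norm (x - y)"
      if "\<epsilon> \<in> {0..1}" "x \<in> D" "y \<in> D" for \<epsilon> x y
      unfolding add_diff_add distrib_right
      using that by (intro order_trans[OF norm_triangle_ineq] add_mono A B)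
  qed (use A B in auto)
qed

lemma lipf_bilinear:
  assumes bil: "bounded_bilinear m" and "lipf D h" "lipf D k"
  shows "lipf D (\<lambda>\<epsilon> x. m (h \<epsilon> x) (k \<epsilon> x))"
proof -
  interpret bounded_bilinear m by fact
  obtain A where A: "A \<ge> 0" "\<And>\<epsilon> x. \<epsilon> \<in> {0..1} \<Longrightarrow> x \<in> D \<Longrightarrow> norm (h \<epsilon> x) \<le> A"
    "\<And>\<epsilon> x y. \<epsilon> \<in> {0..1} \<Longrightarrow> x \<in> D \<Longrightarrow> y \<in> D \<Longrightarrow> norm (h \<epsilon> x - h \<epsilon> y) \<le> A * norm (x - y)"
    using assms(2) by (rule lipfE) blast
  obtain B where B: "B \<ge> 0" "\<And>\<epsilon> x. \<epsilon> \<in> {0..1} \<Longrightarrow> x \<in> D \<Longrightarrow> norm (k \<epsilon> x) \<le> B"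
    "\<And>\<epsilon> x y. \<epsilon> \<in> {0..1} \<Longrightarrow> x \<in> D \<Longrightarrow> y \<in> D \<Longrightarrow> norm (k \<epsilon> x - k \<epsilon> y) \<le> B * norm (x - y)"
    using assms(3) by (rule lipfE) blast
  obtain K where K: "K \<ge> 0" "\<And>a b. norm (m a b) \<le> norm a * norm b * K"
    using nonneg_bounded by blast
  have K': "norm (m a b) \<le> u * v * K" if "norm a \<le> u" "norm b \<le> v" for a b u v
    using that K(1) by (intro order_trans[OF K(2)] mult_right_mono mult_mono) (auto intro: order_trans[OF norm_ge_zero])
  show ?thesis
  \<comment> \<open>A single constant has to serve as sup bound, A B K, and as Lipschitz constant, 2
    A B K; the sum does both.\<close>
  proof (rule lipfI[of "2 * A * B * K + A * B * K"])
    show "norm (m (h \<epsilon> x) (k \<epsilon> x)) \<le> 2 * A * B * K + A * B * K" if "\<epsilon> \<in> {0..1}" "x \<in> D" for \<epsilon> x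
    proof -
      have "norm (m (h \<epsilon> x) (k \<epsilon> x)) \<le> A * B * K" using that by (intro K' A B)
      moreover have "0 \<le> A * B * K" using A(1) B(1) K(1) by simp
      ultimately show ?thesis by simp
    qed
    show "norm (m (h \<epsilon> x) (k \<epsilon> x) - m (h \<epsilon> y) (k \<epsilon> y)) \<le> (2 * A * B * K + A * B * K) * norm (x - y)"
      if "\<epsilon> \<in> {0..1}" "x \<in> D" "y \<in> D" for \<epsilon> x y
    proof -
      have "m (h \<epsilon> x) (k \<epsilon> x) - m (h \<epsilon> y) (k \<epsilon> y) =
          m (h \<epsilon> x - h \<epsilon> y) (k \<epsilon> x) + m (h \<epsilon> y) (k \<epsilon> x - k \<epsilon> y)"
        by (simp add: diff_left diff_right)
      also have "norm \<dots> \<le> (A * norm (x - y)) * B * K + A * (B * norm (x - y)) * K"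
        using that by (intro order_trans[OF norm_triangle_ineq] add_mono K' A B)
      also have "\<dots> = 2 * A * B * K * norm (x - y)" by simp
      also have "\<dots> \<le> (2 * A * B * K + A * B * K) * norm (x - y)"
        using A(1) B(1) K(1) by (intro mult_right_mono) auto
      finally show ?thesis .
    qed
  qed (use A(1) B(1) K(1) in simp)
qed

text \<open>
  A self-map of this class that does not depend on \<open>x\<close> at \<open>\<epsilon> = 0\<close> is a contraction for small \<open>\<epsilon>\<close>; the class is closed
  under the algebra operations, so no Lipschitz constant has to be computed.
\<close>

definition lip_affine :: "'x::real_normed_vector set \<Rightarrow> (real \<Rightarrow> 'x \<Rightarrow> 'b::real_normed_vector) \<Rightarrow> bool" where
  "lip_affine D h \<longleftrightarrow> (\<exists>h0 h1. lipf D (\<lambda>\<epsilon>. h0) \<and> lipf D h1 \<and>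
     (\<forall>\<epsilon>\<in>{0..1}. \<forall>x\<in>D. h \<epsilon> x = h0 x + \<epsilon> *\<^sub>R h1 \<epsilon> x))"

lemma goodI:
  assumes "lipf D (\<lambda>\<epsilon>. h0)" "lipf D h1" "\<And>\<epsilon> x. \<epsilon> \<in> {0..1} \<Longrightarrow> x \<in> D \<Longrightarrow> h \<epsilon> x = h0 x + \<epsilon> *\<^sub>R h1 \<epsilon> x"
  shows "lip_affine D h"
  unfolding lip_affine_def using assms by blast

lemma lip_affine_const: "lip_affine D (\<lambda>\<epsilon> x. c)"
  by (rule goodI[where ?h1.0 = "\<lambda>\<epsilon> x. 0" and ?h0.0 = "\<lambda>x. c"]) (auto intro: lipf_const)

lemma lip_affine_eps: "lip_affine D (\<lambda>\<epsilon> x. \<epsilon>)"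
  by (rule goodI[where ?h1.0 = "\<lambda>\<epsilon> x. 1" and ?h0.0 = "\<lambda>x. 0"]) (auto intro: lipf_const)

lemma lip_affine_id:
  assumes "bounded D"
  shows "lip_affine D (\<lambda>\<epsilon> x. x)"
proof -
  obtain B where B: "\<And>x. x \<in> D \<Longrightarrow> norm x \<le> B" using assms by (auto simp: bounded_iff)
  have "lipf D (\<lambda>(\<epsilon>::real) x. x)"
    by (rule lipfI[of "max 1 \<bar>B\<bar>"])
      (auto dest!: B simp: max_def mult_right_mono[of 1 _ "norm _", simplified])
  then show ?thesis
    by (rule goodI[where ?h1.0 = "\<lambda>\<epsilon> x. 0" and ?h0.0 = "\<lambda>x. x"]) (auto intro: lipf_const)
qed

lemma lip_affine_bilinear:
  assumes bil: "bounded_bilinear m" and "lip_affine D h" "lip_affine D k"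
  shows "lip_affine D (\<lambda>\<epsilon> x. m (h \<epsilon> x) (k \<epsilon> x))"
proof -
  interpret bounded_bilinear m by fact
  obtain h0 h1 where h: "lipf D (\<lambda>\<epsilon>. h0)" "lipf D h1"
    "\<And>\<epsilon> x. \<epsilon> \<in> {0..1} \<Longrightarrow> x \<in> D \<Longrightarrow> h \<epsilon> x = h0 x + \<epsilon> *\<^sub>R h1 \<epsilon> x"
    using assms(2) unfolding lip_affine_def by blast
  obtain k0 k1 where k: "lipf D (\<lambda>\<epsilon>. k0)" "lipf D k1"
    "\<And>\<epsilon> x. \<epsilon> \<in> {0..1} \<Longrightarrow> x \<in> D \<Longrightarrow> k \<epsilon> x = k0 x + \<epsilon> *\<^sub>R k1 \<epsilon> x"
    using assms(3) unfolding lip_affine_def by blast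
  show ?thesis
  proof (rule goodI)
    show "lipf D (\<lambda>\<epsilon> x. m (h0 x) (k0 x))"
      by (rule lipf_bilinear[OF bil h(1) k(1)])
    \<comment> \<open>Every term of the product except \<open>m (h0 x) (k0 x)\<close> contains
      \<epsilon>. One factor \<epsilon> is taken out, and the second one in the last term remains as
      a bounded function on [0, 1].\<close>
    show "lipf D (\<lambda>\<epsilon> x. m (h1 \<epsilon> x) (k0 x) + (m (h0 x) (k1 \<epsilon> x) + \<epsilon> *\<^sub>R m (h1 \<epsilon> x) (k1 \<epsilon> x)))"
      by (intro lipf_add lipf_bilinear[OF bil] lipf_bilinear[OF bounded_bilinear_scaleR] lipf_eps h k)
  qed (simp add: h k add_left add_right scaleR_left scaleR_right algebra_simps)
qed

lemma lip_affine_linear: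
  assumes L: "bounded_linear L" and "lip_affine D h"
  shows "lip_affine D (\<lambda>\<epsilon> x. L (h \<epsilon> x))"
proof -
  have "bounded_bilinear (\<lambda>(r::real) a. r *\<^sub>R L a)"
    using bounded_bilinear.comp[OF bounded_bilinear_scaleR bounded_linear_ident L] by simp
  from lip_affine_bilinear[OF this lip_affine_const[of D 1] assms(2)] show ?thesis by simp
qed

lemma lip_affine_add:
  assumes "lip_affine D h" "lip_affine D k"
  shows "lip_affine D (\<lambda>\<epsilon> x. h \<epsilon> x + k \<epsilon> x)"
proof -
  obtain h0 h1 where h: "lipf D (\<lambda>\<epsilon>. h0)" "lipf D h1"
    "\<And>\<epsilon> x. \<epsilon> \<in> {0..1} \<Longrightarrow> x \<in> D \<Longrightarrow> h \<epsilon> x = h0 x + \<epsilon> *\<^sub>R h1 \<epsilon> x"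
    using assms(1) unfolding lip_affine_def by blast
  obtain k0 k1 where k: "lipf D (\<lambda>\<epsilon>. k0)" "lipf D k1"
    "\<And>\<epsilon> x. \<epsilon> \<in> {0..1} \<Longrightarrow> x \<in> D \<Longrightarrow> k \<epsilon> x = k0 x + \<epsilon> *\<^sub>R k1 \<epsilon> x"
    using assms(2) unfolding lip_affine_def by blast
  show ?thesis
  proof (rule goodI)
    show "lipf D (\<lambda>\<epsilon> x. h0 x + k0 x)" "lipf D (\<lambda>\<epsilon> x. h1 \<epsilon> x + k1 \<epsilon> x)"
      by (intro lipf_add h k)+
  qed (simp add: h k algebra_simps)
qed

lemma lip_affine_diff:
  assumes "lip_affine D h" "lip_affine D k"
  shows "lip_affine D (\<lambda>\<epsilon> x. h \<epsilon> x - k \<epsilon> x)"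
  using lip_affine_add[OF assms(1) lip_affine_linear[OF bounded_linear_minus[OF bounded_linear_ident] assms(2)]] by simp

lemma lip_affine_mult:
  fixes h k :: "real \<Rightarrow> 'x::real_normed_vector \<Rightarrow> 'b::real_normed_algebra"
  shows "lip_affine D h \<Longrightarrow> lip_affine D k \<Longrightarrow> lip_affine D (\<lambda>\<epsilon> x. h \<epsilon> x * k \<epsilon> x)"
  by (rule lip_affine_bilinear[OF bounded_bilinear_mult])

lemma lip_affine_scaleR: "lip_affine D h \<Longrightarrow> lip_affine D k \<Longrightarrow> lip_affine D (\<lambda>\<epsilon> x. h \<epsilon> x *\<^sub>R k \<epsilon> x)"
  by (rule lip_affine_bilinear[OF bounded_bilinear_scaleR])

lemma lip_affine_power:
  fixes h :: "real \<Rightarrow> 'x::real_normed_vector \<Rightarrow> 'b::real_normed_algebra_1"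
  shows "lip_affine D h \<Longrightarrow> lip_affine D (\<lambda>\<epsilon> x. h \<epsilon> x ^ n)"
  by (induction n) (auto intro: lip_affine_const lip_affine_mult)

lemma lip_affine_Pair:
  assumes "lip_affine D h" "lip_affine D k"
  shows "lip_affine D (\<lambda>\<epsilon> x. (h \<epsilon> x, k \<epsilon> x))"
proof -
  have "bounded_linear (\<lambda>a::'b. (a, 0::'c))" "bounded_linear (\<lambda>a::'c. (0::'b, a))"
    by (intro bounded_linear_Pair bounded_linear_ident bounded_linear_zero)+
  from lip_affine_add[OF lip_affine_linear[OF this(1) assms(1)] lip_affine_linear[OF this(2) assms(2)]]
  show ?thesis by simp
qed

text \<open>On the unit ball the map has the form x0 + \<epsilon> h1, so for small \<epsilon> it
  maps the ball into itself and halves distances. Intersecting with the invariant closed set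
  \<open>V\<close> hands the parity constraints on to the fixed point.\<close>

lemma perturbed_fixed_point:
  fixes T :: "real \<Rightarrow> 'x::banach \<Rightarrow> 'x"
  assumes V: "closed V" "x0 \<in> V" and TV: "\<And>\<epsilon> x. x \<in> V \<Longrightarrow> T \<epsilon> x \<in> V"
    and lip_affine: "lip_affine (cball x0 1) T" and T0: "\<And>x. x \<in> cball x0 1 \<Longrightarrow> T 0 x = x0"
  obtains \<epsilon>0 C where "\<epsilon>0 > 0" "\<epsilon>0 \<le> 1"
    "\<And>\<epsilon>. \<epsilon> \<in> {0..\<epsilon>0} \<Longrightarrow> \<exists>x\<in>V. T \<epsilon> x = x \<and> norm (x - x0) \<le> C * \<epsilon>"
proof -
  obtain h0 h1 where h: "lipf (cball x0 1) h1"
    "\<And>\<epsilon> x. \<epsilon> \<in> {0..1} \<Longrightarrow> x \<in> cball x0 1 \<Longrightarrow> T \<epsilon> x = h0 x + \<epsilon> *\<^sub>R h1 \<epsilon> x"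
    using lip_affine unfolding lip_affine_def by blast
  have "h0 x = x0" if "x \<in> cball x0 1" for x
    using h(2)[of 0 x] T0[OF that] that by simp
  with h(2) have T: "\<And>\<epsilon> x. \<epsilon> \<in> {0..1} \<Longrightarrow> x \<in> cball x0 1 \<Longrightarrow> T \<epsilon> x = x0 + \<epsilon> *\<^sub>R h1 \<epsilon> x"
    by simp
  obtain C where C: "C \<ge> 0" "\<And>\<epsilon> x. \<epsilon> \<in> {0..1} \<Longrightarrow> x \<in> cball x0 1 \<Longrightarrow> norm (h1 \<epsilon> x) \<le> C"
    "\<And>\<epsilon> x y. \<epsilon> \<in> {0..1} \<Longrightarrow> x \<in> cball x0 1 \<Longrightarrow> y \<in> cball x0 1 \<Longrightarrow>
      norm (h1 \<epsilon> x - h1 \<epsilon> y) \<le> C * norm (x - y)"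
    using h(1) by (rule lipfE) blast
  \<comment> \<open>Chosen so that \<epsilon> C <= 1/2, which gives both the contraction factor and
    the invariance of the ball; the summand 1 keeps the quotient defined for C = 0.\<close>
  define \<epsilon>0 where "\<epsilon>0 = 1 / (2 * (C + 1))"
  have e0: "\<epsilon>0 > 0" "\<epsilon>0 \<le> 1" "\<epsilon>0 * C \<le> 1 / 2"
    using C(1) by (auto simp: \<epsilon>0_def field_simps)
  show ?thesis
  proof (rule that[OF e0(1,2)])
    fix \<epsilon> assume "\<epsilon> \<in> {0..\<epsilon>0}"
    then have eps: "\<epsilon> \<in> {0..1}" "\<epsilon> * C \<le> 1 / 2"
      using e0 mult_right_mono[OF _ C(1), of \<epsilon> \<epsilon>0] by auto
    let ?S = "V \<inter> cball x0 1"
    have dist: "norm (T \<epsilon> x - x0) \<le> C * \<epsilon>" if "x \<in> cball x0 1" for x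
      using mult_left_mono[OF C(2)[OF eps(1) that], of \<epsilon>] eps(1) by (simp add: T[OF eps(1) that] mult.commute)
    have "\<exists>!x\<in>?S. T \<epsilon> x = x"
    proof (rule Banach_fix[where c = "1 / 2"])
      show "complete ?S" using V(1) by (intro complete_eq_closed[THEN iffD2] closed_Int closed_cball)
      show "?S \<noteq> {}" using V(2) by auto
      show "T \<epsilon> ` ?S \<subseteq> ?S"
        using TV dist eps(2) by (force simp: dist_norm norm_minus_commute mult.commute)
      show "dist (T \<epsilon> x) (T \<epsilon> y) \<le> 1 / 2 * dist x y" if "x \<in> ?S" "y \<in> ?S" for x y
      proof -
        have xy: "x \<in> cball x0 1" "y \<in> cball x0 1" using that by auto
        have "dist (T \<epsilon> x) (T \<epsilon> y) = \<epsilon> * norm (h1 \<epsilon> x - h1 \<epsilon> y)"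
          using eps(1) by (simp add: T[OF eps(1) xy(1)] T[OF eps(1) xy(2)] dist_norm flip: scaleR_diff_right)
        also have "\<dots> \<le> \<epsilon> * (C * norm (x - y))"
          using eps(1) C(3)[OF eps(1) xy] by (intro mult_left_mono) auto
        also have "\<dots> \<le> 1 / 2 * norm (x - y)"
          using mult_right_mono[OF eps(2), of "norm (x - y)"] by simp
        finally show ?thesis by (simp add: dist_norm)
      qed
    qed auto
    then obtain x where "x \<in> ?S" "T \<epsilon> x = x" by blast
    then show "\<exists>x\<in>V. T \<epsilon> x = x \<and> norm (x - x0) \<le> C * \<epsilon>"
      using dist[of x] by auto
  qed
qed

subsection \<open>Lyapunov--Schmidt reduction\<close>

text \<open>
  For \<open>f(s) = a1 s + a2 s\<^sup>2/2 + a3 s\<^sup>3/3 + a4 s\<^sup>4/4\<close> one has \<open>f(Z + \<epsilon> N) = fE + \<epsilon> fO\<close>, where \<open>fE\<close> and \<open>fO\<close> are even and odd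
  in \<open>N\<close>.
\<close>

definition fE :: "real \<Rightarrow> real \<Rightarrow> real \<Rightarrow> real \<Rightarrow> real \<Rightarrow> real ps ps \<Rightarrow> real ps ps \<Rightarrow> real ps ps" where
  "fE a1 a2 a3 a4 \<epsilon> Z N = a1 *\<^sub>R Z + (a2 / 2) *\<^sub>R (Z ^ 2 + \<epsilon> ^ 2 *\<^sub>R N ^ 2) +
     a3 *\<^sub>R ((1 / 3) *\<^sub>R Z ^ 3 + \<epsilon> ^ 2 *\<^sub>R (Z * N ^ 2)) +
     a4 *\<^sub>R ((1 / 4) *\<^sub>R Z ^ 4 + (3 / 2 * \<epsilon> ^ 2) *\<^sub>R (Z ^ 2 * N ^ 2) + (\<epsilon> ^ 4 / 4) *\<^sub>R N ^ 4)"

definition fO :: "real \<Rightarrow> real \<Rightarrow> real \<Rightarrow> real \<Rightarrow> real \<Rightarrow> real ps ps \<Rightarrow> real ps ps \<Rightarrow> real ps ps" where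
  "fO a1 a2 a3 a4 \<epsilon> Z N = a1 *\<^sub>R N + a2 *\<^sub>R (Z * N) +
     a3 *\<^sub>R (Z ^ 2 * N + (\<epsilon> ^ 2 / 3) *\<^sub>R N ^ 3) +
     a4 *\<^sub>R (Z ^ 3 * N + \<epsilon> ^ 2 *\<^sub>R (Z * N ^ 3))"

lemma flip_fE_fO:
  assumes "flip Z = Z" "flip N = - N"
  shows "flip (fE a1 a2 a3 a4 \<epsilon> Z N) = fE a1 a2 a3 a4 \<epsilon> Z N"
    "flip (fO a1 a2 a3 a4 \<epsilon> Z N) = - fO a1 a2 a3 a4 \<epsilon> Z N"
proof -
  interpret F: bounded_linear flip by (rule bounded_linear_flip)
  have pw: "flip (f ^ n) = flip f ^ n" for f n
    by (induction n) (simp_all add: flip_1 flip_mult)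
  show "flip (fE a1 a2 a3 a4 \<epsilon> Z N) = fE a1 a2 a3 a4 \<epsilon> Z N"
    by (simp add: fE_def F.add F.scaleR flip_mult pw assms)
  show "flip (fO a1 a2 a3 a4 \<epsilon> Z N) = - fO a1 a2 a3 a4 \<epsilon> Z N"
    by (simp add: fO_def F.add F.scaleR flip_mult pw assms scaleR_add_right flip: scaleR_minus_right)
qed

lemma lip_affine_fE:
  assumes "lip_affine D a1" "lip_affine D a2" "lip_affine D Z" "lip_affine D N"
  shows "lip_affine D (\<lambda>\<epsilon> x. fE (a1 \<epsilon> x) (a2 \<epsilon> x) a3 a4 \<epsilon> (Z \<epsilon> x) (N \<epsilon> x))"
  unfolding fE_def divide_inverse
  by (intro lip_affine_add lip_affine_scaleR lip_affine_mult lip_affine_power lip_affine_const lip_affine_eps assms)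

lemma lip_affine_fO:
  assumes "lip_affine D a1" "lip_affine D a2" "lip_affine D Z" "lip_affine D N"
  shows "lip_affine D (\<lambda>\<epsilon> x. fO (a1 \<epsilon> x) (a2 \<epsilon> x) a3 a4 \<epsilon> (Z \<epsilon> x) (N \<epsilon> x))"
  unfolding fO_def divide_inverse
  by (intro lip_affine_add lip_affine_scaleR lip_affine_mult lip_affine_power lip_affine_const lip_affine_eps assms)

text \<open>The unknown function is P0 + \<epsilon> (W + e + \<epsilon> ob). By parity
  \<open>r2\<close> vanishes on the even right-hand side and \<open>r1\<close> on the odd one, which
  leaves one scalar condition each.\<close>

definition reduced_solution ::
  "real \<Rightarrow> real \<Rightarrow> real \<Rightarrow> real \<Rightarrow> real ps ps \<Rightarrow> real ps ps \<Rightarrow> real \<Rightarrow> real ps ps \<Rightarrow> real ps ps \<Rightarrow> bool" where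
  "reduced_solution a1 a2 a3 a4 P0 W \<epsilon> e ob \<longleftrightarrow> flip e = e \<and> flip ob = - ob \<and>
     (let E = fE a1 a2 a3 a4 \<epsilon> (P0 + \<epsilon> *\<^sub>R e) (W + \<epsilon> *\<^sub>R ob); B = fO a1 a2 a3 a4 \<epsilon> (P0 + \<epsilon> *\<^sub>R e) (W + \<epsilon> *\<^sub>R ob)
      in e = sol E \<and> ob = sol B \<and> r1 E = 0 \<and> r2 B = 0)"

text \<open>
  The kernel components of the two equations are met by adjusting the two lowest coefficients of the
  nonlinearity. At \<open>\<epsilon> = 0\<close> the even equation no longer involves \<open>ob\<close>, and after the Newton-type
  update of \<open>(p1, p2)\<close> the fixed point map is constant there; for small \<open>\<epsilon>\<close> it is a contraction.
\<close>

theorem lyapunov_schmidt_branch: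
  fixes P0 W :: "real ps ps" and c1 c2 c3 c4 :: real
  assumes P0: "flip P0 = P0" and W: "flip W = - W"
    and H1: "r1 (fE c1 c2 c3 c4 0 P0 W) = 0" and H2: "r2 (fO c1 c2 c3 c4 0 P0 W) = 0"
    and det: "r1 P0 * r2 (P0 * W) - r1 (P0 ^ 2) / 2 * r2 W \<noteq> 0"
  obtains \<epsilon>0 C where "\<epsilon>0 > 0" "\<epsilon>0 \<le> 1"
    "\<And>\<epsilon>. \<epsilon> \<in> {0..\<epsilon>0} \<Longrightarrow> \<exists>e ob p1 p2. reduced_solution (c1 + p1) (c2 + p2) c3 c4 P0 W \<epsilon> e ob \<and>
      norm e \<le> C \<and> norm ob \<le> C \<and>
      norm (ob - sol (fO c1 c2 c3 c4 0 P0 W)) \<le> C * \<epsilon>"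
proof -
  define m11 m12 m21 m22 where m: "m11 = r1 P0" "m12 = r1 (P0 ^ 2) / 2" "m21 = r2 W" "m22 = r2 (P0 * W)"
  define d where "d = m11 * m22 - m12 * m21"
  have d: "d \<noteq> 0" using det by (simp add: d_def m)
  interpret R1: bounded_linear r1 by (rule bounded_linear_r1)
  interpret R2: bounded_linear r2 by (rule bounded_linear_r2)
  interpret F: bounded_linear flip by (rule bounded_linear_flip)
  let ?e = "\<lambda>x :: real ps ps \<times> real ps ps \<times> real \<times> real. fst x"
  let ?o = "\<lambda>x :: real ps ps \<times> real ps ps \<times> real \<times> real. fst (snd x)"
  let ?p1 = "\<lambda>x :: real ps ps \<times> real ps ps \<times> real \<times> real. fst (snd (snd x))"
  let ?p2 = "\<lambda>x :: real ps ps \<times> real ps ps \<times> real \<times> real. snd (snd (snd x))"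
  define Z where "Z \<epsilon> x = P0 + \<epsilon> *\<^sub>R ?e x" for \<epsilon> x
  define N where "N \<epsilon> x = W + \<epsilon> *\<^sub>R ?o x" for \<epsilon> x
  define R1x where "R1x \<epsilon> x = r1 (fE (c1 + ?p1 x) (c2 + ?p2 x) c3 c4 \<epsilon> (Z \<epsilon> x) (N \<epsilon> x))" for \<epsilon> x
  define R2x where "R2x \<epsilon> x = r2 (fO (c1 + ?p1 x) (c2 + ?p2 x) c3 c4 \<epsilon> (Z \<epsilon> x) (N \<epsilon> x))" for \<epsilon> x
  \<comment> \<open>One Newton step for the residuals \<open>R1x\<close>, \<open>R2x\<close>: at
    \<epsilon> = 0 they are linear in (p1, p2) with matrix \<open>m\<close>, whose inverse is
    written out with determinant \<open>d\<close>.\<close>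
  define q1 where "q1 \<epsilon> x = ?p1 x - (m22 / d * R1x \<epsilon> x - m12 / d * R2x \<epsilon> x)" for \<epsilon> x
  define q2 where "q2 \<epsilon> x = ?p2 x - (m11 / d * R2x \<epsilon> x - m21 / d * R1x \<epsilon> x)" for \<epsilon> x
  \<comment> \<open>The updated \<open>q1\<close>, \<open>q2\<close> enter the nonlinearity in place
    of \<open>p1\<close>, \<open>p2\<close>. Since they vanish at \<epsilon> = 0, the whole map is
    constant there.\<close>
  define T where "T \<epsilon> x = (sol (fE (c1 + q1 \<epsilon> x) (c2 + q2 \<epsilon> x) c3 c4 \<epsilon> (Z \<epsilon> x) (N \<epsilon> x)),
      sol (fO (c1 + q1 \<epsilon> x) (c2 + q2 \<epsilon> x) c3 c4 \<epsilon> (Z \<epsilon> x) (N \<epsilon> x)), q1 \<epsilon> x, q2 \<epsilon> x)" for \<epsilon> x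
  define x0 where "x0 = (sol (fE c1 c2 c3 c4 0 P0 W), sol (fO c1 c2 c3 c4 0 P0 W), 0 :: real, 0 :: real)"
  define V where "V = {x :: real ps ps \<times> real ps ps \<times> real \<times> real. flip (?e x) = ?e x \<and> flip (?o x) = - ?o x}"
  have gid: "lip_affine (cball x0 1) (\<lambda>\<epsilon> x. x)" by (rule lip_affine_id) simp
  have gp: "lip_affine (cball x0 1) (\<lambda>\<epsilon>. ?e)" "lip_affine (cball x0 1) (\<lambda>\<epsilon>. ?o)"
    "lip_affine (cball x0 1) (\<lambda>\<epsilon>. ?p1)" "lip_affine (cball x0 1) (\<lambda>\<epsilon>. ?p2)"
    by (intro lip_affine_linear[OF bounded_linear_fst] lip_affine_linear[OF bounded_linear_snd] gid)+
  have gZ: "lip_affine (cball x0 1) Z" "lip_affine (cball x0 1) N"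
    unfolding Z_def[abs_def] N_def[abs_def]
    by (intro lip_affine_add lip_affine_const lip_affine_scaleR lip_affine_eps gp)+
  have gR: "lip_affine (cball x0 1) R1x" "lip_affine (cball x0 1) R2x"
    unfolding R1x_def[abs_def] R2x_def[abs_def]
    by (intro lip_affine_linear[OF bounded_linear_r1] lip_affine_linear[OF bounded_linear_r2] lip_affine_fE lip_affine_fO
        lip_affine_add lip_affine_const gp gZ)+
  have gq: "lip_affine (cball x0 1) q1" "lip_affine (cball x0 1) q2"
    unfolding q1_def[abs_def] q2_def[abs_def]
    by (intro lip_affine_diff lip_affine_mult lip_affine_const gp gR)+
  have gT: "lip_affine (cball x0 1) T"
    unfolding T_def[abs_def]
    by (intro lip_affine_Pair lip_affine_linear[OF bounded_linear_sol] lip_affine_fE lip_affine_fO lip_affine_add lip_affine_const gq gZ)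
  have T0: "T 0 x = x0" for x
  proof -
    have "fE (c1 + ?p1 x) (c2 + ?p2 x) c3 c4 0 P0 W =
        fE c1 c2 c3 c4 0 P0 W + ?p1 x *\<^sub>R P0 + (?p2 x / 2) *\<^sub>R P0 ^ 2"
      by (simp add: fE_def algebra_simps add_divide_distrib)
    then have 1: "R1x 0 x = ?p1 x * m11 + ?p2 x * m12"
      by (simp add: R1x_def Z_def N_def R1.add R1.scaleR H1 m)
    have "fO (c1 + ?p1 x) (c2 + ?p2 x) c3 c4 0 P0 W =
        fO c1 c2 c3 c4 0 P0 W + ?p1 x *\<^sub>R W + ?p2 x *\<^sub>R (P0 * W)"
      by (simp add: fO_def algebra_simps)
    then have 2: "R2x 0 x = ?p1 x * m21 + ?p2 x * m22"
      by (simp add: R2x_def Z_def N_def R2.add R2.scaleR H2 m)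
    have "q1 0 x = 0"
    proof -
      have "m22 / d * R1x 0 x - m12 / d * R2x 0 x = ?p1 x * (d / d)"
        unfolding 1 2 by (simp add: d_def field_simps)
      then show ?thesis using d by (simp add: q1_def)
    qed
    moreover have "q2 0 x = 0"
    proof -
      have "m11 / d * R2x 0 x - m21 / d * R1x 0 x = ?p2 x * (d / d)"
        unfolding 1 2 by (simp add: d_def field_simps)
      then show ?thesis using d by (simp add: q2_def)
    qed
    ultimately show ?thesis
      by (simp add: T_def x0_def Z_def N_def)
  qed
  have TV: "T \<epsilon> x \<in> V" if "x \<in> V" for \<epsilon> x
  proof -
    have "flip (Z \<epsilon> x) = Z \<epsilon> x" "flip (N \<epsilon> x) = - N \<epsilon> x"
      using that by (simp_all add: V_def Z_def N_def F.add F.scaleR P0 W)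
    from flip_fE_fO[OF this] show ?thesis
      by (simp add: V_def T_def flip_sol linear_neg bounded_linear.linear[OF bounded_linear_sol])
  qed
  have clV: "closed V"
    unfolding V_def
    by (intro closed_Collect_conj closed_Collect_eq continuous_intros
        bounded_linear.continuous_on[OF bounded_linear_flip])
  have "x0 \<in> V"
    using flip_fE_fO[OF P0 W]
    by (simp add: V_def x0_def flip_sol linear_neg bounded_linear.linear[OF bounded_linear_sol])
  from perturbed_fixed_point[OF clV this TV gT T0] obtain \<epsilon>0 C where
    e0: "\<epsilon>0 > 0" "\<epsilon>0 \<le> 1" and
    fp: "\<And>\<epsilon>. \<epsilon> \<in> {0..\<epsilon>0} \<Longrightarrow> \<exists>x\<in>V. T \<epsilon> x = x \<and> norm (x - x0) \<le> C * \<epsilon>"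
    by blast
  define K where "K = \<bar>C\<bar> + norm (fst x0) + norm (fst (snd x0))"
  show ?thesis
  proof (rule that[OF e0, of K])
    fix \<epsilon> assume eps: "\<epsilon> \<in> {0..\<epsilon>0}"
    then obtain x where x: "x \<in> V" "T \<epsilon> x = x" "norm (x - x0) \<le> C * \<epsilon>"
      using fp by blast
    have nle: "norm (fst y) \<le> norm y" "norm (fst (snd y)) \<le> norm y" for y :: "real ps ps \<times> real ps ps \<times> real \<times> real"
      using norm_fst_le[of "fst y" "snd y"] norm_fst_le[of "fst (snd y)" "snd (snd y)"]
        norm_snd_le[of "snd y" "fst y"] by simp_all
    have q: "q1 \<epsilon> x = ?p1 x" "q2 \<epsilon> x = ?p2 x"
      "sol (fE (c1 + q1 \<epsilon> x) (c2 + q2 \<epsilon> x) c3 c4 \<epsilon> (Z \<epsilon> x) (N \<epsilon> x)) = ?e x"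
      "sol (fO (c1 + q1 \<epsilon> x) (c2 + q2 \<epsilon> x) c3 c4 \<epsilon> (Z \<epsilon> x) (N \<epsilon> x)) = ?o x"
      using arg_cong[OF x(2), of ?p1] arg_cong[OF x(2), of ?p2] arg_cong[OF x(2), of ?e] arg_cong[OF x(2), of ?o]
      by (simp_all add: T_def)
    \<comment> \<open>At a fixed point the Newton correction is zero, and invertibility of the
      matrix forces both residuals to vanish.\<close>
    have "m22 * R1x \<epsilon> x - m12 * R2x \<epsilon> x = 0" "m11 * R2x \<epsilon> x - m21 * R1x \<epsilon> x = 0"
      using q(1,2) d by (simp_all add: q1_def q2_def field_simps)
    then have "d * R1x \<epsilon> x = 0" "d * R2x \<epsilon> x = 0"
      unfolding d_def by algebra+
    then have R: "R1x \<epsilon> x = 0" "R2x \<epsilon> x = 0" using d by auto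
    have n: "norm (?e x - fst x0) \<le> C * \<epsilon>" "norm (?o x - fst (snd x0)) \<le> C * \<epsilon>"
      using nle[of "x - x0"] x(3) by auto
    have "C * \<epsilon> \<le> \<bar>C\<bar> * 1"
      using eps e0 by (intro mult_mono) auto
    then have b: "norm (?e x) \<le> K" "norm (?o x) \<le> K"
      using n norm_triangle_sub[of "?e x" "fst x0"] norm_triangle_sub[of "?o x" "fst (snd x0)"]
        norm_ge_zero[of "fst x0"] norm_ge_zero[of "fst (snd x0)"]
      unfolding K_def by linarith+
    have "C \<le> K"
      using abs_ge_self[of C] norm_ge_zero[of "fst x0"] norm_ge_zero[of "fst (snd x0)"]
      unfolding K_def by linarith
    then have "C * \<epsilon> \<le> K * \<epsilon>"
      using eps by (intro mult_right_mono) auto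
    with n(2) have "norm (?o x - sol (fO c1 c2 c3 c4 0 P0 W)) \<le> K * \<epsilon>"
      by (simp add: x0_def)
    then show "\<exists>e ob p1 p2. reduced_solution (c1 + p1) (c2 + p2) c3 c4 P0 W \<epsilon> e ob \<and>
      norm e \<le> K \<and> norm ob \<le> K \<and>
      norm (ob - sol (fO c1 c2 c3 c4 0 P0 W)) \<le> K * \<epsilon>"
      using x(1) q R b
      by (intro exI[of _ "?e x"] exI[of _ "?o x"] exI[of _ "?p1 x"] exI[of _ "?p2 x"])
        (simp add: V_def R1x_def R2x_def Z_def N_def reduced_solution_def)
  qed
qed

lemma evS_arith:
  assumes "x \<in> S2"
  shows "evS (u + v) x = evS u x + evS v x" "evS (u - v) x = evS u x - evS v x"
    "evS (- u) x = - evS u x" "evS (r *\<^sub>R u) x = r * evS u x" "evS 0 x = 0"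
    "evS (u ^ n) x = evS u x ^ n" "evS (u * v) x = evS u x * evS v x" "evS 1 x = 1"
  unfolding evS_def using S2_bounds[OF assms] by (simp_all add: ev_arith ev_mult ev_1)

subsection \<open>Integrals over the sphere\<close>

abbreviation (input) box :: "(real \<times> real) set" where
  "box \<equiv> cbox (0, 0) (pi, 2 * pi)"

definition sphint :: "(real \<times> real \<Rightarrow> real) \<Rightarrow> real" where
  "sphint f = integral box f"

lemma box_eq: "{0..pi} \<times> {0..2 * pi} = box"
  by (auto simp: cbox_Pair_eq)

lemma sph_nth: "sph \<theta> \<phi> $ 1 = sin \<theta> * cos \<phi>" "sph \<theta> \<phi> $ 2 = sin \<theta> * sin \<phi>" "sph \<theta> \<phi> $ 3 = cos \<theta>"
  by (simp_all add: sph_def)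

lemma sph_S2: "sph \<theta> \<phi> \<in> S2"
proof -
  have "(sin \<theta> * cos \<phi>)\<^sup>2 + (sin \<theta> * sin \<phi>)\<^sup>2 = (sin \<theta>)\<^sup>2"
    by (simp add: power_mult_distrib flip: distrib_left)
  then show ?thesis unfolding S2_iff sph_nth by simp
qed

lemma sph_w: "(sin (\<theta>::real) * cos \<phi>)\<^sup>2 - (sin \<theta> * sin \<phi>)\<^sup>2 = (sin \<theta>)\<^sup>2 * cos (2 * \<phi>)"
  by (simp add: cos_double power_mult_distrib right_diff_distrib)

lemma evS_sph: "evS u (sph \<theta> \<phi>) = ev u (cos \<theta>) ((sin \<theta>)\<^sup>2 * cos (2 * \<phi>))"
  by (simp add: evS_def sph_nth sph_w)

lemma continuous_on_ev: "continuous_on ({-1..1} \<times> {-1..1}) (\<lambda>(z, w). ev u z w)"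
proof -
  let ?S = "{-1..1} \<times> {-1..1} :: (real \<times> real) set"
  let ?f = "\<lambda>k (z, w). zcoef u k * (case prod_decode k of (i, j) \<Rightarrow> z ^ i * w ^ j) :: real"
  have b: "\<bar>z ^ i * w ^ j\<bar> \<le> 1 * wt i j" if "(z, w) \<in> ?S" for z w :: real and i j
  proof -
    have "\<bar>z ^ i * w ^ j\<bar> \<le> 1"
      using that by (auto simp: abs_mult power_abs intro!: mult_le_one power_le_one)
    with wt_ge(3)[of i j] show ?thesis by linarith
  qed
  have "uniform_limit ?S (\<lambda>n p. \<Sum>k<n. ?f k p) (\<lambda>p. \<Sum>k. ?f k p) sequentially"
  proof (rule Weierstrass_m_test[OF _ summable_zcoef])
    fix k p assume "p \<in> ?S"
    then show "norm (?f k p) \<le> \<bar>zcoef u k\<bar> * wtk k"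
      using b[of "fst p" "snd p"] by (auto simp: abs_mult split: prod.splits intro!: mult_left_mono)
  qed
  moreover have "continuous_on ?S (\<lambda>p. \<Sum>k<n. ?f k p)" for n
    by (auto simp: case_prod_beta intro!: continuous_intros)
  ultimately have "continuous_on ?S (\<lambda>p. \<Sum>k. ?f k p)"
    by (intro uniform_limit_theorem[OF always_eventually]) auto
  moreover have "(\<Sum>k. ?f k (z, w)) = ev u z w" if "(z, w) \<in> ?S" for z w
    using linz_sums(2)[OF b[OF that], of u] ev_eq_linz[of z w u] that by (auto simp: sums_iff)
  ultimately show ?thesis
    by (subst continuous_on_cong[OF refl]) auto
qed

lemma sin2cos_bound: "\<bar>(sin \<theta>)\<^sup>2 * cos \<phi>\<bar> \<le> (1::real)"
  unfolding abs_mult by (intro mult_le_one) (auto simp: abs_square_le_1)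

lemma continuous_on_evS_sph: "continuous_on A (\<lambda>p. evS u (sph (fst p) (snd p)))"
proof -
  have "continuous_on A (\<lambda>p. (\<lambda>(z, w). ev u z w) (cos (fst p), (sin (fst p))\<^sup>2 * cos (2 * snd p)))"
    using sin2cos_bound
    by (intro continuous_on_compose2[OF continuous_on_ev] continuous_intros)
      (auto simp: abs_le_iff minus_le_iff)
  then show ?thesis by (simp add: evS_sph)
qed

lemma evS_ze_sph: "evS (ze i j) (sph \<theta> \<phi>) = cos \<theta> ^ i * ((sin \<theta>)\<^sup>2 * cos (2 * \<phi>)) ^ j"
  by (simp add: evS_ze[OF sph_S2] sph_nth sph_w)

definition tau :: "int \<Rightarrow> real \<Rightarrow> real" where
  "tau m \<phi> = (if m \<ge> 0 then cos (of_int m * \<phi>) else sin (of_int \<bar>m\<bar> * \<phi>))"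

definition yc :: "nat \<Rightarrow> int \<Rightarrow> real" where
  "yc n m = (if m = 0 then sqrt ((2 * real n + 1) / (4 * pi)) else
      (-1) ^ nat \<bar>m\<bar> * sqrt 2 *
      sqrt ((2 * real n + 1) / (4 * pi) * (fact (n - nat \<bar>m\<bar>) / fact (n + nat \<bar>m\<bar>))))"

lemma sph_harm_coord_eq:
  "sph_harm_coord n m \<theta> \<phi> = yc n m * assoc_legendre n (nat \<bar>m\<bar>) (cos \<theta>) * tau m \<phi>"
  by (auto simp: sph_harm_coord_def yc_def tau_def assoc_legendre_def)

lemma continuous_on_sph_harm_coord: "continuous_on A (\<lambda>p. sph_harm_coord n m (fst p) (snd p))"
  unfolding sph_harm_coord_eq assoc_legendre_def tau_def
  by (cases "m \<ge> 0") (auto intro!: continuous_intros)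

lemma integrable_box: "continuous_on box f \<Longrightarrow> f integrable_on box" for f :: "real \<times> real \<Rightarrow> real"
  by (rule integrable_continuous)

lemma l2_inner_eq_sphint:
  assumes "\<And>x. x \<in> S2 \<Longrightarrow> f x = evS u x"
  shows "l2_inner f (sph_harm n m) =
    sphint (\<lambda>p. evS u (sph (fst p) (snd p)) * sph_harm_coord n m (fst p) (snd p) * sin (fst p))"
proof -
  let ?g = "\<lambda>p. evS u (sph (fst p) (snd p)) * sph_harm_coord n m (fst p) (snd p) * sin (fst p)"
  have "l2_inner f (sph_harm n m) = (LINT p : box | lborel. ?g p)"
    unfolding l2_inner_def box_eq
  proof (rule set_lebesgue_integral_cong)
    show "box \<in> sets lborel" by simp
  qed (auto simp: assms[OF sph_S2] sph_harm_sph cbox_Pair_eq)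
  also have "\<dots> = sphint ?g"
    unfolding sphint_def
  proof (rule set_borel_integral_eq_integral)
    show "set_integrable lborel box ?g"
      unfolding set_integrable_def
      by (intro borel_integrable_compact compact_cbox continuous_intros
          continuous_on_evS_sph continuous_on_sph_harm_coord)
  qed
  finally show ?thesis .
qed

text \<open>The inner product with a spherical harmonic as a gauge integral over the coordinate
  rectangle, a form that splits into iterated integrals on monomials.\<close>

definition fourier :: "nat \<Rightarrow> int \<Rightarrow> real ps ps \<Rightarrow> real" where
  "fourier n m u = sphint (\<lambda>p. evS u (sph (fst p) (snd p)) * sph_harm_coord n m (fst p) (snd p) * sin (fst p))"

text \<open>20 is a round bound for 2 pi^2, the area of the coordinate rectangle.\<close>

lemma fourier_bound:
  assumes Y: "\<And>\<theta> \<phi>. \<bar>sph_harm_coord n m \<theta> \<phi>\<bar> \<le> B"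
    and K: "\<And>x. x \<in> S2 \<Longrightarrow> \<bar>evS u x\<bar> \<le> K"
  shows "\<bar>fourier n m u\<bar> \<le> 20 * B * K"
proof -
  have B0: "B \<ge> 0" "K \<ge> 0" using Y[of 0 0] K[OF sph_S2[of 0 0]] by linarith+
  let ?f = "\<lambda>p. evS u (sph (fst p) (snd p)) * sph_harm_coord n m (fst p) (snd p) * sin (fst p)"
  have "norm (integral box ?f) \<le> integral box (\<lambda>p. K * B)"
  proof (rule integral_norm_bound_integral)
    show "?f integrable_on box"
      by (intro integrable_box continuous_intros continuous_on_evS_sph continuous_on_sph_harm_coord)
    fix p :: "real \<times> real"
    have "\<bar>?f p\<bar> \<le> (K * B) * 1"
      unfolding abs_mult by (intro mult_mono K sph_S2 Y) (auto simp: B0)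
    then show "norm (?f p) \<le> K * B" by simp
  qed (intro integrable_box continuous_intros)
  also have "\<dots> = K * B * (2 * pi\<^sup>2)"
    by (simp add: content_Pair power2_eq_square)
  also have "\<dots> \<le> K * B * 20"
  proof (rule mult_left_mono)
    have "pi\<^sup>2 \<le> 3.15\<^sup>2" using pi_approx by (intro power_mono) auto
    then show "2 * pi\<^sup>2 \<le> 20" by (simp add: power2_eq_square)
  qed (use B0 in simp)
  finally show ?thesis by (simp add: fourier_def sphint_def mult_ac)
qed

lemma fourier_linear:
  "fourier n m (u + v) = fourier n m u + fourier n m v" "fourier n m (r *\<^sub>R u) = r * fourier n m u"
proof -
  let ?f = "\<lambda>u p. evS u (sph (fst p) (snd p)) * sph_harm_coord n m (fst p) (snd p) * sin (fst p)"
  have I: "?f u integrable_on box" for u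
    by (intro integrable_box continuous_intros continuous_on_evS_sph continuous_on_sph_harm_coord)
  have "?f (u + v) = (\<lambda>p. ?f u p + ?f v p)" "?f (r *\<^sub>R u) = (\<lambda>p. r * ?f u p)"
    by (simp_all add: fun_eq_iff evS_arith[OF sph_S2] algebra_simps)
  then show "fourier n m (u + v) = fourier n m u + fourier n m v" "fourier n m (r *\<^sub>R u) = r * fourier n m u"
    unfolding fourier_def sphint_def by (simp_all only: integral_add[OF I I] integral_mult_right)
qed

lemma assoc_legendre_bounded: "\<exists>B. \<forall>\<theta>. \<bar>assoc_legendre n m (cos \<theta>)\<bar> \<le> B"
proof -
  have "continuous_on {-1..1} (assoc_legendre n m)"
    unfolding assoc_legendre_def by (intro continuous_intros)
  then have "bounded (assoc_legendre n m ` {-1..1})"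
    by (intro compact_imp_bounded compact_continuous_image) auto
  then obtain B where "\<forall>s\<in>{-1..1}. \<bar>assoc_legendre n m s\<bar> \<le> B"
    by (auto simp: bounded_iff)
  then show ?thesis by (intro exI[of _ B]) auto
qed

lemma tau_le: "\<bar>tau m \<phi>\<bar> \<le> 1"
  by (simp add: tau_def)

lemma bounded_linear_fourier: "bounded_linear (fourier n m)"
proof -
  obtain B where B: "\<And>\<theta>. \<bar>assoc_legendre n (nat \<bar>m\<bar>) (cos \<theta>)\<bar> \<le> B"
    using assoc_legendre_bounded by blast
  have "\<bar>sph_harm_coord n m \<theta> \<phi>\<bar> \<le> \<bar>yc n m\<bar> * B * 1" for \<theta> \<phi>
    unfolding sph_harm_coord_eq abs_mult
    using B[of 0] by (intro mult_mono B tau_le) auto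
  from fourier_bound[OF this evS_bound] show ?thesis
    by (intro bounded_linear_intro[where K = "20 * (\<bar>yc n m\<bar> * B * 1)"])
      (auto simp: fourier_linear mult_ac)
qed

definition thint :: "(real \<Rightarrow> real) \<Rightarrow> real" where
  "thint f = integral {0..pi} f"

definition phint :: "nat \<Rightarrow> int \<Rightarrow> real" where
  "phint j m = integral {0..2 * pi} (\<lambda>\<phi>. cos (2 * \<phi>) ^ j * tau m \<phi>)"

lemma fourier_ze:
  "fourier n m (ze i j) = yc n m *
    thint (\<lambda>\<theta>. cos \<theta> ^ i * (sin \<theta>) ^ (2 * j) * assoc_legendre n (nat \<bar>m\<bar>) (cos \<theta>) * sin \<theta>) * phint j m"
proof -
  let ?h = "\<lambda>\<theta>. cos \<theta> ^ i * (sin \<theta>) ^ (2 * j) * assoc_legendre n (nat \<bar>m\<bar>) (cos \<theta>) * sin \<theta>"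
  let ?k = "\<lambda>\<phi>. cos (2 * \<phi>) ^ j * tau m \<phi>"
  let ?f = "\<lambda>p. evS (ze i j) (sph (fst p) (snd p)) * sph_harm_coord n m (fst p) (snd p) * sin (fst p)"
  have C: "continuous_on box ?f"
    by (intro continuous_intros continuous_on_evS_sph continuous_on_sph_harm_coord)
  have "fourier n m (ze i j) = integral {0..pi} (\<lambda>\<theta>. integral {0..2 * pi} (\<lambda>\<phi>. ?f (\<theta>, \<phi>)))"
    unfolding fourier_def sphint_def integral_prod_continuous[OF C] by (simp add: cbox_interval)
  also have "(\<lambda>\<theta> \<phi>. ?f (\<theta>, \<phi>)) = (\<lambda>\<theta> \<phi>. (yc n m * ?h \<theta>) * ?k \<phi>)"
    by (auto simp: fun_eq_iff evS_ze_sph sph_harm_coord_eq power_mult_distrib power_mult[symmetric] mult_ac)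
  finally have "fourier n m (ze i j) = integral {0..pi} (\<lambda>\<theta>. integral {0..2 * pi} (\<lambda>\<phi>. (yc n m * ?h \<theta>) * ?k \<phi>))"
    by (simp add: fun_eq_iff)
  then show ?thesis
    unfolding thint_def phint_def by (simp only: integral_mult_right integral_mult_left)
qed

subsection \<open>Longitudinal integrals\<close>

definition cint :: "nat \<Rightarrow> int \<Rightarrow> real" where
  "cint j k = integral {0..2 * pi} (\<lambda>\<phi>. cos (2 * \<phi>) ^ j * cos (of_int k * \<phi>))"

definition sint :: "nat \<Rightarrow> int \<Rightarrow> real" where
  "sint j k = integral {0..2 * pi} (\<lambda>\<phi>. cos (2 * \<phi>) ^ j * sin (of_int k * \<phi>))"

lemma cint_Suc: "cint (Suc j) k = (cint j (k + 2) + cint j (k - 2)) / 2"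
proof -
  have eq: "cos (2 * \<phi>) * cos (of_int k * \<phi>) = (cos (of_int (k + 2) * \<phi>) + cos (of_int (k - 2) * \<phi>)) / 2" for \<phi> :: real
    by (simp add: distrib_right left_diff_distrib cos_add cos_diff)
  have pt: "cos (2 * \<phi>) ^ Suc j * cos (of_int k * \<phi>) =
      (cos (2 * \<phi>) ^ j * cos (of_int (k + 2) * \<phi>) + cos (2 * \<phi>) ^ j * cos (of_int (k - 2) * \<phi>)) / 2" for \<phi> :: real
    unfolding power_Suc2 mult.assoc eq by (simp add: distrib_left del: of_int_add of_int_diff)
  show ?thesis
    unfolding cint_def pt integral_divide
    by (subst integral_add)
      (auto intro!: integrable_continuous_real continuous_intros)
qed

lemma sint_Suc: "sint (Suc j) k = (sint j (k + 2) + sint j (k - 2)) / 2"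
proof -
  have eq: "cos (2 * \<phi>) * sin (of_int k * \<phi>) = (sin (of_int (k + 2) * \<phi>) + sin (of_int (k - 2) * \<phi>)) / 2" for \<phi> :: real
    by (simp add: distrib_right left_diff_distrib sin_add sin_diff)
  have pt: "cos (2 * \<phi>) ^ Suc j * sin (of_int k * \<phi>) =
      (cos (2 * \<phi>) ^ j * sin (of_int (k + 2) * \<phi>) + cos (2 * \<phi>) ^ j * sin (of_int (k - 2) * \<phi>)) / 2" for \<phi> :: real
    unfolding power_Suc2 mult.assoc eq by (simp add: distrib_left del: of_int_add of_int_diff)
  show ?thesis
    unfolding sint_def pt integral_divide
    by (subst integral_add)
      (auto intro!: integrable_continuous_real continuous_intros)
qed

lemma cint_0: "cint 0 k = (if k = 0 then 2 * pi else 0)"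
proof (cases "k = 0")
  case False
  have "((\<lambda>\<phi>. cos (of_int k * \<phi>)) has_integral
      (sin (of_int k * (2 * pi)) / of_int k - sin (of_int k * 0) / of_int k)) {0..2 * pi}"
    using False by (intro fundamental_theorem_of_calculus)
      (auto simp flip: has_real_derivative_iff_has_vector_derivative intro!: derivative_eq_intros)
  moreover have "sin (of_int k * (2 * pi)) = 0"
    using sin_int_2pin[of k] by (simp add: mult_ac)
  ultimately show ?thesis using False by (simp add: cint_def integral_unique)
qed (simp add: cint_def)

lemma sint_0: "sint 0 k = 0"
proof (cases "k = 0")
  case False
  have "((\<lambda>\<phi>. sin (of_int k * \<phi>)) has_integral
      (- cos (of_int k * (2 * pi)) / of_int k - (- cos (of_int k * 0) / of_int k))) {0..2 * pi}"
    using False by (intro fundamental_theorem_of_calculus)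
      (auto simp flip: has_real_derivative_iff_has_vector_derivative intro!: derivative_eq_intros)
  moreover have "cos (of_int k * (2 * pi)) = 1"
    using cos_int_2pin[of k] by (simp add: mult_ac)
  ultimately show ?thesis using False by (simp add: sint_def integral_unique)
qed (simp add: sint_def)

lemma sint_eq_0: "sint j k = 0"
  by (induction j arbitrary: k) (simp_all add: sint_0 sint_Suc)

text \<open>cos(2 \<phi>)^j contains only the frequencies 2 j, 2 j - 4, ..., - 2 j. Their range and
  evenness are used here, the step of 4 in \<open>cint_parity\<close>.\<close>

lemma cint_eq_0: "odd k \<or> \<bar>k\<bar> > 2 * int j \<Longrightarrow> cint j k = 0"
proof (induction j arbitrary: k)
  case (Suc j)
  have "cint j (k + 2) = 0" "cint j (k - 2) = 0"
    using Suc.prems by (auto intro!: Suc.IH)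
  then show ?case by (simp add: cint_Suc)
qed (auto simp: cint_0)

lemma cint_parity: "even k \<Longrightarrow> odd (k div 2 + int j) \<Longrightarrow> cint j k = 0"
proof (induction j arbitrary: k)
  case (Suc j)
  have "(k + 2) div 2 = k div 2 + 1" "(k - 2) div 2 = k div 2 - 1" by auto
  then have "cint j (k + 2) = 0" "cint j (k - 2) = 0"
    using Suc.prems by (auto intro!: Suc.IH)
  then show ?case by (simp add: cint_Suc)
qed (auto simp: cint_0)

lemma phint_eq: "phint j m = (if m \<ge> 0 then cint j m else 0)"
  using sint_eq_0[of j m] by (simp add: phint_def tau_def cint_def sint_def)

lemma phint_1_2: "phint 1 2 = pi"
  by (simp add: phint_eq cint_Suc cint_0)

lemma phint_even_2: "even j \<Longrightarrow> phint j 2 = 0"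
  by (simp add: phint_eq cint_parity)

subsection \<open>Latitudinal integrals\<close>

text \<open>After s = cos \<theta> this is the integral of \<open>q\<close> over [-1, 1].\<close>

definition J :: "real poly \<Rightarrow> real" where
  "J q = thint (\<lambda>\<theta>. poly q (cos \<theta>) * sin \<theta>)"

lemma J_integrable: "(\<lambda>\<theta>. poly q (cos \<theta>) * sin \<theta>) integrable_on {0..pi}"
  by (intro integrable_continuous_real continuous_intros)

lemma J_add: "J (p + q) = J p + J q"
  unfolding J_def thint_def by (simp add: distrib_right integral_add[OF J_integrable J_integrable])

lemma J_smult: "J (smult c q) = c * J q"
  unfolding J_def thint_def by (simp add: mult.assoc)

lemma J_0: "J 0 = 0"
  by (simp add: J_def thint_def)

lemma J_pderiv: "J (pderiv q) = poly q 1 - poly q (-1)"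
proof -
  have "((\<lambda>\<theta>. poly (pderiv q) (cos \<theta>) * sin \<theta>) has_integral (- poly q (cos pi) - - poly q (cos 0))) {0..pi}"
    by (intro fundamental_theorem_of_calculus)
      (auto simp flip: has_real_derivative_iff_has_vector_derivative intro!: derivative_eq_intros)
  then show ?thesis
    by (simp add: J_def thint_def integral_unique)
qed

lemma J_parts:
  assumes "poly (a * b) 1 = 0" "poly (a * b) (-1) = 0"
  shows "J (a * pderiv b) = - J (pderiv a * b)"
proof -
  have "J (a * pderiv b) + J (pderiv a * b) = J (pderiv (a * b))"
    by (simp add: pderiv_mult J_add mult.commute)
  also have "\<dots> = 0" unfolding J_pderiv assms by simp
  finally show ?thesis by simp
qed

text \<open>Each integration by parts moves one derivative from \<open>b\<close> to
  \<open>a\<close>. The second hypothesis kills the boundary terms, and the first one what is left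
  at the end.\<close>

lemma J_parts_iterated:
  assumes "(pderiv ^^ N) a = 0"
    and "\<And>t s. t < N \<Longrightarrow> s = 1 \<or> s = -1 \<Longrightarrow>
      poly ((pderiv ^^ t) a) s * poly ((pderiv ^^ (N - 1 - t)) b) s = 0"
  shows "J (a * (pderiv ^^ N) b) = 0"
  using assms
proof (induction N arbitrary: a)
  case (Suc N)
  have "J (a * pderiv ((pderiv ^^ N) b)) = - J (pderiv a * (pderiv ^^ N) b)"
    using Suc.prems(2)[of 0] by (intro J_parts) auto
  also have "J (pderiv a * (pderiv ^^ N) b) = 0"
  proof (rule Suc.IH)
    show "(pderiv ^^ N) (pderiv a) = 0" using Suc.prems(1) by (simp add: funpow_swap1)
    show "poly ((pderiv ^^ t) (pderiv a)) s * poly ((pderiv ^^ (N - 1 - t)) b) s = 0"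
      if "t < N" "s = 1 \<or> s = -1" for t s
      using Suc.prems(2)[of "Suc t" s] that by (simp add: funpow_swap1)
  qed
  finally show ?case by simp
qed (simp add: J_0)

abbreviation (input) Q2 :: "real poly" where
  "Q2 \<equiv> [:-1, 0, 1:]"

lemma Q2_power_dvd_pderiv: "Q2 ^ k dvd f \<Longrightarrow> Q2 ^ (k - 1) dvd pderiv f"
proof (cases k)
  case (Suc k')
  assume "Q2 ^ k dvd f"
  then obtain c where f: "f = Q2 ^ Suc k' * c" using Suc by auto
  have "pderiv f = Q2 ^ k' * (Q2 * pderiv c + smult (of_nat (Suc k')) (pderiv Q2) * c)"
    unfolding f pderiv_mult pderiv_power_Suc by (simp add: algebra_simps)
  then show ?thesis using Suc by simp
qed simp

lemma poly_pderiv_Q2_power_eq_0: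
  assumes "Q2 ^ k dvd f" "t < k" "s = 1 \<or> s = -1"
  shows "poly ((pderiv ^^ t) f) s = 0"
proof -
  have "Q2 ^ (k - t) dvd (pderiv ^^ t) f"
  proof (induction t)
    case (Suc t)
    from Q2_power_dvd_pderiv[OF this] show ?case by simp
  qed (use assms in simp)
  moreover have "Q2 dvd Q2 ^ (k - t)"
    using assms(2) by (intro dvd_power) simp
  ultimately obtain c where "(pderiv ^^ t) f = Q2 * c"
    using dvd_trans by (metis dvdE)
  then show ?thesis
    using assms(3) by auto
qed

lemma pderiv_funpow_eq_0: "degree (a :: real poly) < N \<Longrightarrow> (pderiv ^^ N) a = 0"
proof (rule poly_eqI)
  fix k assume "degree a < N"
  then show "coeff ((pderiv ^^ N) a) k = coeff 0 k"
    by (simp add: coeff_higher_pderiv coeff_eq_0)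
qed

lemma pderiv_funpow_smult: "(pderiv ^^ m) (smult c q) = smult c ((pderiv ^^ m) (q :: real poly))"
  by (induction m) (simp_all add: pderiv_smult)

lemma pderiv_legendre:
  "(pderiv ^^ m) (legendre n) = smult (1 / (2 ^ n * fact n)) ((pderiv ^^ (n + m)) (Q2 ^ n))"
  by (simp add: legendre_def pderiv_funpow_smult funpow_add add.commute[of n])

text \<open>Rodrigues' formula and n + m integrations by parts. While fewer than k derivatives have
  reached the left factor, its zeros of order k at 1 and -1 kill the boundary terms; afterwards
  fewer than n derivatives remain on \<open>Q2 ^ n\<close>, because m <= k. Finally n + m exceeds
  the degree of the left factor.\<close>

lemma J_orthogonal:
  assumes k: "m \<le> k" and d: "i + 2 * k < n + m"
  shows "J (monom 1 i * Q2 ^ k * (pderiv ^^ m) (legendre n)) = 0"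
proof -
  have "J (monom 1 i * Q2 ^ k * (pderiv ^^ (n + m)) (Q2 ^ n)) = 0"
  proof (rule J_parts_iterated)
    have "degree (monom 1 i * Q2 ^ k :: real poly) \<le> i + 2 * k"
      by (rule order_trans[OF degree_mult_le])
        (intro add_mono degree_monom_le order_trans[OF degree_power_le], simp)
    then show "(pderiv ^^ (n + m)) (monom 1 i * Q2 ^ k :: real poly) = 0"
      using d by (intro pderiv_funpow_eq_0) simp
    show "poly ((pderiv ^^ t) (monom 1 i * Q2 ^ k)) s * poly ((pderiv ^^ (n + m - 1 - t)) (Q2 ^ n)) s = 0"
      if "t < n + m" "s = 1 \<or> s = -1" for t s
    proof (cases "t < k")
      case True
      then show ?thesis using poly_pderiv_Q2_power_eq_0[of k "monom 1 i * Q2 ^ k" t s] that by simp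
    next
      case False
      then have "n + m - 1 - t < n" using k that by simp
      then show ?thesis using poly_pderiv_Q2_power_eq_0[of n "Q2 ^ n" "n + m - 1 - t" s] that by simp
    qed
  qed
  then show ?thesis
    unfolding pderiv_legendre mult_smult_right J_smult by simp
qed

text \<open>For even order the square root disappears and the integrand is a polynomial in cos
  \<theta> times sin \<theta>; the sign stems from \<open>Q2\<close> being minus the squared
  sine.\<close>

lemma thint_assoc_legendre:
  "thint (\<lambda>\<theta>. cos \<theta> ^ i * sin \<theta> ^ (2 * j) * assoc_legendre n (2 * l) (cos \<theta>) * sin \<theta>) =
    (-1) ^ (j + l) * J (monom 1 i * Q2 ^ (j + l) * (pderiv ^^ (2 * l)) (legendre n))"
proof -
  have "thint (\<lambda>\<theta>. cos \<theta> ^ i * sin \<theta> ^ (2 * j) * assoc_legendre n (2 * l) (cos \<theta>) * sin \<theta>) =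
      J (smult ((-1) ^ (j + l)) (monom 1 i * Q2 ^ (j + l) * (pderiv ^^ (2 * l)) (legendre n)))"
    unfolding J_def thint_def
  proof (rule integral_cong)
    fix \<theta> assume \<theta>: "\<theta> \<in> {0..pi}"
    then have s: "sqrt (1 - (cos \<theta>)\<^sup>2) = sin \<theta>"
      by (simp add: sin_squared_eq[symmetric] sin_ge_zero)
    have q: "poly Q2 (cos \<theta>) = - ((sin \<theta>)\<^sup>2)"
      using sin_cos_squared_add[of \<theta>] by (simp add: power2_eq_square algebra_simps)
    have "(-1) ^ (j + l) * (- ((sin \<theta>)\<^sup>2)) ^ (j + l) = (sin \<theta>) ^ (2 * j) * sin \<theta> ^ (2 * l)"
      unfolding power_mult_distrib[symmetric] by (simp add: power_mult power_add)
    then show "cos \<theta> ^ i * sin \<theta> ^ (2 * j) * assoc_legendre n (2 * l) (cos \<theta>) * sin \<theta> =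
        poly (smult ((-1) ^ (j + l)) (monom 1 i * Q2 ^ (j + l) * (pderiv ^^ (2 * l)) (legendre n))) (cos \<theta>) * sin \<theta>"
      unfolding poly_smult poly_mult poly_power q assoc_legendre_def s poly_monom
      by (simp add: mult_ac)
  qed
  then show ?thesis by (simp add: J_smult)
qed

text \<open>Polynomials of degree below n are orthogonal to the harmonics of degree n. The
  longitudinal integral leaves only m = 2 l with l <= j, and there \<open>J_orthogonal\<close>
  applies with k = j + l.\<close>

lemma fourier_ze_eq_0:
  assumes "i + 2 * j < n" "\<bar>m\<bar> \<le> int n"
  shows "fourier n m (ze i j) = 0"
proof (cases "m \<ge> 0 \<and> even m \<and> m \<le> 2 * int j")
  case True
  then obtain l where m: "m = 2 * int l" by (metis evenE nonneg_int_cases zero_le_mult_iff zero_le_numeral not_numeral_le_zero)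
  with True have l: "l \<le> j" by simp
  have "J (monom 1 i * Q2 ^ (j + l) * (pderiv ^^ (2 * l)) (legendre n)) = 0"
    using l assms by (intro J_orthogonal) auto
  then show ?thesis
    unfolding fourier_ze using thint_assoc_legendre[of i j n l] by (simp add: m nat_mult_distrib)
next
  case False
  then have "phint j m = 0"
    by (auto simp: phint_eq cint_eq_0)
  then show ?thesis by (simp add: fourier_ze)
qed

subsection \<open>Bounds for spherical harmonics\<close>

text \<open>The coefficient norm with radius 2 is submultiplicative and equals 2^2 + 1 = 5 on
  \<open>Q2\<close>.\<close>

lemma coeff_Q2_power_sum: "(\<Sum>i<M. \<bar>coeff (Q2 ^ n) i\<bar> * 2 ^ i) \<le> 5 ^ n"
proof (induction n)
  case 0
  have "(\<Sum>i<M. \<bar>coeff (1 :: real poly) i\<bar> * 2 ^ i) = (\<Sum>i<M. if i = 0 then 1 else 0)"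
    by (intro sum.cong) auto
  then show ?case by simp
next
  case (Suc n)
  let ?c = "\<lambda>i. \<bar>coeff (Q2 ^ n) i\<bar> * 2 ^ i"
  have c: "coeff (Q2 ^ Suc n) i = (if i < 2 then 0 else coeff (Q2 ^ n) (i - 2)) - coeff (Q2 ^ n) i" for i
    by (cases i; cases "i - 1") (auto simp: coeff_pCons split: nat.splits)
  have "(\<Sum>i<M. \<bar>coeff (Q2 ^ Suc n) i\<bar> * 2 ^ i) \<le>
      (\<Sum>i<M. (if i < 2 then 0 else 4 * ?c (i - 2)) + ?c i)"
  proof (rule sum_mono)
    fix i
    show "\<bar>coeff (Q2 ^ Suc n) i\<bar> * 2 ^ i \<le> (if i < 2 then 0 else 4 * ?c (i - 2)) + ?c i"
    proof (cases "i < 2")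
      case False
      then have "(2::real) ^ i = 4 * 2 ^ (i - 2)"
        by (simp add: power_diff)
      then show ?thesis
        unfolding c using False abs_triangle_ineq4[of "coeff (Q2 ^ n) (i - 2)" "coeff (Q2 ^ n) i"]
          mult_right_mono[OF abs_triangle_ineq4[of "coeff (Q2 ^ n) (i - 2)" "coeff (Q2 ^ n) i"], of "2 ^ i"]
        by (simp add: algebra_simps)
    qed (simp add: c del: power_Suc)
  qed
  also have "\<dots> = (\<Sum>i<M. if i < 2 then 0 else 4 * ?c (i - 2)) + (\<Sum>i<M. ?c i)"
    by (rule sum.distrib)
  also have "(\<Sum>i<M. if i < 2 then 0 else 4 * ?c (i - 2)) \<le> 4 * (\<Sum>i<M. ?c i)"
  proof -
    have "(\<Sum>i<M. if i < 2 then 0 else 4 * ?c (i - 2)) = (\<Sum>i\<in>{2..<M}. 4 * ?c (i - 2))"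
      by (intro sum.mono_neutral_cong_right) auto
    also have "\<dots> = (\<Sum>i<M - 2. 4 * ?c i)"
      by (intro sum.reindex_bij_witness[of _ "\<lambda>i. i + 2" "\<lambda>i. i - 2"]) auto
    also have "\<dots> \<le> (\<Sum>i<M. 4 * ?c i)"
      by (intro sum_mono2) auto
    finally show ?thesis by (simp add: sum_distrib_left)
  qed
  finally show ?case using Suc.IH by simp
qed

lemma pochhammer_le: "pochhammer (real (Suc k)) N \<le> fact N * 2 ^ (k + N)"
proof -
  have "pochhammer (real (Suc k)) N = fact (k + N) / fact k"
    using pochhammer_fact[of "k + N", where 'a = real] pochhammer_product[of k "k + N" "1::real"]
    by (simp add: pochhammer_fact[symmetric] add.commute)
  also have "\<dots> = fact N * real ((k + N) choose N)"
    by (simp add: binomial_fact)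
  also have "\<dots> \<le> fact N * real (2 ^ (k + N))"
    by (intro mult_left_mono of_nat_mono binomial_le_pow2) auto
  finally show ?thesis by simp
qed

text \<open>An estimate of Cauchy type: N-fold differentiation multiplies the coefficient of degree
  k + N by (k + N)! / k! <= N! 2^(k + N), and the power of 2 is absorbed by the radius 2 of the
  preceding norm.\<close>

lemma poly_pderiv_Q2_power_le:
  assumes "\<bar>s\<bar> \<le> 1"
  shows "\<bar>poly ((pderiv ^^ N) (Q2 ^ n)) s\<bar> \<le> fact N * 5 ^ n"
proof -
  let ?f = "(pderiv ^^ N) (Q2 ^ n)"
  have "\<bar>poly ?f s\<bar> \<le> (\<Sum>k\<le>degree ?f. \<bar>coeff ?f k * s ^ k\<bar>)"
    unfolding poly_altdef by (rule sum_abs)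
  also have "\<dots> \<le> (\<Sum>k\<le>degree ?f. fact N * (\<bar>coeff (Q2 ^ n) (k + N)\<bar> * 2 ^ (k + N)))"
  proof (rule sum_mono)
    fix k
    have "\<bar>coeff ?f k * s ^ k\<bar> \<le> \<bar>coeff ?f k\<bar> * 1"
      unfolding abs_mult power_abs using assms by (intro mult_left_mono power_le_one) auto
    also have "\<dots> = pochhammer (real (Suc k)) N * \<bar>coeff (Q2 ^ n) (k + N)\<bar>"
      by (simp add: coeff_higher_pderiv abs_mult pochhammer_nonneg)
    also have "\<dots> \<le> (fact N * 2 ^ (k + N)) * \<bar>coeff (Q2 ^ n) (k + N)\<bar>"
      by (intro mult_right_mono pochhammer_le) auto
    finally show "\<bar>coeff ?f k * s ^ k\<bar> \<le> fact N * (\<bar>coeff (Q2 ^ n) (k + N)\<bar> * 2 ^ (k + N))"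
      by (simp add: mult_ac)
  qed
  also have "\<dots> = fact N * (\<Sum>k\<le>degree ?f. \<bar>coeff (Q2 ^ n) (k + N)\<bar> * 2 ^ (k + N))"
    by (rule sum_distrib_left[symmetric])
  also have "(\<Sum>k\<le>degree ?f. \<bar>coeff (Q2 ^ n) (k + N)\<bar> * 2 ^ (k + N)) =
      (\<Sum>i\<in>(\<lambda>k. k + N) ` {..degree ?f}. \<bar>coeff (Q2 ^ n) i\<bar> * 2 ^ i)"
    by (simp add: sum.reindex inj_on_def)
  also have "\<dots> \<le> (\<Sum>i<degree ?f + N + 1. \<bar>coeff (Q2 ^ n) i\<bar> * 2 ^ i)"
    by (intro sum_mono2) auto
  also have "\<dots> \<le> 5 ^ n" by (rule coeff_Q2_power_sum)
  finally show ?thesis by simp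
qed

text \<open>Far from sharp, but no normalisation integral is needed.\<close>

lemma sph_harm_coord_le:
  assumes "\<bar>m\<bar> \<le> int n"
  shows "\<bar>sph_harm_coord n m \<theta> \<phi>\<bar> \<le> 10 ^ n"
proof -
  define k where "k = nat \<bar>m\<bar>"
  have k: "k \<le> n" using assms by (simp add: k_def)
  let ?r = "(fact (n - k) / fact (n + k) :: real)"
  have two_n: "2 * real n + 1 \<le> 4 ^ n"
    by (induction n) (auto simp: algebra_simps)
  have pi: "1 / (2 * pi) \<le> 1" "1 / (4 * pi) \<le> 1" using pi_gt3 by auto
  have yc: "(yc n m)\<^sup>2 \<le> (2 * real n + 1) * ?r"
  proof (cases "m = 0")
    case True
    then have "(yc n m)\<^sup>2 = (2 * real n + 1) * (1 / (4 * pi))"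
      by (simp add: yc_def)
    also have "\<dots> \<le> (2 * real n + 1) * 1" by (intro mult_left_mono pi) auto
    finally show ?thesis using True by (simp add: k_def)
  next
    case False
    have "((-1) ^ nat \<bar>m\<bar>)\<^sup>2 = (1::real)" by (simp flip: power_mult)
    then have "(yc n m)\<^sup>2 = (2 * real n + 1) * ?r * (1 / (2 * pi))"
      using False by (simp add: yc_def power_mult_distrib k_def mult_ac)
    also have "\<dots> \<le> (2 * real n + 1) * ?r * 1" by (intro mult_left_mono pi) auto
    finally show ?thesis by simp
  qed
  have "\<bar>sqrt (1 - (cos \<theta>)\<^sup>2) ^ k\<bar> \<le> 1"
    by (simp add: power_abs power_le_one sin_squared_eq[symmetric])
  then have "\<bar>assoc_legendre n k (cos \<theta>)\<bar> \<le> 1 * \<bar>poly ((pderiv ^^ k) (legendre n)) (cos \<theta>)\<bar>"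
    unfolding assoc_legendre_def abs_mult by (intro mult_right_mono) (auto simp: power_abs)
  also have "\<dots> = \<bar>poly ((pderiv ^^ (n + k)) (Q2 ^ n)) (cos \<theta>)\<bar> / (2 ^ n * fact n)"
    unfolding pderiv_legendre poly_smult by (simp add: abs_mult)
  also have "\<dots> \<le> fact (n + k) * 5 ^ n / (2 ^ n * fact n)"
    by (intro divide_right_mono poly_pderiv_Q2_power_le) auto
  finally have al: "\<bar>assoc_legendre n k (cos \<theta>)\<bar> \<le> fact (n + k) * 5 ^ n / (2 ^ n * fact n)" .
  have "\<bar>sph_harm_coord n m \<theta> \<phi>\<bar> \<le> \<bar>yc n m\<bar> * \<bar>assoc_legendre n k (cos \<theta>)\<bar> * 1"
    unfolding sph_harm_coord_eq abs_mult k_def by (intro mult_left_mono tau_le) auto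
  \<comment> \<open>Squaring removes the root in \<open>yc\<close>, whose factorial quotient then
    cancels one of the two factors (n + k)! from the derivative bound.\<close>
  then have "\<bar>sph_harm_coord n m \<theta> \<phi>\<bar>\<^sup>2 \<le> (\<bar>yc n m\<bar> * \<bar>assoc_legendre n k (cos \<theta>)\<bar>)\<^sup>2"
    by (intro power_mono) auto
  also have "\<dots> = (yc n m)\<^sup>2 * \<bar>assoc_legendre n k (cos \<theta>)\<bar>\<^sup>2"
    by (simp add: power_mult_distrib)
  also have "\<dots> \<le> ((2 * real n + 1) * ?r) * (fact (n + k) * 5 ^ n / (2 ^ n * fact n))\<^sup>2"
    by (intro mult_mono yc power_mono al) auto
  also have "\<dots> = (2 * real n + 1) * (25 / 4) ^ n * (fact (n - k) * fact (n + k) / (fact n)\<^sup>2)"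
  proof -
    have "(25 / 4 :: real) ^ n = (5 ^ n * 5 ^ n) / (2 ^ n * 2 ^ n)"
      unfolding power_mult_distrib[symmetric] power_divide[symmetric] by simp
    moreover have "(x * (A / B)) * (B * u / (v * f))\<^sup>2 = x * ((u * u) / (v * v)) * (A * B / f\<^sup>2)"
      if "B \<noteq> 0" "v \<noteq> 0" "f \<noteq> 0" for x A B u v f :: real
      using that by (simp add: field_simps power2_eq_square)
    ultimately show ?thesis by simp
  qed
  \<comment> \<open>The first 4^n covers 2 n + 1, the last one the central binomial coefficient; the
    three bases multiply to 100 = 10^2.\<close>
  also have "\<dots> \<le> 4 ^ n * (25 / 4) ^ n * 4 ^ n"
  proof (intro mult_mono two_n)
    have "(fact (n - k) * fact (n + k) :: nat) \<le> fact (2 * n)"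
      using fact_fact_dvd_fact[of "n - k" "n + k", where 'a = nat] k
      by (intro dvd_imp_le) (simp_all add: mult_2)
    then have "real (fact (n - k) * fact (n + k)) \<le> real (fact (2 * n))"
      by (rule of_nat_mono)
    then have "fact (n - k) * fact (n + k) \<le> (fact (2 * n) :: real)" by simp
    then have "fact (n - k) * fact (n + k) / (fact n)\<^sup>2 \<le> (fact (2 * n) / (fact n)\<^sup>2 :: real)"
      by (rule divide_right_mono) simp
    also have "\<dots> = real ((2 * n) choose n)"
      by (simp add: binomial_fact power2_eq_square mult_2)
    also have "\<dots> \<le> real (2 ^ (2 * n))" by (intro of_nat_mono binomial_le_pow2)
    finally show "fact (n - k) * fact (n + k) / (fact n)\<^sup>2 \<le> (4 ^ n :: real)"
      by (simp add: power_mult)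
  qed auto
  also have "\<dots> = (10 ^ n)\<^sup>2"
    unfolding power2_eq_square power_mult_distrib[symmetric] by simp
  finally show ?thesis by (simp add: abs_le_square_iff[symmetric])
qed

text \<open>Only monomials of degree at least n contribute. Their weight is at least 100^n against
  the bound 10^n for the harmonic, which leaves (1/10)^n.\<close>

lemma fourier_decay:
  assumes m: "\<bar>m\<bar> \<le> int n"
  shows "\<bar>fourier n m u\<bar> \<le> 20 * (1 / 10) ^ n * norm u"
proof -
  have c: "norm (fourier n m (ze i j)) \<le> (20 * (1 / 10) ^ n) * wt i j" for i j
  proof (cases "i + 2 * j < n")
    case True
    then show ?thesis using m by (simp add: fourier_ze_eq_0)
  next
    case False
    have "\<bar>fourier n m (ze i j)\<bar> \<le> 20 * 10 ^ n * 1"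
    proof (rule fourier_bound[OF sph_harm_coord_le[OF m]])
      fix x :: "real^3" assume "x \<in> S2"
      then show "\<bar>evS (ze i j) x\<bar> \<le> 1"
        using S2_bounds[of x] by (simp add: evS_ze abs_mult power_abs mult_le_one power_le_one)
    qed
    also have "\<dots> = 20 * (1 / 10) ^ n * 100 ^ n"
    proof -
      have "(1 / 10 :: real) ^ n * 100 ^ n = 10 ^ n"
        unfolding power_mult_distrib[symmetric] by simp
      then show ?thesis by simp
    qed
    also have "\<dots> \<le> 20 * (1 / 10) ^ n * 100 ^ (i + 2 * j)"
      using False by (intro mult_left_mono power_increasing) auto
    also have "(100::real) ^ (i + 2 * j) = wt i j"
      by (simp add: power_add power_mult)
    finally show ?thesis by simp
  qed
  have "fourier n m u = linz (\<lambda>i j. fourier n m (ze i j)) u"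
    by (rule bounded_linear_eq_zeI[where f = u])
      (simp_all add: bounded_linear_fourier bounded_linear_linz[OF c] linz_ze[OF c])
  then show ?thesis using norm_linz_le[OF c, of u] by simp
qed

subsection \<open>Gevrey norms\<close>

text \<open>With \<lambda> = 1/20 the exponential is at most exp(1/10)^(n + 1) <= (6/5)^(n + 1), and
  the polynomial factor is at most (n + 1)^4 <= 16^n. The rate 96/5 leaves room under the squared
  decay (1/100)^n even with 2 n + 1 orders per degree.\<close>

lemma gevrey_weight_le: "gevrey_weight (1 / 20) n \<le> (6 / 5) * (96 / 5) ^ n"
proof -
  have e: "exp (1 / 10 :: real) \<le> 6 / 5"
  proof -
    have "exp (- 1 / 10 :: real) \<ge> 9 / 10" using exp_ge_add_one_self[of "- 1 / 10 :: real"] by simp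
    moreover have "exp (1 / 10 :: real) * exp (- 1 / 10) = 1" by (simp flip: exp_add)
    ultimately have "exp (1 / 10 :: real) * (9 / 10) \<le> 1"
      by (metis exp_ge_zero mult_left_mono)
    then show ?thesis by simp
  qed
  have le: "eigval n + 1 \<le> (real n + 1)\<^sup>2"
    by (simp add: eigval_def power2_eq_square algebra_simps)
  have pos: "0 \<le> eigval n + 1" by (simp add: eigval_def)
  have n2: "real n + 1 \<le> 2 ^ n"
    by (induction n) auto
  have "exp (2 * (1 / 20) * sqrt (eigval n + 1)) \<le> exp ((real n + 1) * (1 / 10))"
    using real_sqrt_le_mono[OF le] by simp
  also have "\<dots> = exp (1 / 10) ^ Suc n"
    using exp_of_nat_mult[of "Suc n" "1 / 10 :: real"] by (simp add: add.commute)
  also have "\<dots> \<le> (6 / 5) ^ Suc n"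
    by (intro power_mono e) auto
  finally have 1: "exp (2 * (1 / 20) * sqrt (eigval n + 1)) \<le> (6 / 5) ^ Suc n" .
  have "(eigval n + 1)\<^sup>2 \<le> ((real n + 1)\<^sup>2)\<^sup>2"
    by (intro power_mono le pos)
  also have "\<dots> \<le> ((2 ^ n)\<^sup>2)\<^sup>2"
    by (intro power_mono n2) auto
  also have "\<dots> = 16 ^ n"
    by (simp add: power2_eq_square flip: power_mult_distrib)
  finally have 2: "(eigval n + 1)\<^sup>2 \<le> 16 ^ n" .
  have "gevrey_weight (1 / 20) n \<le> 16 ^ n * (6 / 5) ^ Suc n"
    unfolding gevrey_weight_def by (intro mult_mono 1 2) auto
  also have "\<dots> = (6 / 5) * (96 / 5) ^ n"
    by (simp flip: power_mult_distrib)
  finally show ?thesis .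
qed

text \<open>Weight, squared decay and 2 n + 1 <= 4^n combine to a geometric series of ratio 4 *
  (96/5) / 100 = 96/125. With 480 = 400 * 6/5 its sum is below 2500 = 50^2 times the squared
  norm.\<close>

lemma gevrey_evS:
  assumes f: "\<And>x. x \<in> S2 \<Longrightarrow> f x = evS u x"
  shows "gevrey_finite (1 / 20) f" "gevrey_norm (1 / 20) f \<le> 50 * norm u"
proof -
  let ?t = "\<lambda>(n, m). gevrey_weight (1 / 20) n * \<bar>l2_inner f (sph_harm n m)\<bar>\<^sup>2"
  define b where "b n = 480 * (norm u)\<^sup>2 * (24 / 125) ^ n" for n :: nat
  have l2: "l2_inner f (sph_harm n m) = fourier n m u" for n m
    unfolding fourier_def by (rule l2_inner_eq_sphint[OF f])
  have t0: "0 \<le> ?t p" for p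
    by (auto simp: gevrey_weight_def split: prod.splits)
  have tb: "?t (n, m) \<le> b n" if "\<bar>m\<bar> \<le> int n" for n m
  proof -
    have "\<bar>fourier n m u\<bar>\<^sup>2 \<le> (20 * (1 / 10) ^ n * norm u)\<^sup>2"
      by (intro power_mono fourier_decay that) auto
    also have "\<dots> = 400 * (1 / 100) ^ n * (norm u)\<^sup>2"
    proof -
      have "((1 / 10 :: real) ^ n)\<^sup>2 = (1 / 100) ^ n"
        unfolding power2_eq_square power_mult_distrib[symmetric] by simp
      then show ?thesis unfolding power_mult_distrib by simp
    qed
    finally have "?t (n, m) \<le> ((6 / 5) * (96 / 5) ^ n) * (400 * (1 / 100) ^ n * (norm u)\<^sup>2)"
      unfolding prod.case l2 by (intro mult_mono gevrey_weight_le) auto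
    also have "\<dots> = 480 * (norm u)\<^sup>2 * ((96 / 5) * (1 / 100)) ^ n"
      by (simp only: power_mult_distrib) simp
    also have "(96 / 5) * (1 / 100) = (24 / 125 :: real)" by simp
    finally show ?thesis by (simp add: b_def)
  qed
  have fin: "sum ?t F \<le> 2500 * (norm u)\<^sup>2" if F: "finite F" "F \<subseteq> gevrey_index" for F
  proof -
    define M where "M = Suc (Max (insert 0 (fst ` F)))"
    have "F \<subseteq> (SIGMA n:{..<M}. {- int n..int n})"
    proof (safe)
      fix n m assume nm: "(n, m) \<in> F"
      then have "n \<le> Max (insert 0 (fst ` F))" using F(1) by (intro Max_ge) force+
      then show "n < M" by (simp add: M_def)
      show "m \<in> {- int n..int n}" using nm F(2) by (auto simp: gevrey_index_def)
    qed
    then have "sum ?t F \<le> sum ?t (SIGMA n:{..<M}. {- int n..int n})"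
      by (intro sum_mono2 finite_SigmaI) (use t0 in auto)
    also have "\<dots> = (\<Sum>n<M. \<Sum>m\<in>{- int n..int n}. ?t (n, m))"
      by (subst sum.Sigma) auto
    also have "\<dots> \<le> (\<Sum>n<M. \<Sum>m\<in>{- int n..int n}. b n)"
      by (intro sum_mono tb) auto
    also have "\<dots> \<le> (\<Sum>n<M. 480 * (norm u)\<^sup>2 * (96 / 125) ^ n)"
    proof (rule sum_mono)
      fix n
      have "2 * real n + 1 \<le> 4 ^ n" by (induction n) (auto simp: algebra_simps)
      then have "(2 * real n + 1) * (24 / 125) ^ n \<le> 4 ^ n * (24 / 125) ^ n"
        by (intro mult_right_mono) auto
      also have "\<dots> = (96 / 125) ^ n" by (simp flip: power_mult_distrib)
      finally have "480 * (norm u)\<^sup>2 * ((2 * real n + 1) * (24 / 125) ^ n) \<le> 480 * (norm u)\<^sup>2 * (96 / 125) ^ n"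
        by (intro mult_left_mono) auto
      moreover have "real (card {- int n..int n}) = 2 * real n + 1" by simp
      ultimately show "(\<Sum>m\<in>{- int n..int n}. b n) \<le> 480 * (norm u)\<^sup>2 * (96 / 125) ^ n"
        by (simp add: b_def mult_ac)
    qed
    also have "\<dots> = 480 * (norm u)\<^sup>2 * (\<Sum>n<M. (96 / 125) ^ n)"
      by (rule sum_distrib_left[symmetric])
    also have "\<dots> \<le> 480 * (norm u)\<^sup>2 * (\<Sum>n. (96 / 125) ^ n)"
      by (intro mult_left_mono sum_le_suminf summable_geometric) auto
    also have "(\<Sum>n. (96 / 125) ^ n) = (125 / 29 :: real)"
      by (subst suminf_geometric) auto
    also have "480 * (norm u)\<^sup>2 * (125 / 29) \<le> 2500 * (norm u)\<^sup>2"
      using zero_le_power2[of "norm u"] by linarith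
    finally show ?thesis .
  qed
  have S: "?t summable_on gevrey_index"
    using t0 fin by (intro nonneg_bdd_above_summable_on bdd_aboveI[of _ "2500 * (norm u)\<^sup>2"]) auto
  then show "gevrey_finite (1 / 20) f" by (simp add: gevrey_finite_def)
  have "infsum ?t gevrey_index \<le> 2500 * (norm u)\<^sup>2"
    by (rule infsum_le_finite_sums[OF S fin])
  then have "gevrey_norm (1 / 20) f \<le> sqrt ((50 * norm u)\<^sup>2)"
    unfolding gevrey_norm_def by (intro real_sqrt_le_mono) (simp add: power_mult_distrib)
  then show "gevrey_norm (1 / 20) f \<le> 50 * norm u"
    unfolding real_sqrt_abs by simp
qed

subsection \<open>Explicit coefficients\<close>

text \<open>The integral of s^k over [-1, 1].\<close>

definition jm :: "nat \<Rightarrow> real" where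
  "jm k = (if even k then 2 / (real k + 1) else 0)"

lemma J_monom: "J (monom 1 k) = jm k"
proof -
  have "pderiv (monom (1 / real (Suc k)) (Suc k)) = monom 1 k"
    by (simp add: pderiv_monom del: of_nat_Suc)
  then have "J (monom 1 k) = poly (monom (1 / real (Suc k)) (Suc k)) 1 - poly (monom (1 / real (Suc k)) (Suc k)) (-1)"
    using J_pderiv[of "monom (1 / real (Suc k)) (Suc k)"] by simp
  then show ?thesis
    by (auto simp: jm_def poly_monom add.commute)
qed

lemma J_monom_pCons: "J (monom 1 k * pCons a q) = a * jm k + J (monom 1 (Suc k) * q)"
proof -
  have "monom 1 k * pCons a q = smult a (monom 1 k) + monom 1 (Suc k) * q"
    by (simp add: monom_Suc algebra_simps)
  then show ?thesis by (simp add: J_add J_smult J_monom)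
qed

lemma pderiv2_legendre_4: "(pderiv ^^ 2) (legendre 4) = [:-15 / 2, 0, 105 / 2:]"
  by (simp add: legendre_def pderiv_pCons numeral_eq_Suc fact_reduce)

lemma pderiv2_legendre_6: "(pderiv ^^ 2) (legendre 6) = [:105 / 8, 0, -945 / 4, 0, 3465 / 8:]"
  by (simp add: legendre_def pderiv_pCons numeral_eq_Suc fact_reduce)

text \<open>The factor pi is the longitudinal integral. \<open>yc 4 2\<close> stays symbolic, since
  it cancels against the right-hand side chosen for the linear system; likewise
  \<open>yc 6 2\<close>.\<close>

lemma fourier_4_2_ze1:
  "fourier 4 2 (ze i 1) = yc 4 2 * pi * J (monom 1 i * [:-15 / 2, 0, 135 / 2, 0, -225 / 2, 0, 105 / 2:])"
proof -
  have eq: "nat \<bar>2 :: int\<bar> = 2" by simp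
  note T = thint_assoc_legendre[of i 1 4 1, unfolded mult_1_right one_add_one]
  have P: "Q2 ^ 2 * (pderiv ^^ 2) (legendre 4) = [:-15 / 2, 0, 135 / 2, 0, -225 / 2, 0, 105 / 2:]"
    unfolding pderiv2_legendre_4 by (simp add: power2_eq_square)
  show ?thesis
    unfolding fourier_ze eq mult_1_right T mult.assoc[of "monom (1::real) i"] P phint_1_2 by simp
qed

lemma fourier_6_2_ze1:
  "fourier 6 2 (ze i 1) = yc 6 2 * pi *
    J (monom 1 i * [:105 / 8, 0, -1050 / 4, 0, 7350 / 8, 0, -4410 / 4, 0, 3465 / 8:])"
proof -
  have eq: "nat \<bar>2 :: int\<bar> = 2" by simp
  note T = thint_assoc_legendre[of i 1 6 1, unfolded mult_1_right one_add_one]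
  have P: "Q2 ^ 2 * (pderiv ^^ 2) (legendre 6) = [:105 / 8, 0, -1050 / 4, 0, 7350 / 8, 0, -4410 / 4, 0, 3465 / 8:]"
    unfolding pderiv2_legendre_6 by (simp add: power2_eq_square)
  show ?thesis
    unfolding fourier_ze eq mult_1_right T mult.assoc[of "monom (1::real) i"] P phint_1_2 by simp
qed

subsection \<open>Real analyticity\<close>

definition peval :: "real \<Rightarrow> 'a::banach_calg ps \<Rightarrow> 'a" where
  "peval r = psl (\<lambda>n a. r ^ n *\<^sub>R a)"

context
  fixes r :: real
  assumes r: "\<bar>r\<bar> \<le> 1"
begin

lemma peval_aux:
  "bounded_linear (\<lambda>a::'a::banach_calg. r ^ n *\<^sub>R a)" "norm (r ^ n *\<^sub>R (a::'a)) \<le> 1 * norm a"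
  using r by (auto intro: bounded_linear_scaleR_right simp: power_abs mult_left_le_one_le power_le_one)

lemma bounded_linear_peval: "bounded_linear (peval r :: 'a::banach_calg ps \<Rightarrow> 'a)"
  unfolding peval_def by (rule bounded_linear_psl[where C = 1]; rule peval_aux)

lemma peval_psm: "peval r (psm n (a::'a::banach_calg)) = r ^ n *\<^sub>R a"
  unfolding peval_def by (rule psl_psm[where C = 1]; rule peval_aux)

lemma peval_mult: "peval r (f * g) = peval r f * peval r (g :: 'a::banach_calg ps)"
proof -
  have 1: "peval r (psm n a * g) = peval r (psm n a) * peval r g" for n and a :: 'a and g
  proof (rule bounded_linear_eq_psI[where f = g])
    show "bounded_linear (\<lambda>g. peval r (psm n a * g))"
      by (rule bounded_linear_compose[OF bounded_linear_peval bounded_linear_mult_right])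
    show "bounded_linear (\<lambda>g. peval r (psm n a) * peval r g)"
      by (rule bounded_linear_compose[OF bounded_linear_mult_right bounded_linear_peval])
  qed (simp add: psm_mult peval_psm power_add)
  show ?thesis
  proof (rule bounded_linear_eq_psI[where f = f])
    show "bounded_linear (\<lambda>f. peval r (f * g))"
      by (rule bounded_linear_compose[OF bounded_linear_peval bounded_linear_mult_left])
    show "bounded_linear (\<lambda>f. peval r f * peval r g)"
      by (rule bounded_linear_compose[OF bounded_linear_mult_left bounded_linear_peval])
  qed (fact 1)
qed

end

lemma psm_0_1: "psm 0 (1::'a::banach_calg) = 1"
  by (rule ps_eqI) (auto simp: psc_psm)

text \<open>\<open>a\<close> belongs to the outermost variable and \<open>c\<close> to the
  innermost, in accordance with the order of indices in \<open>coef3\<close>.\<close>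

definition ev3 :: "real \<Rightarrow> real \<Rightarrow> real \<Rightarrow> real ps ps ps \<Rightarrow> real" where
  "ev3 a b c U = peval c (peval b (peval a U))"

context
  fixes a b c :: real
  assumes abc: "\<bar>a\<bar> \<le> 1" "\<bar>b\<bar> \<le> 1" "\<bar>c\<bar> \<le> 1"
begin

lemma bounded_linear_ev3: "bounded_linear (ev3 a b c)"
  unfolding ev3_def[abs_def]
  by (intro bounded_linear_compose[OF bounded_linear_peval] bounded_linear_peval abc)

lemma ev3_mult: "ev3 a b c (U * V) = ev3 a b c U * ev3 a b c V"
  by (simp add: ev3_def peval_mult abc)

lemma ev3_psm: "ev3 a b c (psm k (psm j (psm i 1))) = a ^ k * b ^ j * c ^ i"
proof -
  note lin = linear_scale[OF bounded_linear.linear[OF bounded_linear_peval]]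
  show ?thesis
    by (simp add: ev3_def peval_psm abc lin)
qed

lemma ev3_1: "ev3 a b c 1 = 1"
  using ev3_psm[of 0 0 0] by (simp add: psm_0_1)

lemma ev3_power: "ev3 a b c (U ^ n) = ev3 a b c U ^ n"
  by (induction n) (simp_all add: ev3_1 ev3_mult)

end

definition coef3 :: "real ps ps ps \<Rightarrow> (3 \<Rightarrow> nat) \<Rightarrow> real" where
  "coef3 U \<alpha> = psc (psc (psc U (\<alpha> 1)) (\<alpha> 2)) (\<alpha> 3)"

lemma sum_coef3_le:
  assumes "finite F"
  shows "(\<Sum>\<alpha>\<in>F. \<bar>coef3 U \<alpha>\<bar>) \<le> norm U"
proof -
  let ?g = "\<lambda>\<alpha> :: 3 \<Rightarrow> nat. (\<alpha> 1, \<alpha> 2, \<alpha> 3)"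
  let ?A = "?g ` F"
  define M where "M = (MAX p\<in>insert (0, 0, 0) ?A. fst p + fst (snd p) + snd (snd p))"
  have M: "?A \<subseteq> {..M} \<times> {..M} \<times> {..M}"
  proof
    fix p assume "p \<in> ?A"
    then have "fst p + fst (snd p) + snd (snd p) \<le> M"
      unfolding M_def using assms by (intro Max_ge) auto
    then show "p \<in> {..M} \<times> {..M} \<times> {..M}" by (cases p) auto
  qed
  have inj: "inj_on ?g F"
  proof (rule inj_onI)
    fix \<alpha> \<beta> :: "3 \<Rightarrow> nat" assume "?g \<alpha> = ?g \<beta>"
    then have "\<alpha> i = \<beta> i" for i using exhaust_3[of i] by auto
    then show "\<alpha> = \<beta>" by auto
  qed
  have "(\<Sum>\<alpha>\<in>F. \<bar>coef3 U \<alpha>\<bar>) = (\<Sum>p\<in>?A. case p of (k, j, i) \<Rightarrow> \<bar>psc (psc (psc U k) j) i\<bar>)"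
    by (subst sum.reindex[OF inj]) (simp add: coef3_def)
  also have "\<dots> \<le> (\<Sum>p\<in>{..M} \<times> {..M} \<times> {..M}. case p of (k, j, i) \<Rightarrow> \<bar>psc (psc (psc U k) j) i\<bar>)"
    by (rule sum_mono2) (use M in auto)
  also have "\<dots> = (\<Sum>k\<le>M. \<Sum>j\<le>M. \<Sum>i\<le>M. norm (psc (psc (psc U k) j) i))"
    by (simp add: sum.cartesian_product)
  also have "\<dots> \<le> (\<Sum>k\<le>M. \<Sum>j\<le>M. norm (psc (psc U k) j))"
    by (intro sum_mono sum_norm_psc_le) auto
  also have "\<dots> \<le> (\<Sum>k\<le>M. norm (psc U k))"
    by (intro sum_mono sum_norm_psc_le) auto
  also have "\<dots> \<le> norm U"
    by (rule sum_norm_psc_le) auto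
  finally show ?thesis .
qed

lemma ev3_has_sum:
  assumes abc: "\<bar>a\<bar> \<le> 1" "\<bar>b\<bar> \<le> 1" "\<bar>c\<bar> \<le> 1"
  shows "((\<lambda>\<alpha>. coef3 U \<alpha> * (a ^ \<alpha> 1 * b ^ \<alpha> 2 * c ^ \<alpha> 3)) has_sum ev3 a b c U) UNIV"
proof -
  let ?m = "\<lambda>\<alpha> :: 3 \<Rightarrow> nat. a ^ \<alpha> 1 * b ^ \<alpha> 2 * c ^ \<alpha> 3"
  have m: "\<bar>?m \<alpha>\<bar> \<le> 1" for \<alpha>
    using abc by (simp add: abs_mult power_abs mult_le_one power_le_one)
  have le: "norm (coef3 U \<alpha> * ?m \<alpha>) \<le> \<bar>coef3 U \<alpha>\<bar>" for U \<alpha>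
    using mult_left_mono[OF m[of \<alpha>], of "\<bar>coef3 U \<alpha>\<bar>"] by (simp add: abs_mult)
  have fin: "(\<Sum>\<alpha>\<in>F. norm (coef3 U \<alpha> * ?m \<alpha>)) \<le> norm U" if "finite F" for F U
    using sum_mono[of F "\<lambda>\<alpha>. norm (coef3 U \<alpha> * ?m \<alpha>)", OF le] sum_coef3_le[OF that, of U]
    by (rule order_trans)
  have A: "(\<lambda>\<alpha>. norm (coef3 U \<alpha> * ?m \<alpha>)) summable_on UNIV" for U
    using fin[of _ U] by (intro nonneg_bdd_above_summable_on bdd_aboveI[of _ "norm U"]) auto
  have S: "(\<lambda>\<alpha>. coef3 U \<alpha> * ?m \<alpha>) summable_on UNIV" for U
    by (rule abs_summable_summable[OF A])
  define H where "H U = (\<Sum>\<^sub>\<infinity>\<alpha>. coef3 U \<alpha> * ?m \<alpha>)" for U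
  have H: "bounded_linear H"
  proof (rule bounded_linear_intro[of _ 1])
    show "H (U + V) = H U + H V" for U V
      unfolding H_def infsum_add[OF S S, symmetric] by (simp add: coef3_def distrib_right)
    show "H (r *\<^sub>R U) = r *\<^sub>R H U" for r U
      unfolding H_def real_scaleR_def infsum_cmult_right'[symmetric] by (simp add: coef3_def mult.assoc)
    fix U
    have "norm (H U) \<le> (\<Sum>\<^sub>\<infinity>\<alpha>. norm (coef3 U \<alpha> * ?m \<alpha>))"
      unfolding H_def by (rule norm_infsum_bound[OF A])
    also have "\<dots> \<le> norm U"
      by (rule infsum_le_finite_sums[OF A fin])
    finally show "norm (H U) \<le> norm U * 1" by simp
  qed
  have "H U = ev3 a b c U"
  proof (rule bounded_linear_eq_psI[where f = U, OF H bounded_linear_ev3[OF abc]])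
    fix k and V :: "real ps ps"
    show "H (psm k V) = ev3 a b c (psm k V)"
    proof (rule bounded_linear_eq_peI[where f = V])
      show "bounded_linear (\<lambda>V. H (psm k V))" "bounded_linear (\<lambda>V. ev3 a b c (psm k V))"
        by (intro bounded_linear_compose[OF H] bounded_linear_compose[OF bounded_linear_ev3[OF abc]] bounded_linear_psm)+
      fix i j
      let ?\<beta> = "\<lambda>l :: 3. if l = 1 then k else if l = 2 then j else i"
      have "coef3 (psm k (pe i j)) \<alpha> * ?m \<alpha> = (if \<alpha> = ?\<beta> then ?m ?\<beta> else 0)" for \<alpha>
      proof (cases "\<alpha> = ?\<beta>")
        case False
        then obtain l where "\<alpha> l \<noteq> ?\<beta> l" by auto
        then have "\<alpha> 1 \<noteq> k \<or> \<alpha> 2 \<noteq> j \<or> \<alpha> 3 \<noteq> i"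
          using exhaust_3[of l] by auto
        then show ?thesis using False by (auto simp: coef3_def pe_def psc_psm)
      qed (simp add: coef3_def pe_def psc_psm)
      then have "H (psm k (pe i j)) = (\<Sum>\<^sub>\<infinity>\<alpha>. if \<alpha> = ?\<beta> then ?m ?\<beta> else 0)"
        by (simp only: H_def)
      also have "\<dots> = (\<Sum>\<^sub>\<infinity>\<alpha>\<in>{?\<beta>}. ?m ?\<beta>)"
        by (rule infsum_cong_neutral) auto
      also have "\<dots> = a ^ k * b ^ j * c ^ i" by simp
      finally show "H (psm k (pe i j)) = ev3 a b c (psm k (pe i j))"
        by (simp add: pe_def ev3_psm[OF abc])
    qed
  qed
  then show ?thesis
    using has_sum_infsum[OF S[of U]] by (simp add: H_def)
qed

text \<open>Re-expansion about \<open>p\<close>: the series is substituted with (p3 + e3) / 100 and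
  ((p1 + e1)^2 - (p2 + e2)^2) / 10000 in the algebra of three variables. The large radii make both
  of norm at most 1, so \<open>U\<close> is the local power series, valid on the whole ambient ball
  of radius 1.\<close>

lemma real_analytic_on_evS: "real_analytic_on (evS u) S2"
  unfolding real_analytic_on_def
proof
  fix p :: "real^3" assume p: "p \<in> S2"
  define e1 :: "real ps ps ps" where "e1 = psm 1 (psm 0 (psm 0 1))"
  define e2 :: "real ps ps ps" where "e2 = psm 0 (psm 1 (psm 0 1))"
  define e3 :: "real ps ps ps" where "e3 = psm 0 (psm 0 (psm 1 1))"
  have n: "norm e1 = 1" "norm e2 = 1" "norm e3 = 1"
    by (simp_all add: e1_def e2_def e3_def norm_psm)
  have pn: "\<bar>p $ i\<bar> \<le> 1" for i
    using component_le_norm_cart[of p i] p by simp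
  define X where "X = (1 / 100) *\<^sub>R ((p $ 3) *\<^sub>R 1 + e3)"
  define Y where "Y = (1 / 10000) *\<^sub>R (((p $ 1) *\<^sub>R 1 + e1) ^ 2 - ((p $ 2) *\<^sub>R 1 + e2) ^ 2)"
  have t: "norm ((p $ i) *\<^sub>R 1 + e) \<le> 2" if "norm e = 1" for i and e :: "real ps ps ps"
    using norm_triangle_ineq[of "(p $ i) *\<^sub>R 1" e] that pn[of i] by simp
  have X: "norm X \<le> 1" unfolding X_def using t[OF n(3), of 3] by simp
  have "norm (((p $ 1) *\<^sub>R 1 + e1) ^ 2 - ((p $ 2) *\<^sub>R 1 + e2) ^ 2) \<le> 2 ^ 2 + 2 ^ 2"
    by (intro order_trans[OF norm_triangle_ineq4] add_mono order_trans[OF norm_power_ineq] power_mono t n) auto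
  then have Y: "norm Y \<le> 1" unfolding Y_def by simp
  define U where "U = hom2 X Y u"
  have main: "((\<lambda>\<alpha>. coef3 U \<alpha> * (\<Prod>i\<in>UNIV. (x $ i - p $ i) ^ \<alpha> i)) has_sum evS u x) UNIV"
    if x: "x \<in> ball p 1" for x
  proof -
    have d: "\<bar>x $ i - p $ i\<bar> \<le> 1" for i
      using component_le_norm_cart[of "x - p" i] x by (simp add: dist_norm norm_minus_commute)
    let ?E = "ev3 (x $ 1 - p $ 1) (x $ 2 - p $ 2) (x $ 3 - p $ 3)"
    interpret E: bounded_linear ?E by (rule bounded_linear_ev3[OF d d d])
    have E1: "?E 1 = 1" by (rule ev3_1[OF d d d])
    have Ee: "?E e1 = x $ 1 - p $ 1" "?E e2 = x $ 2 - p $ 2" "?E e3 = x $ 3 - p $ 3"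
      unfolding e1_def e2_def e3_def using ev3_psm[OF d d d] by simp_all
    have EX: "?E X = x $ 3 / 100"
      by (simp add: X_def E.scaleR E.add E1 Ee)
    have EY: "?E Y = ((x $ 1)\<^sup>2 - (x $ 2)\<^sup>2) / 10000"
      by (simp add: Y_def E.scaleR E.add E.diff ev3_power[OF d d d] E1 Ee)
    have x2: "\<bar>x $ i\<bar> \<le> 2" for i
      using d[of i] pn[of i] by linarith
    have xz: "\<bar>x $ 3 / 100\<bar> \<le> 1" using x2[of 3] by simp
    have "(x $ 1)\<^sup>2 \<le> 4" "(x $ 2)\<^sup>2 \<le> 4"
      using x2[of 1] x2[of 2] abs_le_square_iff[of "x $ 1" 2] abs_le_square_iff[of "x $ 2" 2] by simp_all
    then have "\<bar>(x $ 1)\<^sup>2 - (x $ 2)\<^sup>2\<bar> \<le> 10000"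
      using zero_le_power2[of "x $ 1"] zero_le_power2[of "x $ 2"] by linarith
    then have xw: "\<bar>((x $ 1)\<^sup>2 - (x $ 2)\<^sup>2) / 10000\<bar> \<le> 1" by simp
    have "?E U = evS u x"
      unfolding U_def evS_def ev_def
    proof (rule bounded_linear_eq_peI[where f = u])
      show "bounded_linear (\<lambda>u. ?E (hom2 X Y u))"
        by (rule bounded_linear_compose[OF E.bounded_linear_axioms bounded_linear_hom2[OF X Y]])
      show "bounded_linear (\<lambda>u. hom2 (x $ 3 / 100) (((x $ 1)\<^sup>2 - (x $ 2)\<^sup>2) / 10000) u)"
        by (rule bounded_linear_hom2) (use xz xw in simp_all)
      show "?E (hom2 X Y (pe i j)) = hom2 (x $ 3 / 100) (((x $ 1)\<^sup>2 - (x $ 2)\<^sup>2) / 10000) (pe i j)" for i j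
      proof -
        have "hom2 (x $ 3 / 100) (((x $ 1)\<^sup>2 - (x $ 2)\<^sup>2) / 10000) (pe i j) =
            (x $ 3 / 100) ^ i * (((x $ 1)\<^sup>2 - (x $ 2)\<^sup>2) / 10000) ^ j"
          using xz xw by (intro hom2_pe) simp_all
        then show ?thesis
          unfolding hom2_pe[OF X Y] ev3_mult[OF d d d] ev3_power[OF d d d] EX EY by (rule sym)
      qed
    qed
    moreover have "(\<Prod>i\<in>UNIV. f i) = f 1 * f 2 * f 3" for f :: "3 \<Rightarrow> real"
      unfolding UNIV_3 by (simp add: mult.assoc)
    ultimately show ?thesis
      using ev3_has_sum[OF d[of 1] d[of 2] d[of 3], of U] by (simp only:)
  qed
  show "\<exists>r>0. \<exists>(a :: (3 \<Rightarrow> nat) \<Rightarrow> real) g.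
      (\<forall>x\<in>ball p r. ((\<lambda>\<alpha>. a \<alpha> * (\<Prod>i\<in>UNIV. (x $ i - p $ i) ^ \<alpha> i)) has_sum g x) UNIV) \<and>
      (\<forall>x\<in>S2 \<inter> ball p r. evS u x = g x)"
  proof (rule exI[of _ 1], rule conjI)
    show "\<exists>(a :: (3 \<Rightarrow> nat) \<Rightarrow> real) g.
        (\<forall>x\<in>ball p 1. ((\<lambda>\<alpha>. a \<alpha> * (\<Prod>i\<in>UNIV. (x $ i - p $ i) ^ \<alpha> i)) has_sum g x) UNIV) \<and>
        (\<forall>x\<in>S2 \<inter> ball p 1. evS u x = g x)"
      using main by (intro exI[of _ "coef3 U"] exI[of _ "evS u"] conjI ballI refl)
  qed simp
qed

lemma real_analytic_poly: "real_analytic (poly q)"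
  unfolding real_analytic_def
proof
  fix p
  let ?c = "coeff (pcompose q [:p, 1:])"
  have "(\<lambda>n. ?c n * (x - p) ^ n) sums poly q x" for x
  proof -
    have "(\<lambda>n. ?c n * (x - p) ^ n) sums (\<Sum>n\<le>degree (pcompose q [:p, 1:]). ?c n * (x - p) ^ n)"
      by (rule sums_finite) (auto simp: coeff_eq_0)
    also have "\<dots> = poly (pcompose q [:p, 1:]) (x - p)"
      by (simp add: poly_altdef)
    also have "\<dots> = poly q x"
      by (simp add: poly_pcompose)
    finally show ?thesis .
  qed
  then show "\<exists>r>0. \<exists>a. \<forall>x\<in>ball p r. (\<lambda>n. a n * (x - p) ^ n) sums poly q x"
    by (intro exI[of _ 1] conjI exI[of _ ?c]) auto
qed

subsection \<open>Nontriviality\<close>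

lemma ev_flip:
  assumes "\<bar>z\<bar> \<le> 1" "\<bar>w\<bar> \<le> 1"
  shows "ev (flip u) z w = ev u z (- w)"
proof (rule bounded_linear_eq_zeI[where f = u])
  have zw: "\<bar>z\<bar> \<le> 100" "\<bar>w\<bar> \<le> 10000" "\<bar>- w\<bar> \<le> 10000" using assms by auto
  show "bounded_linear (\<lambda>u. ev (flip u) z w)"
    by (rule bounded_linear_compose[OF bounded_linear_ev[OF zw(1,2)] bounded_linear_flip])
  show "bounded_linear (\<lambda>u. ev u z (- w))"
    by (rule bounded_linear_ev[OF zw(1,3)])
  show "ev (flip (ze i j)) z w = ev (ze i j) z (- w)" for i j
    by (cases "even j") (simp_all add: flip_ze ev_ze[OF zw(1,2)] ev_ze[OF zw(1,3)] ev_arith[OF zw(1,2)])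
qed

text \<open>Summing over the longitudes \<open>0, \<pi>/2, \<pi>, 3\<pi>/2\<close> with alternating signs annihilates zonal functions and
  all of \<open>Y\<^sub>2\<close> except the multiples of \<open>Y\<^sub>2\<^sup>2\<close>.\<close>

definition alternating :: "(real^3 \<Rightarrow> real) \<Rightarrow> real \<Rightarrow> real" where
  "alternating u \<theta> = u (sph \<theta> 0) - u (sph \<theta> (pi / 2)) + u (sph \<theta> pi) - u (sph \<theta> (3 * pi / 2))"

lemma alternating_Y2_space:
  assumes "w \<in> Y2_space"
  obtains \<kappa> where "\<And>\<theta>. \<theta> \<in> {0..pi} \<Longrightarrow> alternating w \<theta> = \<kappa> * (sin \<theta>)\<^sup>2"
proof -
  obtain a :: "int \<Rightarrow> real" where a: "\<And>x. x \<in> S2 \<Longrightarrow> w x = (\<Sum>m = -2..2. a m * sph_harm 2 m x)"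
    using assms by (auto simp: Y2_space_def)
  have I: "{-2..2} = {-2, -1, 0, 1, 2 :: int}" by auto
  have tr: "cos (3 * pi / 2) = 0" "sin (3 * pi / 2) = -1" "cos (2 * (3 * pi / 2)) = -1" "sin (2 * (3 * pi / 2)) = 0"
    "cos (2 * (pi / 2)) = -1" "sin (2 * (pi / 2)) = 0"
  proof -
    have "3 * pi / 2 = pi + pi / 2" by simp
    then show "cos (3 * pi / 2) = 0" "sin (3 * pi / 2) = -1"
      by (simp_all only: cos_add sin_add) simp_all
    have "2 * (3 * pi / 2) = 2 * pi + pi" by simp
    then show "cos (2 * (3 * pi / 2)) = -1" "sin (2 * (3 * pi / 2)) = 0"
      by (simp_all only: cos_add sin_add) simp_all
  qed simp_all
  have "alternating w \<theta> = 4 * a 2 * yc 2 2 * assoc_legendre 2 2 (cos \<theta>)" if "\<theta> \<in> {0..pi}" for \<theta>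
  proof -
    have w: "w (sph \<theta> \<phi>) = (\<Sum>m = -2..2. a m * (yc 2 m * assoc_legendre 2 (nat \<bar>m\<bar>) (cos \<theta>) * tau m \<phi>))" for \<phi>
      using that by (simp add: a[OF sph_S2] sph_harm_sph sph_harm_coord_eq)
    show ?thesis
      unfolding alternating_def w I by (simp add: tau_def tr tr[unfolded mult.commute[of _ pi]] algebra_simps)
  qed
  moreover have "assoc_legendre 2 2 (cos \<theta>) = 3 * (sin \<theta>)\<^sup>2" for \<theta>
  proof -
    have L: "(pderiv ^^ 2) (legendre 2) = [:3:]"
      by (simp add: legendre_def pderiv_pCons numeral_eq_Suc fact_reduce)
    have "(sqrt (1 - (cos \<theta>)\<^sup>2))\<^sup>2 = (sin \<theta>)\<^sup>2"
      by (simp add: sin_squared_eq[symmetric])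
    then show ?thesis unfolding assoc_legendre_def L by simp
  qed
  ultimately show ?thesis
    by (intro that[of "12 * a 2 * yc 2 2"]) simp
qed

text \<open>The alternating sum cancels the even part \<open>A\<close> and counts the odd part four
  times. For a trivial function it is a multiple of the squared sine, which on the meridian \<phi> =
  0 is both w and 1 - z^2, so \<open>B\<close> is a multiple of w there.\<close>

lemma not_nontrivialE:
  assumes f: "\<And>x. x \<in> S2 \<Longrightarrow> f x = evS (A + \<epsilon> *\<^sub>R (ze 0 1 + \<epsilon> *\<^sub>R B)) x"
    and A: "flip A = A" and B: "flip B = - B" and "\<epsilon> > 0" and nt: "\<not> nontrivial f"
  obtains \<kappa> where "\<And>z. \<bar>z\<bar> < 1 \<Longrightarrow> ev B z (1 - z\<^sup>2) = \<kappa> * (1 - z\<^sup>2)"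
proof -
  obtain h g where h: "zonal h" and g: "g \<in> Y2_space" and fx: "\<And>x. x \<in> S2 \<Longrightarrow> f x = h x + g x"
    using nt by (auto simp: nontrivial_def)
  obtain \<kappa> where \<kappa>: "\<And>\<theta>. \<theta> \<in> {0..pi} \<Longrightarrow> alternating g \<theta> = \<kappa> * (sin \<theta>)\<^sup>2"
    using alternating_Y2_space[OF g] by blast
  \<comment> \<open>The factor comes from solving 4 \<epsilon> (s + \<epsilon> B) = \<kappa> s for
    B, where s = 1 - z^2.\<close>
  have "ev B z (1 - z\<^sup>2) = ((\<kappa> / 4 - \<epsilon>) / \<epsilon>\<^sup>2) * (1 - z\<^sup>2)" if z: "\<bar>z\<bar> < 1" for z
  proof -
    define \<theta> where "\<theta> = arccos z"
    have \<theta>: "\<theta> \<in> {0..pi}" "cos \<theta> = z" using z by (auto simp: \<theta>_def arccos_lbound arccos_ubound)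
    have s: "(sin \<theta>)\<^sup>2 = 1 - z\<^sup>2" using \<theta>(2) by (simp add: sin_squared_eq)
    define s where "s = 1 - z\<^sup>2"
    have "z\<^sup>2 \<le> 1" using z by (simp add: abs_square_le_1)
    then have "0 \<le> s" "s \<le> 1"
      unfolding s_def using zero_le_power2[of z] by linarith+
    then have zs: "\<bar>z\<bar> \<le> 1" "\<bar>s\<bar> \<le> 1" "\<bar>z\<bar> \<le> 100" "\<bar>s\<bar> \<le> 10000" "\<bar>- s\<bar> \<le> 10000"
      using z by auto
    have "alternating h \<theta> = 0"
      using h \<theta>(1) unfolding zonal_def alternating_def by auto
    then have "alternating f \<theta> = \<kappa> * s"
      using \<kappa>[OF \<theta>(1)] s by (simp add: alternating_def fx[OF sph_S2] s_def)
    moreover have "alternating f \<theta> = 4 * \<epsilon> * (s + \<epsilon> * ev B z s)"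
    proof -
      have c: "cos (2 * (pi / 2)) = -1" "cos (2 * (3 * pi / 2)) = -1"
      proof -
        have "2 * (3 * pi / 2) = 2 * pi + pi" by simp
        then show "cos (2 * (3 * pi / 2)) = -1" by (simp only: cos_add) simp
      qed simp
      have e: "ev A z (- s) = ev A z s" "ev B z (- s) = - ev B z s"
        using ev_flip[OF zs(1,2), of A] ev_flip[OF zs(1,2), of B] A B ev_arith(3)[OF zs(3,4), of B] by simp_all
      show ?thesis
        unfolding alternating_def f[OF sph_S2] evS_sph \<theta>(2) s s_def[symmetric] c
        by (simp add: ev_arith[OF zs(3,4)] ev_arith[OF zs(3,5)] ev_ze[OF zs(3,4)] ev_ze[OF zs(3,5)] e algebra_simps)
    qed
    ultimately have "4 * \<epsilon> * (s + \<epsilon> * ev B z s) = \<kappa> * s" by simp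
    then have "\<epsilon>\<^sup>2 * ev B z s = (\<kappa> / 4 - \<epsilon>) * s"
      by (simp add: power2_eq_square algebra_simps)
    then have "ev B z s = ((\<kappa> / 4 - \<epsilon>) * s) / \<epsilon>\<^sup>2"
      using \<open>\<epsilon> > 0\<close> by (simp add: field_simps)
    then show ?thesis by (simp add: s_def)
  qed
  then show ?thesis by (rule that)
qed

lemma nontrivial_not_zonal: "nontrivial u \<Longrightarrow> \<not> zonal u"
proof
  assume "nontrivial u" "zonal u"
  moreover have "(\<lambda>x. 0) \<in> Y2_space"
    unfolding Y2_space_def by (auto intro!: exI[of _ "\<lambda>m. 0"])
  ultimately show False
    unfolding nontrivial_def by (metis add.right_neutral)
qed

subsection \<open>The choice of the nonlinearity\<close>

text \<open>With a, u in the roles of the squares of the two amplitudes of \<Psi>0, this cubic is,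
  up to a positive factor, the determinant left by the elimination in \<open>linear_system\<close>.
  Completing the square leaves one negative term: u^3 beats it for a <= 4 u, the square itself
  otherwise.\<close>

lemma det_pos:
  fixes a u :: real
  assumes "a \<ge> 0" "u > 0"
  shows "4 / 45 * a ^ 3 - 32 / 105 * a\<^sup>2 * u + 96 / 455 * a * u\<^sup>2 + 1152 / 5005 * u ^ 3 > 0"
proof -
  have eq: "4 / 45 * a ^ 3 - 32 / 105 * a\<^sup>2 * u + 96 / 455 * a * u\<^sup>2 + 1152 / 5005 * u ^ 3 =
      4 / 45 * a * (a - 12 / 7 * u)\<^sup>2 - 32 / 637 * a * u\<^sup>2 + 1152 / 5005 * u ^ 3"
    by (simp add: power2_eq_square power3_eq_cube algebra_simps)
  have u3: "u ^ 3 > 0" using assms by simp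
  have au: "0 \<le> a * u\<^sup>2" using assms by simp
  show ?thesis
  proof (cases "a \<le> 4 * u")
    case True
    then have "a * u\<^sup>2 \<le> 4 * u * u\<^sup>2" by (intro mult_right_mono) auto
    then have "a * u\<^sup>2 \<le> 4 * u ^ 3" by (simp add: power2_eq_square power3_eq_cube)
    moreover have "0 \<le> 4 / 45 * a * (a - 12 / 7 * u)\<^sup>2" using assms by simp
    ultimately show ?thesis unfolding eq using u3 by linarith
  next
    case False
    then have "(2 * u)\<^sup>2 \<le> (a - 12 / 7 * u)\<^sup>2" using assms by (intro power_mono) auto
    then have "a * (2 * u)\<^sup>2 \<le> a * (a - 12 / 7 * u)\<^sup>2" using assms by (intro mult_left_mono) auto
    then have "4 * (a * u\<^sup>2) \<le> a * (a - 12 / 7 * u)\<^sup>2" by (simp add: power_mult_distrib mult_ac)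
    then show ?thesis unfolding eq using u3 au by linarith
  qed
qed

text \<open>
  The first two equations are \<open>r1 (f \<Psi>\<^sub>0) = 0\<close> and \<open>r2 (f' \<Psi>\<^sub>0 * w) = 0\<close> for
  \<open>f' s = c1 + c2 s + c3 s\<^sup>2 + c4 s\<^sup>3\<close> and \<open>\<Psi>\<^sub>0 = a z + d (3 z\<^sup>2 - 1)\<close>; the last two prescribe the coefficients of
  degree 6 and 4.
\<close>

lemma linear_system:
  fixes a d \<rho>6 \<rho>4 :: real
  assumes "a\<^sup>2 + d\<^sup>2 > 0" "d = 0 \<Longrightarrow> \<rho>6 = 0"
  obtains c1 c2 c3 c4 where
    "c1 * (3 * d) + c2 / 2 * (a\<^sup>2 + 12 / 7 * d\<^sup>2) + c3 / 3 * (36 / 7 * d ^ 3 + 33 / 7 * a\<^sup>2 * d) +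
      c4 / 4 * (480 / 77 * d ^ 4 + 96 / 7 * a\<^sup>2 * d\<^sup>2 + 6 / 7 * a ^ 4) = 0"
    "c1 - 4 / 7 * d * c2 + c3 * (4 / 7 * d\<^sup>2 + a\<^sup>2 / 7) - 32 / 77 * d ^ 3 * c4 = 0"
    "768 / 143 * (d\<^sup>2 * c3 + a\<^sup>2 * d * c4) = \<rho>6"
    "32 / 7 * d * c2 + (32 / 21 * a\<^sup>2 - 128 / 77 * d\<^sup>2) * c3 + (384 / 91 * d ^ 3 + 32 / 11 * a\<^sup>2 * d) * c4 = \<rho>4"
proof (cases "d = 0")
  case True
  then have a: "a \<noteq> 0" using assms(1) by auto
  \<comment> \<open>For d = 0 the third equation reads 0 = \<open>\<rho>6\<close>; with c2 = c4 = 0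
    the fourth determines c3, the second c1, and the first holds.\<close>
  show ?thesis
    by (rule that[of "- (21 * \<rho>4 / (32 * a\<^sup>2)) * a\<^sup>2 / 7" 0 "21 * \<rho>4 / (32 * a\<^sup>2)" 0])
      (use True a assms(2) in \<open>auto simp: field_simps\<close>)
next
  case False
  define A where "A = a\<^sup>2"
  \<comment> \<open>Elimination with x = c4 as parameter: C3, C2 and C1 solve the third, fourth and
    second equation, in this order.\<close>
  define C3 where "C3 x = (143 / 768 * \<rho>6 - A * d * x) / d\<^sup>2" for x
  define C2 where "C2 x = 7 / (32 * d) * (\<rho>4 - (32 / 21 * A - 128 / 77 * d\<^sup>2) * C3 x -
      (384 / 91 * d ^ 3 + 32 / 11 * A * d) * x)" for x
  define C1 where "C1 x = 4 / 7 * d * C2 x - C3 x * (4 / 7 * d\<^sup>2 + A / 7) + 32 / 77 * d ^ 3 * x" for x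
  define K where "K = (4 / 45 * A ^ 3 - 32 / 105 * A\<^sup>2 * d\<^sup>2 + 96 / 455 * A * (d\<^sup>2)\<^sup>2 + 1152 / 5005 * (d\<^sup>2) ^ 3) * 15 / 8"
  have "0 \<le> A" "0 < d\<^sup>2" using False by (simp_all add: A_def)
  from det_pos[OF this] have K: "K > 0"
    unfolding K_def by (intro divide_pos_pos mult_pos_pos) simp_all
  define f where "f x = C1 x * (3 * d) + C2 x / 2 * (A + 12 / 7 * d\<^sup>2) + C3 x / 3 * (36 / 7 * d ^ 3 + 33 / 7 * A * d) +
      x / 4 * (480 / 77 * d ^ 4 + 96 / 7 * A * d\<^sup>2 + 6 / 7 * A\<^sup>2)" for x
  have c3: "C3 x = C3 0 - A / d * x" for x
    using False by (simp add: C3_def field_simps power2_eq_square)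
  have c2: "C2 x = C2 0 + (A\<^sup>2 / (3 * d\<^sup>2) - A - 12 / 13 * d\<^sup>2) * x" for x
    unfolding C2_def c3[of x] using False by (simp add: field_simps power2_eq_square power3_eq_cube)
  have c1: "C1 x = C1 0 + (A\<^sup>2 / (3 * d) - 16 / 143 * d ^ 3) * x" for x
    unfolding C1_def c3[of x] c2[of x] using False by (simp add: field_simps power2_eq_square power3_eq_cube)
  \<comment> \<open>The remaining equation is affine in the parameter, and its slope is positive by
    \<open>det_pos\<close>.\<close>
  have f: "f x = f 0 + K / d\<^sup>2 * x" for x
    unfolding f_def c3[of x] c2[of x] c1[of x] K_def using False
    by (simp add: field_simps power2_eq_square power3_eq_cube power4_eq_xxxx)
  define x where "x = - f 0 * d\<^sup>2 / K"
  have "f x = 0"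
    using f[of x] K False by (simp add: x_def)
  then have 1: "C1 x * (3 * d) + C2 x / 2 * (a\<^sup>2 + 12 / 7 * d\<^sup>2) + C3 x / 3 * (36 / 7 * d ^ 3 + 33 / 7 * a\<^sup>2 * d) +
      x / 4 * (480 / 77 * d ^ 4 + 96 / 7 * a\<^sup>2 * d\<^sup>2 + 6 / 7 * a ^ 4) = 0"
    by (simp add: f_def A_def)
  have 2: "C1 x - 4 / 7 * d * C2 x + C3 x * (4 / 7 * d\<^sup>2 + a\<^sup>2 / 7) - 32 / 77 * d ^ 3 * x = 0"
    by (simp add: C1_def A_def)
  have 3: "768 / 143 * (d\<^sup>2 * C3 x + a\<^sup>2 * d * x) = \<rho>6"
    using False by (simp add: C3_def A_def field_simps)
  have 4: "32 / 7 * d * C2 x + (32 / 21 * a\<^sup>2 - 128 / 77 * d\<^sup>2) * C3 x + (384 / 91 * d ^ 3 + 32 / 11 * a\<^sup>2 * d) * x = \<rho>4"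
  proof -
    have "32 / 7 * d * C2 x = \<rho>4 - (32 / 21 * A - 128 / 77 * d\<^sup>2) * C3 x - (384 / 91 * d ^ 3 + 32 / 11 * A * d) * x"
      using False by (simp add: C2_def)
    then show ?thesis unfolding A_def by linarith
  qed
  show ?thesis by (rule that[OF 1 2 3 4])
qed

subsection \<open>Polynomials in the height\<close>

text \<open>Horner's scheme, so that a linear functional can be evaluated on an explicit polynomial
  coefficient by coefficient.\<close>

definition zp :: "real poly \<Rightarrow> real ps ps" where
  "zp q = fold_coeffs (\<lambda>a u. a *\<^sub>R 1 + ze 1 0 * u) q 0"

lemma zp_0 [simp]: "zp 0 = 0"
  by (simp add: zp_def)

lemma zp_pCons [simp]: "zp (pCons a q) = a *\<^sub>R 1 + ze 1 0 * zp q"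
  by (cases "a = 0 \<and> q = 0") (auto simp: zp_def)

lemma zp_add: "zp (p + q) = zp p + zp q"
proof (induction p arbitrary: q)
  case (pCons a p)
  show ?case
  proof (cases q)
    case (pCons b q')
    then show ?thesis by (simp add: pCons.IH algebra_simps)
  qed
qed simp

lemma zp_1: "zp 1 = 1"
  by (simp add: one_pCons)

lemma zp_smult: "zp (smult c q) = c *\<^sub>R zp q"
  by (induction q) (simp_all add: algebra_simps)

lemma zp_mult: "zp (p * q) = zp p * zp q"
  by (induction p) (simp_all add: zp_add zp_smult algebra_simps)

lemma zp_power: "zp (p ^ n) = zp p ^ n"
  by (induction n) (simp_all add: zp_1 zp_mult)

lemma linear_zp_pCons:
  assumes "bounded_linear L"
  shows "L (ze i j * zp (pCons a q)) = a * L (ze i j) + L (ze (Suc i) j * zp q)"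
proof -
  interpret bounded_linear L by fact
  have "ze i j * zp (pCons a q) = a *\<^sub>R ze i j + ze (Suc i) j * zp q"
    by (simp add: distrib_left mult.assoc[symmetric] ze_mult)
  then show ?thesis by (simp add: add scaleR)
qed

context
  fixes a d :: real
begin

definition P0p :: "real poly" where
  "P0p = [:- d, a, 3 * d:]"

lemma P0p_2: "P0p ^ 2 = [:d\<^sup>2, - 2 * a * d, a\<^sup>2 - 6 * d\<^sup>2, 6 * a * d, 9 * d\<^sup>2:]"
  by (simp add: P0p_def power2_eq_square algebra_simps)

lemma P0p_3: "P0p ^ 3 = [:- (d ^ 3), 3 * a * d\<^sup>2, 9 * d ^ 3 - 3 * a\<^sup>2 * d, a ^ 3 - 18 * a * d\<^sup>2,
    9 * a\<^sup>2 * d - 27 * d ^ 3, 27 * a * d\<^sup>2, 27 * d ^ 3:]"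
  by (simp add: P0p_def power2_eq_square power3_eq_cube algebra_simps)

lemma P0p_4: "P0p ^ 4 = [:d ^ 4, - 4 * a * d ^ 3, 6 * a\<^sup>2 * d\<^sup>2 - 12 * d ^ 4, 36 * a * d ^ 3 - 4 * a ^ 3 * d,
    a ^ 4 - 36 * a\<^sup>2 * d\<^sup>2 + 54 * d ^ 4, 12 * a ^ 3 * d - 108 * a * d ^ 3, 54 * a\<^sup>2 * d\<^sup>2 - 108 * d ^ 4,
    108 * a * d ^ 3, 81 * d ^ 4:]"
  by (simp add: P0p_def power2_eq_square power3_eq_cube power4_eq_xxxx algebra_simps)

end

section \<open>Explicit values of the resonance functionals and of the solution coefficients\<close>

lemma r1_values: "r1 (ze 0 0) = 0" "r1 (ze (Suc 0) 0) = 0" "r1 (ze 2 0) = 1" "r1 (ze 3 0) = 0" "r1 (ze 4 0) = 6 / 7"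
  "r1 (ze 5 0) = 0" "r1 (ze 6 0) = 5 / 7" "r1 (ze 7 0) = 0" "r1 (ze 8 0) = 20 / 33"
proof -
  show 0: "r1 (ze 0 0) = 0" and 1: "r1 (ze (Suc 0) 0) = 0" and 2: "r1 (ze 2 0) = 1"
    by (subst r1_ze; simp add: dd_def)+
  show 3: "r1 (ze 3 0) = 0" using r1_ze[of 3 0] 1 by (simp add: dd_def)
  show 4: "r1 (ze 4 0) = 6 / 7" using r1_ze[of 4 0] 2 by (simp add: dd_def)
  show 5: "r1 (ze 5 0) = 0" using r1_ze[of 5 0] 3 by (simp add: dd_def)
  show 6: "r1 (ze 6 0) = 5 / 7" using r1_ze[of 6 0] 4 by (simp add: dd_def)
  show 7: "r1 (ze 7 0) = 0" using r1_ze[of 7 0] 5 by (simp add: dd_def)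
  show 8: "r1 (ze 8 0) = 20 / 33" using r1_ze[of 8 0] 6 by (simp add: dd_def)
qed

lemma r2_values: "r2 (ze 0 1) = 1" "r2 (ze (Suc 0) 1) = 0" "r2 (ze 2 1) = 1 / 7" "r2 (ze 3 1) = 0" "r2 (ze 4 1) = 1 / 21"
  "r2 (ze 5 1) = 0" "r2 (ze 6 1) = 5 / 231"
proof -
  show 0: "r2 (ze 0 1) = 1" and 1: "r2 (ze (Suc 0) 1) = 0"
    by (subst r2_ze; simp add: dd_def)+
  show 2: "r2 (ze 2 1) = 1 / 7" using r2_ze[of 2 1] 0 by (simp add: dd_def)
  show 3: "r2 (ze 3 1) = 0" using r2_ze[of 3 1] 1 by (simp add: dd_def)
  show 4: "r2 (ze 4 1) = 1 / 21" using r2_ze[of 4 1] 2 by (simp add: dd_def)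
  show 5: "r2 (ze 5 1) = 0" using r2_ze[of 5 1] 3 by (simp add: dd_def)
  show 6: "r2 (ze 6 1) = 5 / 231" using r2_ze[of 6 1] 4 by (simp add: dd_def)
qed

definition fsol :: "nat \<Rightarrow> real ps ps \<Rightarrow> real" where
  "fsol n u = fourier n 2 (sol u)"

lemma bounded_linear_fsol: "bounded_linear (fsol n)"
  unfolding fsol_def[abs_def] by (rule bounded_linear_compose[OF bounded_linear_fourier bounded_linear_sol])

lemma fsol_ze1: "fsol n (ze i 1) = (if i = 0 then 0 else
    (1 / dd (i + 2)) * (fourier n 2 (ze i 1) - real i * (real i - 1) * fsol n (ze (i - 2) 1)))"
proof -
  interpret F: bounded_linear "fourier n 2" by (rule bounded_linear_fourier)
  show ?thesis
    unfolding fsol_def sol_ze[of i 1] by (simp add: F.scaleR F.diff F.zero)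
qed

text \<open>14 is - \<open>dd 4\<close>. The values are those of \<open>fourier 4 2\<close> divided
  by \<open>dd 4\<close>, as self-adjointness of \<Delta> + 6 predicts; in degree 6 the divisor is
  \<open>dd 6\<close> = -36. These are the factors 1/14 and 1/36 of the theorem.\<close>

lemma fsol_4_values: 
  defines "M \<equiv> - (yc 4 2 * pi / 14)"
  shows "fsol 4 (ze 0 1) = 0" "fsol 4 (ze (Suc 0) 1) = 0" "fsol 4 (ze 2 1) = M * (32 / 21)" "fsol 4 (ze 3 1) = 0"
  "fsol 4 (ze 4 1) = M * (64 / 77)" "fsol 4 (ze 5 1) = 0" "fsol 4 (ze 6 1) = M * (480 / 1001)"
proof -
  have J: "J (monom 1 i * pCons c q) = c * jm i + J (monom 1 (Suc i) * q)" for i c q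
    by (rule J_monom_pCons)
  have F: "fourier 4 2 (ze 0 1) = 0" "fourier 4 2 (ze (Suc 0) 1) = 0" "fourier 4 2 (ze 2 1) = yc 4 2 * pi * (32 / 21)"
    "fourier 4 2 (ze 3 1) = 0" "fourier 4 2 (ze 4 1) = yc 4 2 * pi * (64 / 77)" "fourier 4 2 (ze 5 1) = 0"
    "fourier 4 2 (ze 6 1) = yc 4 2 * pi * (480 / 1001)"
    unfolding fourier_4_2_ze1 J mult_zero_right J_0 jm_def by simp_all
  show 0: "fsol 4 (ze 0 1) = 0" by (subst fsol_ze1) simp
  show 1: "fsol 4 (ze (Suc 0) 1) = 0" using fsol_ze1[of 4 "Suc 0"] F by simp
  show 2: "fsol 4 (ze 2 1) = M * (32 / 21)" using fsol_ze1[of 4 2] F 0 by (simp add: dd_def M_def mult_ac)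
  show 3: "fsol 4 (ze 3 1) = 0" using fsol_ze1[of 4 3] F 1 by (simp add: dd_def)
  show 4: "fsol 4 (ze 4 1) = M * (64 / 77)" using fsol_ze1[of 4 4] F 2 by (simp add: dd_def M_def mult_ac)
  show 5: "fsol 4 (ze 5 1) = 0" using fsol_ze1[of 4 5] F 3 by (simp add: dd_def)
  show 6: "fsol 4 (ze 6 1) = M * (480 / 1001)" using fsol_ze1[of 4 6] F 4 by (simp add: dd_def M_def mult_ac)
qed

lemma fsol_6_values:
  defines "M \<equiv> - (yc 6 2 * pi / 36)"
  shows "fsol 6 (ze 0 1) = 0" "fsol 6 (ze (Suc 0) 1) = 0" "fsol 6 (ze 2 1) = 0" "fsol 6 (ze 3 1) = 0"
  "fsol 6 (ze 4 1) = M * (256 / 429)" "fsol 6 (ze 5 1) = 0" "fsol 6 (ze 6 1) = M * (256 / 429)"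
proof -
  have J: "J (monom 1 i * pCons c q) = c * jm i + J (monom 1 (Suc i) * q)" for i c q
    by (rule J_monom_pCons)
  have F: "fourier 6 2 (ze 0 1) = 0" "fourier 6 2 (ze (Suc 0) 1) = 0" "fourier 6 2 (ze 2 1) = 0"
    "fourier 6 2 (ze 3 1) = 0" "fourier 6 2 (ze 4 1) = yc 6 2 * pi * (256 / 429)" "fourier 6 2 (ze 5 1) = 0"
    "fourier 6 2 (ze 6 1) = yc 6 2 * pi * (256 / 429)"
    unfolding fourier_6_2_ze1 J mult_zero_right J_0 jm_def by simp_all
  show 0: "fsol 6 (ze 0 1) = 0" by (subst fsol_ze1) simp
  show 1: "fsol 6 (ze (Suc 0) 1) = 0" using fsol_ze1[of 6 "Suc 0"] F by simp
  show 2: "fsol 6 (ze 2 1) = 0" using fsol_ze1[of 6 2] F 0 by (simp add: dd_def)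
  show 3: "fsol 6 (ze 3 1) = 0" using fsol_ze1[of 6 3] F 1 by (simp add: dd_def)
  show 4: "fsol 6 (ze 4 1) = M * (256 / 429)" using fsol_ze1[of 6 4] F 2 by (simp add: dd_def M_def mult_ac)
  show 5: "fsol 6 (ze 5 1) = 0" using fsol_ze1[of 6 5] F 3 by (simp add: dd_def)
  show 6: "fsol 6 (ze 6 1) = M * (256 / 429)" using fsol_ze1[of 6 6] F 4 by (simp add: dd_def M_def mult_ac)
qed

text \<open>cos(2 \<phi>)^j is orthogonal to cos(2 \<phi>) for even j, so only the part odd in w
  contributes to order 2.\<close>

lemma fourier_odd_2: "fourier n 2 (flip u) = - fourier n 2 u"
proof (rule bounded_linear_eq_zeI[where f = u])
  show "bounded_linear (\<lambda>u. fourier n 2 (flip u))"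
    by (rule bounded_linear_compose[OF bounded_linear_fourier bounded_linear_flip])
  show "fourier n 2 (flip (ze i j)) = - fourier n 2 (ze i j)" for i j
    by (cases "even j") (simp_all add: flip_ze fourier_linear fourier_ze phint_even_2 linear_neg
        bounded_linear.linear[OF bounded_linear_fourier])
qed (intro bounded_linear_minus bounded_linear_fourier)

text \<open>For j = 1 the recursion only lowers \<open>i\<close>, hence the solution stays w times a
  function of the height. The non-triviality argument compares this function with a
  constant.\<close>

lemma sol_ze1_factor: "\<exists>q. \<forall>z w. \<bar>z\<bar> \<le> 1 \<longrightarrow> \<bar>w\<bar> \<le> 1 \<longrightarrow> ev (sol (ze i 1)) z w = w * q z"
proof (induction i rule: less_induct)
  case (less i)
  show ?case
  proof (cases "i = 0")
    case True
    then have "sol (ze i 1) = 0" using sol_ze[of 0 1] by simp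
    then show ?thesis by (intro exI[of _ "\<lambda>z. 0"]) (auto simp: ev_arith)
  next
    case False
    have eq: "sol (ze i 1) = (1 / dd (i + 2)) *\<^sub>R (ze i 1 - (real i * (real i - 1)) *\<^sub>R sol (ze (i - 2) 1))"
      using False by (subst sol_ze) simp
    obtain q where q: "\<forall>z w. \<bar>z\<bar> \<le> 1 \<longrightarrow> \<bar>w\<bar> \<le> 1 \<longrightarrow> ev (sol (ze (i - 2) 1)) z w = w * q z"
      using less[of "i - 2"] False by auto
    show ?thesis
      unfolding eq using q
      by (intro exI[of _ "\<lambda>z. (1 / dd (i + 2)) * (z ^ i - (real i * (real i - 1)) * q z)"])
        (auto simp: ev_arith ev_ze algebra_simps)
  qed
qed

lemma sol_zp_factor: "\<exists>q. \<forall>z w. \<bar>z\<bar> \<le> 1 \<longrightarrow> \<bar>w\<bar> \<le> 1 \<longrightarrow> ev (sol (ze i 1 * zp g)) z w = w * q z"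
proof (induction g arbitrary: i)
  case 0
  then show ?case
    using bounded_linear.linear[OF bounded_linear_sol]
    by (intro exI[of _ "\<lambda>z. 0"]) (auto simp: ev_arith linear_0)
next
  case (pCons b g)
  have "ze i 1 * zp (pCons b g) = b *\<^sub>R ze i 1 + ze (Suc i) 1 * zp g"
    by (simp add: distrib_left mult.assoc[symmetric] ze_mult)
  then have eq: "sol (ze i 1 * zp (pCons b g)) = b *\<^sub>R sol (ze i 1) + sol (ze (Suc i) 1 * zp g)"
    using bounded_linear.linear[OF bounded_linear_sol] by (simp add: linear_add linear_scale)
  obtain q1 q2 where "\<forall>z w. \<bar>z\<bar> \<le> 1 \<longrightarrow> \<bar>w\<bar> \<le> 1 \<longrightarrow> ev (sol (ze i 1)) z w = w * q1 z"
    "\<forall>z w. \<bar>z\<bar> \<le> 1 \<longrightarrow> \<bar>w\<bar> \<le> 1 \<longrightarrow> ev (sol (ze (Suc i) 1 * zp g)) z w = w * q2 z"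
    using sol_ze1_factor pCons.IH by meson
  then show ?case
    unfolding eq by (intro exI[of _ "\<lambda>z. b * q1 z + q2 z"]) (auto simp: ev_arith algebra_simps)
qed

lemma linear_zp_3:
  assumes "bounded_linear L"
  shows "L (ze 0 j * zp [:a0, a1, a2:]) = (a0 * L (ze 0 j) + a1 * L (ze (Suc 0) j) + a2 * L (ze 2 j) :: real)"
  unfolding linear_zp_pCons[OF assms] zp_0 mult_zero_right
  by (simp add: linear_0 bounded_linear.linear[OF assms] numeral_eq_Suc)

lemma linear_zp_5:
  assumes "bounded_linear L"
  shows "L (ze 0 j * zp [:a0, a1, a2, a3, a4:]) = (a0 * L (ze 0 j) + a1 * L (ze (Suc 0) j) + a2 * L (ze 2 j) + a3 * L (ze 3 j) + a4 * L (ze 4 j) :: real)"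
  unfolding linear_zp_pCons[OF assms] zp_0 mult_zero_right
  by (simp add: linear_0 bounded_linear.linear[OF assms] numeral_eq_Suc)

lemma linear_zp_7:
  assumes "bounded_linear L"
  shows "L (ze 0 j * zp [:a0, a1, a2, a3, a4, a5, a6:]) = (a0 * L (ze 0 j) + a1 * L (ze (Suc 0) j) + a2 * L (ze 2 j) + a3 * L (ze 3 j) + a4 * L (ze 4 j) + a5 * L (ze 5 j) + a6 * L (ze 6 j) :: real)"
  unfolding linear_zp_pCons[OF assms] zp_0 mult_zero_right
  by (simp add: linear_0 bounded_linear.linear[OF assms] numeral_eq_Suc)

lemma linear_zp_9:
  assumes "bounded_linear L"
  shows "L (ze 0 j * zp [:a0, a1, a2, a3, a4, a5, a6, a7, a8:]) = (a0 * L (ze 0 j) + a1 * L (ze (Suc 0) j) + a2 * L (ze 2 j) + a3 * L (ze 3 j) + a4 * L (ze 4 j) + a5 * L (ze 5 j) + a6 * L (ze 6 j) + a7 * L (ze 7 j) + a8 * L (ze 8 j) :: real)"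
  unfolding linear_zp_pCons[OF assms] zp_0 mult_zero_right
  by (simp add: linear_0 bounded_linear.linear[OF assms] numeral_eq_Suc)

lemma sph_harm_1_0: "x \<in> S2 \<Longrightarrow> sph_harm 1 0 x = sqrt (3 / (4 * pi)) * x $ 3"
proof -
  assume "x \<in> S2"
  then have "cos (arccos (x $ 3)) = x $ 3" using S2_bounds(1)[of x] by (simp add: abs_le_iff)
  moreover have "legendre 1 = [:0, 1:]" by (simp add: legendre_def pderiv_pCons)
  ultimately show ?thesis by (simp add: sph_harm_def sph_harm_coord_def)
qed

lemma sph_harm_2_0: "x \<in> S2 \<Longrightarrow> sph_harm 2 0 x = sqrt (5 / (4 * pi)) / 2 * (3 * (x $ 3)\<^sup>2 - 1)"
proof -
  assume "x \<in> S2"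
  then have "cos (arccos (x $ 3)) = x $ 3" using S2_bounds(1)[of x] by (simp add: abs_le_iff)
  moreover have "legendre 2 = [:- 1 / 2, 0, 3 / 2:]"
    by (simp add: legendre_def pderiv_pCons numeral_eq_Suc fact_reduce)
  ultimately show ?thesis by (simp add: sph_harm_def sph_harm_coord_def power2_eq_square field_simps)
qed

lemma yc_2_neq_0: "n \<ge> 2 \<Longrightarrow> yc n 2 \<noteq> 0"
  by (simp add: yc_def)

lemma fourier_cong:
  assumes "\<And>x. x \<in> S2 \<Longrightarrow> evS u x = evS v x"
  shows "fourier n m u = fourier n m v"
  unfolding fourier_def by (simp add: assms[OF sph_S2])

section \<open>Assembly: coefficients of the nonlinearity, the branch, asymptotics and
  non-triviality\<close>

theorem theorem1p1:
  fixes \<beta> \<gamma> :: real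
  assumes "\<beta>\<^sup>2 + \<gamma>\<^sup>2 > 0"
  shows "\<exists>c>0. \<exists>l>0. \<exists>\<epsilon>0>0. \<exists>(\<Psi> :: real \<Rightarrow> real^3 \<Rightarrow> real) (F :: real \<Rightarrow> real \<Rightarrow> real).
    (\<forall>\<epsilon>\<in>{0<..\<epsilon>0}.
       real_analytic_on (\<Psi> \<epsilon>) S2 \<and>
       real_analytic (F \<epsilon>) \<and>
       (\<forall>x\<in>S2. laplace_beltrami (\<Psi> \<epsilon>) x - 4 * \<gamma> * sph_harm 1 0 x = F \<epsilon> (\<Psi> \<epsilon> x)) \<and>
       gevrey_finite l (\<lambda>x. \<beta> * sph_harm 2 0 x + \<gamma> * sph_harm 1 0 x - \<Psi> \<epsilon> x) \<and>
       \<not> zonal (\<Psi> \<epsilon>) \<and>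
       nontrivial (\<Psi> \<epsilon>)) \<and>
    (\<lambda>\<epsilon>. gevrey_norm l (\<lambda>x. \<beta> * sph_harm 2 0 x + \<gamma> * sph_harm 1 0 x - \<Psi> \<epsilon> x))
      \<in> O[at_right 0](\<lambda>\<epsilon>. \<epsilon>) \<and>
    (\<lambda>\<epsilon>. l2_inner (\<Psi> \<epsilon>) (sph_harm 6 2)
          - (- \<beta>\<^sup>2 * (1 / 36) * (45 / (11 * pi * sqrt 182)) * c * \<epsilon>\<^sup>2))
      \<in> O[at_right 0](\<lambda>\<epsilon>. \<epsilon> ^ 3) \<and>
    (\<lambda>\<epsilon>. l2_inner (\<Psi> \<epsilon>) (sph_harm 4 2)
          - (- (1 / 14) * (3 * sqrt 3 / (154 * pi) * (11 * \<gamma>\<^sup>2 - 5 * \<beta>\<^sup>2)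
                - \<beta>\<^sup>2 * (1 / (7 * pi)) * (30 * \<gamma>\<^sup>2 / (7 * \<gamma>\<^sup>2 + 15 * \<beta>\<^sup>2))) * c * \<epsilon>\<^sup>2))
      \<in> O[at_right 0](\<lambda>\<epsilon>. \<epsilon> ^ 3)"
proof -
  \<comment> \<open>Chosen such that \<Psi>0 = a z + d (3 z^2 - 1); \<open>T6\<close> and
    \<open>T4\<close> are the required second-order coefficients for c = 1.\<close>
  define a d where "a = \<gamma> * sqrt (3 / (4 * pi))" and "d = \<beta> * (sqrt (5 / (4 * pi)) / 2)"
  define T6 where "T6 = - \<beta>\<^sup>2 * (1 / 36) * (45 / (11 * pi * sqrt 182))"
  define T4 where "T4 = - (1 / 14) * (3 * sqrt 3 / (154 * pi) * (11 * \<gamma>\<^sup>2 - 5 * \<beta>\<^sup>2)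
                - \<beta>\<^sup>2 * (1 / (7 * pi)) * (30 * \<gamma>\<^sup>2 / (7 * \<gamma>\<^sup>2 + 15 * \<beta>\<^sup>2)))"
  \<comment> \<open>At least one target is non-zero; this is the source of non-triviality.\<close>
  have T: "T6 \<noteq> 0 \<or> T4 \<noteq> 0"
  proof (cases "\<beta> = 0")
    case True
    with assms show ?thesis by (simp add: T4_def)
  next
    case False
    then show ?thesis by (simp add: T6_def)
  qed
  have y: "yc 6 2 \<noteq> 0" "yc 4 2 \<noteq> 0" by (intro yc_2_neq_0; simp)+
  have d0: "d = 0 \<longleftrightarrow> \<beta> = 0" and a0: "a = 0 \<longleftrightarrow> \<gamma> = 0" by (simp_all add: d_def a_def)
  have "a\<^sup>2 + d\<^sup>2 > 0"
    using assms d0 a0 by (metis add_pos_nonneg add_nonneg_pos zero_less_power2 zero_le_power2 add.right_neutral less_irrefl zero_power2)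
  \<comment> \<open>The right-hand sides undo the division by \<open>dd 6\<close> = -36 and
    \<open>dd 4\<close> = -14 and the normalisation of the harmonics. The factor \<beta>^2 in
    \<open>T6\<close> makes the system compatible when d = 0.\<close>
  moreover have "d = 0 \<Longrightarrow> T6 * (- 36) / (yc 6 2 * pi) = 0" by (simp add: d0 T6_def)
  ultimately obtain c1 c2 c3 c4 where
    c1: "c1 * (3 * d) + c2 / 2 * (a\<^sup>2 + 12 / 7 * d\<^sup>2) + c3 / 3 * (36 / 7 * d ^ 3 + 33 / 7 * a\<^sup>2 * d) +
      c4 / 4 * (480 / 77 * d ^ 4 + 96 / 7 * a\<^sup>2 * d\<^sup>2 + 6 / 7 * a ^ 4) = 0" and
    c2: "c1 - 4 / 7 * d * c2 + c3 * (4 / 7 * d\<^sup>2 + a\<^sup>2 / 7) - 32 / 77 * d ^ 3 * c4 = 0" and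
    c3: "768 / 143 * (d\<^sup>2 * c3 + a\<^sup>2 * d * c4) = T6 * (- 36) / (yc 6 2 * pi)" and
    c4: "32 / 7 * d * c2 + (32 / 21 * a\<^sup>2 - 128 / 77 * d\<^sup>2) * c3 + (384 / 91 * d ^ 3 + 32 / 11 * a\<^sup>2 * d) * c4 =
      T4 * (- 14) / (yc 4 2 * pi)"
    by (rule linear_system[of a d "T6 * (- 36) / (yc 6 2 * pi)" "T4 * (- 14) / (yc 4 2 * pi)"])
  define P0 where "P0 = zp (P0p a d)"
  define W where "W = ze 0 1"
  have PW: "P0 ^ k * W = ze 0 1 * zp (P0p a d ^ k)" for k
    by (simp add: P0_def W_def zp_power mult.commute)
  have P1: "P0 ^ k = ze 0 0 * zp (P0p a d ^ k)" for k
    by (simp add: P0_def zp_power ze_0)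
  interpret R1: bounded_linear r1 by (rule bounded_linear_r1)
  interpret R2: bounded_linear r2 by (rule bounded_linear_r2)
  interpret S: bounded_linear "fsol n" for n by (rule bounded_linear_fsol)
  have p1: "P0p a d ^ 1 = [:- d, a, 3 * d:]" by (simp add: P0p_def)
  have m: "r1 (P0 ^ 1) = 3 * d" "r1 (P0 ^ 2) = a\<^sup>2 + 12 / 7 * d\<^sup>2"
    "r1 (P0 ^ 3) = 36 / 7 * d ^ 3 + 33 / 7 * a\<^sup>2 * d"
    "r1 (P0 ^ 4) = 480 / 77 * d ^ 4 + 96 / 7 * a\<^sup>2 * d\<^sup>2 + 6 / 7 * a ^ 4"
    unfolding P1 p1 P0p_2 P0p_3 P0p_4 linear_zp_3[OF bounded_linear_r1] linear_zp_5[OF bounded_linear_r1]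
      linear_zp_7[OF bounded_linear_r1] linear_zp_9[OF bounded_linear_r1] r1_values
    by (simp_all add: field_simps)
  have n: "r2 (P0 ^ 1 * W) = - 4 / 7 * d" "r2 (P0 ^ 2 * W) = 4 / 7 * d\<^sup>2 + a\<^sup>2 / 7"
    "r2 (P0 ^ 3 * W) = - 32 / 77 * d ^ 3"
    unfolding PW p1 P0p_2 P0p_3 linear_zp_3[OF bounded_linear_r2] linear_zp_5[OF bounded_linear_r2]
      linear_zp_7[OF bounded_linear_r2] r2_values
    by (simp_all add: field_simps)
  have n0: "r2 W = 1" by (simp only: W_def r2_values)
  define M6 where "M6 = - (yc 6 2 * pi / 36)"
  define M4 where "M4 = - (yc 4 2 * pi / 14)"
  have s6: "fsol 6 (P0 ^ 1 * W) = 0" "fsol 6 (P0 ^ 2 * W) = M6 * (768 / 143 * d\<^sup>2)"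
    "fsol 6 (P0 ^ 3 * W) = M6 * (768 / 143 * (a\<^sup>2 * d))"
    unfolding PW p1 P0p_2 P0p_3 linear_zp_3[OF bounded_linear_fsol] linear_zp_5[OF bounded_linear_fsol]
      linear_zp_7[OF bounded_linear_fsol] fsol_6_values M6_def[symmetric]
    by (simp_all add: field_simps)
  have s4: "fsol 4 (P0 ^ 1 * W) = M4 * (32 / 7 * d)" "fsol 4 (P0 ^ 2 * W) = M4 * (32 / 21 * a\<^sup>2 - 128 / 77 * d\<^sup>2)"
    "fsol 4 (P0 ^ 3 * W) = M4 * (384 / 91 * d ^ 3 + 32 / 11 * a\<^sup>2 * d)"
    unfolding PW p1 P0p_2 P0p_3 linear_zp_3[OF bounded_linear_fsol] linear_zp_5[OF bounded_linear_fsol]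
      linear_zp_7[OF bounded_linear_fsol] fsol_4_values M4_def[symmetric]
    by (simp_all add: field_simps)
  have s0: "fsol 6 W = 0" "fsol 4 W = 0"
    by (simp_all only: W_def fsol_6_values fsol_4_values)
  have fE0: "fE c1 c2 c3 c4 0 P0 W =
      c1 *\<^sub>R P0 ^ 1 + (c2 / 2) *\<^sub>R P0 ^ 2 + (c3 / 3) *\<^sub>R P0 ^ 3 + (c4 / 4) *\<^sub>R P0 ^ 4"
    by (simp add: fE_def)
  have fO0: "fO c1 c2 c3 c4 0 P0 W =
      c1 *\<^sub>R W + c2 *\<^sub>R (P0 ^ 1 * W) + c3 *\<^sub>R (P0 ^ 2 * W) + c4 *\<^sub>R (P0 ^ 3 * W)"
    by (simp add: fO_def)
  have H1: "r1 (fE c1 c2 c3 c4 0 P0 W) = 0"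
    unfolding fE0 R1.add R1.scaleR m using c1 by simp
  have H2: "r2 (fO c1 c2 c3 c4 0 P0 W) = 0"
    unfolding fO0 R2.add R2.scaleR n n0 using c2 by (simp add: algebra_simps)
  define o0 where "o0 = sol (fO c1 c2 c3 c4 0 P0 W)"
  have o6: "fourier 6 2 o0 = T6"
  proof -
    have "fourier 6 2 o0 = M6 * (768 / 143 * (d\<^sup>2 * c3 + a\<^sup>2 * d * c4))"
      unfolding o0_def fsol_def[symmetric] fO0 S.add S.scaleR s6 s0 by (simp add: algebra_simps)
    then show ?thesis unfolding c3 using y by (simp add: M6_def)
  qed
  have o4: "fourier 4 2 o0 = T4"
  proof -
    have "fourier 4 2 o0 = M4 * (32 / 7 * d * c2 + (32 / 21 * a\<^sup>2 - 128 / 77 * d\<^sup>2) * c3 +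
        (384 / 91 * d ^ 3 + 32 / 11 * a\<^sup>2 * d) * c4)"
      unfolding o0_def fsol_def[symmetric] fO0 S.add S.scaleR s4 s0 by (simp add: algebra_simps)
    then show ?thesis unfolding c4 using y by (simp add: M4_def)
  qed
  have P0_ze: "P0 = a *\<^sub>R ze 1 0 + d *\<^sub>R (3 *\<^sub>R ze 2 0 - ze 0 0)"
    by (simp add: P0_def P0p_def ze_0 ze_mult algebra_simps numeral_2_eq_2)
  interpret Fl: bounded_linear flip by (rule bounded_linear_flip)
  have flP: "flip P0 = P0"
    by (simp add: P0_ze Fl.add Fl.diff Fl.scaleR flip_ze)
  have flW: "flip W = - W" by (simp add: W_def flip_ze)
  \<comment> \<open>The Jacobian of the two resonance conditions with respect to the two lowest
    coefficients is a negative definite form in (a, d).\<close>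
  have det: "r1 P0 * r2 (P0 * W) - r1 (P0 ^ 2) / 2 * r2 W \<noteq> 0"
  proof -
    have "r1 P0 * r2 (P0 * W) - r1 (P0 ^ 2) / 2 * r2 W = - (a\<^sup>2 / 2 + 18 / 7 * d\<^sup>2)"
    proof -
      have "r1 P0 = 3 * d" "r2 (P0 * W) = - 4 / 7 * d" using m(1) n(1) by simp_all
      then show ?thesis by (simp only: m(2) n0) (simp add: power2_eq_square field_simps)
    qed
    moreover have "a\<^sup>2 / 2 + 18 / 7 * d\<^sup>2 > 0"
      using \<open>a\<^sup>2 + d\<^sup>2 > 0\<close> zero_le_power2[of a] zero_le_power2[of d] by linarith
    ultimately show ?thesis by linarith
  qed
  obtain \<epsilon>0 C where e0: "\<epsilon>0 > 0" "\<epsilon>0 \<le> 1" and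
    br: "\<And>\<epsilon>. \<epsilon> \<in> {0..\<epsilon>0} \<Longrightarrow> \<exists>e ob p1 p2. reduced_solution (c1 + p1) (c2 + p2) c3 c4 P0 W \<epsilon> e ob \<and>
      norm e \<le> C \<and> norm ob \<le> C \<and> norm (ob - o0) \<le> C * \<epsilon>"
    unfolding o0_def by (rule lyapunov_schmidt_branch[OF flP flW H1 H2 det]) blast
  define Q where "Q \<epsilon> = (\<lambda>(e, ob, p1, p2). reduced_solution (c1 + p1) (c2 + p2) c3 c4 P0 W \<epsilon> e ob \<and>
      norm e \<le> C \<and> norm ob \<le> C \<and> norm (ob - o0) \<le> C * \<epsilon>)" for \<epsilon>
  have ex: "\<exists>t. Q \<epsilon> t" if eps: "\<epsilon> \<in> {0..\<epsilon>0}" for \<epsilon>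
  proof -
    obtain e ob p1 p2 where "reduced_solution (c1 + p1) (c2 + p2) c3 c4 P0 W \<epsilon> e ob \<and>
        norm e \<le> C \<and> norm ob \<le> C \<and> norm (ob - o0) \<le> C * \<epsilon>"
      using br[OF eps] by blast
    then show ?thesis by (intro exI[of _ "(e, ob, p1, p2)"]) (simp add: Q_def)
  qed
  \<comment> \<open>A choice of one solution for each \<epsilon> turns the branch into functions of
    \<epsilon>.\<close>
  define t where "t \<epsilon> = (SOME t. Q \<epsilon> t)" for \<epsilon>
  have t: "Q \<epsilon> (t \<epsilon>)" if "\<epsilon> \<in> {0..\<epsilon>0}" for \<epsilon>
    unfolding t_def by (rule someI_ex[OF ex[OF that]])
  define e where "e \<epsilon> = fst (t \<epsilon>)" for \<epsilon>
  define ob where "ob \<epsilon> = fst (snd (t \<epsilon>))" for \<epsilon>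
  define a1 where "a1 \<epsilon> = c1 + fst (snd (snd (t \<epsilon>)))" for \<epsilon>
  define a2 where "a2 \<epsilon> = c2 + snd (snd (snd (t \<epsilon>)))" for \<epsilon>
  define Z where "Z \<epsilon> = P0 + \<epsilon> *\<^sub>R e \<epsilon>" for \<epsilon>
  define N where "N \<epsilon> = W + \<epsilon> *\<^sub>R ob \<epsilon>" for \<epsilon>
  define E where "E \<epsilon> = fE (a1 \<epsilon>) (a2 \<epsilon>) c3 c4 \<epsilon> (Z \<epsilon>) (N \<epsilon>)" for \<epsilon>
  define B where "B \<epsilon> = fO (a1 \<epsilon>) (a2 \<epsilon>) c3 c4 \<epsilon> (Z \<epsilon>) (N \<epsilon>)" for \<epsilon>
  have t': "flip (e \<epsilon>) = e \<epsilon>" "flip (ob \<epsilon>) = - ob \<epsilon>" "e \<epsilon> = sol (E \<epsilon>)" "ob \<epsilon> = sol (B \<epsilon>)"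
    "r1 (E \<epsilon>) = 0" "r2 (B \<epsilon>) = 0" "norm (e \<epsilon>) \<le> C" "norm (ob \<epsilon>) \<le> C" "norm (ob \<epsilon> - o0) \<le> C * \<epsilon>"
    if "\<epsilon> \<in> {0..\<epsilon>0}" for \<epsilon>
    using t[OF that] unfolding Q_def case_prod_beta e_def[symmetric] ob_def[symmetric] a1_def[symmetric] a2_def[symmetric]
      reduced_solution_def Let_def Z_def[symmetric] N_def[symmetric] E_def[symmetric] B_def[symmetric] by blast+
  have C0: "C \<ge> 0" using order_trans[OF norm_ge_zero t'(7)[of 0]] e0 by simp
  define U where "U \<epsilon> = Z \<epsilon> + \<epsilon> *\<^sub>R N \<epsilon>" for \<epsilon>
  define \<Psi> where "\<Psi> \<epsilon> = evS (U \<epsilon>)" for \<epsilon>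
  define F where "F \<epsilon> = poly [:0, - 6 + \<epsilon> * a1 \<epsilon>, \<epsilon> * a2 \<epsilon> / 2, \<epsilon> * c3 / 3, \<epsilon> * c4 / 4:]" for \<epsilon>
  have Psi0: "evS P0 x = \<beta> * sph_harm 2 0 x + \<gamma> * sph_harm 1 0 x" if "x \<in> S2" for x
    unfolding sph_harm_1_0[OF that] sph_harm_2_0[OF that] P0_ze a_def d_def
    by (simp add: evS_arith[OF that] evS_ze[OF that] algebra_simps diff_divide_distrib)
  have pde: "laplace_beltrami (\<Psi> \<epsilon>) x - 4 * \<gamma> * sph_harm 1 0 x = F \<epsilon> (\<Psi> \<epsilon> x)"
    if eps: "\<epsilon> \<in> {0..\<epsilon>0}" and x: "x \<in> S2" for \<epsilon> x
  proof -
    interpret L: bounded_linear "\<lambda>u. laplace_beltrami (evS u) x" by (rule laplace_beltrami_evS_aux[OF x])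
    note A = evS_arith[OF x]
    have fl: "flip (Z \<epsilon>) = Z \<epsilon>" "flip (N \<epsilon>) = - N \<epsilon>"
      by (simp_all add: Z_def N_def Fl.add Fl.scaleR flP flW t'(1,2)[OF eps])
    \<comment> \<open>Parity supplies the two resonance conditions that were not imposed.\<close>
    have "r2 (E \<epsilon>) = - r2 (E \<epsilon>)" "r1 (B \<epsilon>) = - r1 (B \<epsilon>)"
      using r2_flip[of "E \<epsilon>"] r1_flip[of "B \<epsilon>"] flip_fE_fO[OF fl] by (simp_all add: E_def B_def R1.neg)
    then have r: "r2 (E \<epsilon>) = 0" "r1 (B \<epsilon>) = 0" by linarith+
    have e1: "laplace_beltrami (evS (e \<epsilon>)) x = evS (E \<epsilon>) x - 6 * evS (e \<epsilon>) x"
      using laplace_beltrami_sol[OF x, of "E \<epsilon>"] r t'(3,5)[OF eps] by simp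
    have o1: "laplace_beltrami (evS (ob \<epsilon>)) x = evS (B \<epsilon>) x - 6 * evS (ob \<epsilon>) x"
      using laplace_beltrami_sol[OF x, of "B \<epsilon>"] r t'(4,6)[OF eps] by simp
    have w1: "laplace_beltrami (evS W) x = - 6 * evS W x"
      by (simp add: W_def laplace_beltrami_evS_aux(2)[OF x] lapm_def evS_ze[OF x])
    \<comment> \<open>The degree 1 part has eigenvalue -2, and the defect of 4 against -6 is the
      inhomogeneous term of the equation.\<close>
    have p1: "laplace_beltrami (evS P0) x = 4 * \<gamma> * sph_harm 1 0 x - 6 * evS P0 x"
      unfolding sph_harm_1_0[OF x] P0_ze a_def
      by (simp add: L.add L.diff L.scaleR laplace_beltrami_evS_aux(2)[OF x] lapm_def A evS_ze[OF x] algebra_simps)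
    have "laplace_beltrami (\<Psi> \<epsilon>) x - 4 * \<gamma> * sph_harm 1 0 x =
        - 6 * evS (U \<epsilon>) x + \<epsilon> * (evS (E \<epsilon>) x + \<epsilon> * evS (B \<epsilon>) x)"
      unfolding \<Psi>_def U_def Z_def N_def L.add L.scaleR e1 o1 w1 p1 A by (simp add: algebra_simps)
    also have "evS (E \<epsilon>) x + \<epsilon> * evS (B \<epsilon>) x =
        a1 \<epsilon> * evS (U \<epsilon>) x + a2 \<epsilon> / 2 * (evS (U \<epsilon>) x)\<^sup>2 + c3 / 3 * (evS (U \<epsilon>) x) ^ 3 + c4 / 4 * (evS (U \<epsilon>) x) ^ 4"
      unfolding E_def B_def fE_def fO_def U_def A
      by (simp add: field_simps power2_eq_square power3_eq_cube power4_eq_xxxx)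
    finally show ?thesis
      by (simp add: F_def \<Psi>_def power2_eq_square power3_eq_cube power4_eq_xxxx algebra_simps)
  qed
  have dif: "\<beta> * sph_harm 2 0 x + \<gamma> * sph_harm 1 0 x - \<Psi> \<epsilon> x = evS (- (\<epsilon> *\<^sub>R (e \<epsilon> + N \<epsilon>))) x"
    if "x \<in> S2" for \<epsilon> x
    unfolding Psi0[OF that, symmetric] \<Psi>_def U_def Z_def
    by (simp add: evS_arith[OF that] algebra_simps)
  have gn: "gevrey_norm (1 / 20) (\<lambda>x. \<beta> * sph_harm 2 0 x + \<gamma> * sph_harm 1 0 x - \<Psi> \<epsilon> x) \<le>
      50 * (2 * C + 10000) * \<epsilon>" if eps: "\<epsilon> \<in> {0..\<epsilon>0}" for \<epsilon>
  proof -
    have "norm (N \<epsilon>) \<le> norm W + \<epsilon> * norm (ob \<epsilon>)"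
      using norm_triangle_ineq[of W "\<epsilon> *\<^sub>R ob \<epsilon>"] eps by (simp add: N_def)
    also have "\<dots> \<le> 10000 + 1 * C"
      using t'(8)[OF eps] eps e0 by (intro add_mono mult_mono) (auto simp: W_def norm_ze)
    finally have "norm (e \<epsilon> + N \<epsilon>) \<le> 2 * C + 10000"
      using norm_triangle_ineq[of "e \<epsilon>" "N \<epsilon>"] t'(7)[OF eps] by linarith
    then have "\<epsilon> * norm (e \<epsilon> + N \<epsilon>) \<le> \<epsilon> * (2 * C + 10000)"
      using eps by (intro mult_left_mono) auto
    then have "50 * (\<epsilon> * norm (e \<epsilon> + N \<epsilon>)) \<le> 50 * (2 * C + 10000) * \<epsilon>" by (simp add: algebra_simps)
    moreover have "norm (- (\<epsilon> *\<^sub>R (e \<epsilon> + N \<epsilon>))) = \<epsilon> * norm (e \<epsilon> + N \<epsilon>)"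
      using eps by simp
    ultimately have "50 * norm (- (\<epsilon> *\<^sub>R (e \<epsilon> + N \<epsilon>))) \<le> 50 * (2 * C + 10000) * \<epsilon>"
      by (simp only:)
    with gevrey_evS(2)[OF dif, of \<epsilon>] show ?thesis by (rule order_trans)
  qed
  \<comment> \<open>\<open>P0\<close> and \<open>W\<close> have degree at most 2 and
    \<open>e\<close> is even in w, so for n >= 4 only the term of order \<epsilon>^2
    survives.\<close>
  have l2: "l2_inner (\<Psi> \<epsilon>) (sph_harm n 2) = \<epsilon>\<^sup>2 * fourier n 2 (ob \<epsilon>)"
    if eps: "\<epsilon> \<in> {0..\<epsilon>0}" and n: "n \<ge> 4" for \<epsilon> n
  proof -
    interpret Fo: bounded_linear "fourier n 2" by (rule bounded_linear_fourier)
    have "l2_inner (\<Psi> \<epsilon>) (sph_harm n 2) = fourier n 2 (U \<epsilon>)"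
      unfolding fourier_def by (rule l2_inner_eq_sphint) (simp add: \<Psi>_def)
    moreover have "fourier n 2 (ze 1 0) = 0" "fourier n 2 (ze 2 0) = 0" "fourier n 2 (ze 0 0) = 0"
      "fourier n 2 (ze 0 1) = 0"
      using n by (intro fourier_ze_eq_0; simp)+
    moreover have "fourier n 2 (e \<epsilon>) = 0"
      using fourier_odd_2[of n "e \<epsilon>"] t'(1)[OF eps] by simp
    ultimately show ?thesis
      by (simp add: U_def Z_def N_def P0_ze W_def Fo.add Fo.diff Fo.scaleR power2_eq_square)
  qed
  have l2O: "(\<lambda>\<epsilon>. l2_inner (\<Psi> \<epsilon>) (sph_harm n 2) - fourier n 2 o0 * \<epsilon>\<^sup>2) \<in> O[at_right 0](\<lambda>\<epsilon>. \<epsilon> ^ 3)"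
    if n: "n \<ge> 4" for n
  proof (rule bigoI[where c = "20 * (1 / 10) ^ n * C"])
    show "\<forall>\<^sub>F \<epsilon> in at_right 0. norm (l2_inner (\<Psi> \<epsilon>) (sph_harm n 2) - fourier n 2 o0 * \<epsilon>\<^sup>2) \<le>
        20 * (1 / 10) ^ n * C * norm (\<epsilon> ^ 3)"
    proof (rule eventually_at_rightI[OF _ e0(1)])
      fix \<epsilon> assume "\<epsilon> \<in> {0<..<\<epsilon>0}"
      then have eps: "\<epsilon> \<in> {0..\<epsilon>0}" by auto
      interpret Fo: bounded_linear "fourier n 2" by (rule bounded_linear_fourier)
      have "\<bar>fourier n 2 (ob \<epsilon> - o0)\<bar> \<le> 20 * (1 / 10) ^ n * norm (ob \<epsilon> - o0)"
        using n by (intro fourier_decay) simp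
      also have "\<dots> \<le> 20 * (1 / 10) ^ n * (C * \<epsilon>)"
        by (intro mult_left_mono t'(9)[OF eps]) simp
      finally have "\<epsilon>\<^sup>2 * \<bar>fourier n 2 (ob \<epsilon> - o0)\<bar> \<le> \<epsilon>\<^sup>2 * (20 * (1 / 10) ^ n * (C * \<epsilon>))"
        by (intro mult_left_mono) auto
      moreover have "norm (l2_inner (\<Psi> \<epsilon>) (sph_harm n 2) - fourier n 2 o0 * \<epsilon>\<^sup>2) = \<epsilon>\<^sup>2 * \<bar>fourier n 2 (ob \<epsilon> - o0)\<bar>"
      proof -
        have "l2_inner (\<Psi> \<epsilon>) (sph_harm n 2) - fourier n 2 o0 * \<epsilon>\<^sup>2 = \<epsilon>\<^sup>2 * fourier n 2 (ob \<epsilon> - o0)"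
          unfolding l2[OF eps n] Fo.diff by (simp add: algebra_simps)
        then show ?thesis by (simp add: abs_mult)
      qed
      moreover have "norm (\<epsilon> ^ 3) = \<epsilon> * \<epsilon>\<^sup>2" using eps by (simp add: power3_eq_cube power2_eq_square)
      ultimately show "norm (l2_inner (\<Psi> \<epsilon>) (sph_harm n 2) - fourier n 2 o0 * \<epsilon>\<^sup>2) \<le>
          20 * (1 / 10) ^ n * C * norm (\<epsilon> ^ 3)"
        by (simp add: mult_ac)
    qed
  qed
  \<comment> \<open>\<open>g\<close> is f'(\<Psi>0) as a polynomial in the height, so
    \<open>o0\<close> solves a problem with right-hand side w g(z) and is itself w q(z).\<close>
  define g where "g = smult c1 1 + smult c2 (P0p a d ^ 1) + smult c3 (P0p a d ^ 2) + smult c4 (P0p a d ^ 3)"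
  have "fO c1 c2 c3 c4 0 P0 W = ze 0 1 * zp g"
    unfolding fO0 unfolding PW g_def zp_add zp_smult zp_1 unfolding W_def by (simp add: distrib_left)
  then obtain q where q: "\<And>z w. \<bar>z\<bar> \<le> 1 \<Longrightarrow> \<bar>w\<bar> \<le> 1 \<Longrightarrow> ev o0 z w = w * q z"
    using sol_zp_factor[of 0 g] unfolding o0_def by auto
  \<comment> \<open>If q were constant on (-1, 1), then \<open>o0\<close> would be a multiple of w
    on the sphere and its coefficients in degrees 6 and 4 would vanish, contradicting
    \<open>T\<close>.\<close>
  obtain z1 z2 where z: "\<bar>z1\<bar> < 1" "\<bar>z2\<bar> < 1" "q z1 \<noteq> q z2"
  proof (rule ccontr)
    assume "\<not> thesis"
    then have k: "q z = q 0" if "\<bar>z\<bar> < 1" for z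
      using that \<open>\<And>z2 z1. \<bar>z1\<bar> < 1 \<Longrightarrow> \<bar>z2\<bar> < 1 \<Longrightarrow> q z1 \<noteq> q z2 \<Longrightarrow> thesis\<close>[of z 0] by auto
    have "evS o0 x = evS (q 0 *\<^sub>R ze 0 1) x" if x: "x \<in> S2" for x
    proof -
      let ?w = "(x $ 1)\<^sup>2 - (x $ 2)\<^sup>2"
      have 1: "evS o0 x = ?w * q (x $ 3)"
        unfolding evS_def by (rule q) (rule S2_bounds[OF x])+
      have "?w * q (x $ 3) = ?w * q 0"
      proof (cases "\<bar>x $ 3\<bar> < 1")
        \<comment> \<open>At the poles nothing is known about q, but w vanishes there.\<close>
        case False
        then have "x $ 3 = 1 \<or> x $ 3 = - 1" using S2_bounds(1)[OF x] by linarith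
        then have "(x $ 3)\<^sup>2 = 1" by auto
        then have "(x $ 1)\<^sup>2 + (x $ 2)\<^sup>2 = 0" using x S2_iff[of x] by linarith
        then show ?thesis by (simp add: sum_power2_eq_zero_iff)
      next
        case True
        from k[OF this] show ?thesis by (rule arg_cong)
      qed
      with 1 show ?thesis by (simp add: evS_arith[OF x] evS_ze[OF x])
    qed
    then have "fourier n 2 o0 = q 0 * fourier n 2 (ze 0 1)" for n
      using fourier_cong[of o0 "q 0 *\<^sub>R ze 0 1" n 2] by (simp add: fourier_linear)
    moreover have "fourier 6 2 (ze 0 1) = 0" "fourier 4 2 (ze 0 1) = 0"
      by (intro fourier_ze_eq_0; simp)+
    ultimately have "fourier 6 2 o0 = 0" "fourier 4 2 o0 = 0" by simp_all
    with o6 o4 T show False by simp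
  qed
  define D where "D = C / (1 - z1\<^sup>2) + C / (1 - z2\<^sup>2)"
  have zz: "1 - z1\<^sup>2 > 0" "1 - z2\<^sup>2 > 0" using z by (simp_all add: abs_square_less_1)
  have D0: "D \<ge> 0" using C0 zz by (simp add: D_def)
  \<comment> \<open>Makes D \<epsilon> at most half of |q z1 - q z2|; the summand 1 excludes a zero
    denominator.\<close>
  define \<epsilon>1 where "\<epsilon>1 = min \<epsilon>0 (\<bar>q z1 - q z2\<bar> / (2 * (D + 1)))"
  have e1: "\<epsilon>1 > 0" using e0 z D0 by (simp add: \<epsilon>1_def)
  have nt: "nontrivial (\<Psi> \<epsilon>)" if "\<epsilon> \<in> {0<..\<epsilon>1}" for \<epsilon>
  proof (rule ccontr)
    assume nt: "\<not> nontrivial (\<Psi> \<epsilon>)"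
    have eps: "\<epsilon> \<in> {0..\<epsilon>0}" and pos: "\<epsilon> > 0" and small: "\<epsilon> \<le> \<bar>q z1 - q z2\<bar> / (2 * (D + 1))"
      using that by (auto simp: \<epsilon>1_def)
    have U: "\<Psi> \<epsilon> x = evS (Z \<epsilon> + \<epsilon> *\<^sub>R (ze 0 1 + \<epsilon> *\<^sub>R ob \<epsilon>)) x" for x
      by (simp add: \<Psi>_def U_def N_def W_def)
    have flZ: "flip (Z \<epsilon>) = Z \<epsilon>" by (simp add: Z_def Fl.add Fl.scaleR flP t'(1)[OF eps])
    obtain \<kappa> where \<kappa>: "\<And>z. \<bar>z\<bar> < 1 \<Longrightarrow> ev (ob \<epsilon>) z (1 - z\<^sup>2) = \<kappa> * (1 - z\<^sup>2)"
      using not_nontrivialE[OF U flZ t'(2)[OF eps] pos nt] by blast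
    \<comment> \<open>On the meridian w = 1 - z^2 triviality gives \<open>ob \<epsilon>\<close> =
      \<kappa> w, while \<open>o0\<close> is q(z) w, and the two differ by at most C \<epsilon>. Two
      heights with different values of q then contradict a common \<kappa>.\<close>
    have est: "\<bar>\<kappa> - q z\<bar> \<le> C * \<epsilon> / (1 - z\<^sup>2)" if z: "\<bar>z\<bar> < 1" for z
    proof -
      have s: "1 - z\<^sup>2 > 0" using z by (simp add: abs_square_less_1)
      have b: "\<bar>z\<bar> \<le> 1" "\<bar>1 - z\<^sup>2\<bar> \<le> 1" using z s by auto
      then have b': "\<bar>z\<bar> \<le> 100" "\<bar>1 - z\<^sup>2\<bar> \<le> 10000" by linarith+
      have "\<bar>ev (ob \<epsilon> - o0) z (1 - z\<^sup>2)\<bar> \<le> C * \<epsilon>"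
        by (rule order_trans[OF ev_bound[OF b'] t'(9)[OF eps]])
      then have "\<bar>(\<kappa> - q z) * (1 - z\<^sup>2)\<bar> \<le> C * \<epsilon>"
        by (simp add: ev_arith[OF b'] \<kappa>[OF z] q[OF b] algebra_simps)
      then show ?thesis using s by (simp add: abs_mult pos_le_divide_eq)
    qed
    have "\<bar>q z1 - q z2\<bar> \<le> C * \<epsilon> / (1 - z1\<^sup>2) + C * \<epsilon> / (1 - z2\<^sup>2)"
      using est[OF z(1)] est[OF z(2)] by linarith
    also have "\<dots> = D * \<epsilon>" by (simp add: D_def algebra_simps)
    also have "\<dots> \<le> (D + 1) * (\<bar>q z1 - q z2\<bar> / (2 * (D + 1)))"
      using small D0 pos by (intro mult_mono) auto
    also have "\<dots> = \<bar>q z1 - q z2\<bar> / 2" using D0 by (simp add: field_simps)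
    finally show False using z(3) by simp
  qed
  have fin: "real_analytic_on (\<Psi> \<epsilon>) S2 \<and> real_analytic (F \<epsilon>) \<and>
       (\<forall>x\<in>S2. laplace_beltrami (\<Psi> \<epsilon>) x - 4 * \<gamma> * sph_harm 1 0 x = F \<epsilon> (\<Psi> \<epsilon> x)) \<and>
       gevrey_finite (1 / 20) (\<lambda>x. \<beta> * sph_harm 2 0 x + \<gamma> * sph_harm 1 0 x - \<Psi> \<epsilon> x) \<and>
       \<not> zonal (\<Psi> \<epsilon>) \<and> nontrivial (\<Psi> \<epsilon>)" if "\<epsilon> \<in> {0<..\<epsilon>1}" for \<epsilon>
  proof -
    have "\<epsilon> \<in> {0..\<epsilon>0}" using that by (auto simp: \<epsilon>1_def)
    then show ?thesis
      using nt[OF that] nontrivial_not_zonal[OF nt[OF that]] pde gevrey_evS(1)[OF dif]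
      by (auto simp: \<Psi>_def F_def real_analytic_on_evS real_analytic_poly simp del: poly_pCons)
  qed
  have gO: "(\<lambda>\<epsilon>. gevrey_norm (1 / 20) (\<lambda>x. \<beta> * sph_harm 2 0 x + \<gamma> * sph_harm 1 0 x - \<Psi> \<epsilon> x))
      \<in> O[at_right 0](\<lambda>\<epsilon>. \<epsilon>)"
  proof (rule bigoI[where c = "50 * (2 * C + 10000)"], rule eventually_at_rightI[OF _ e0(1)])
    fix \<epsilon> assume "\<epsilon> \<in> {0<..<\<epsilon>0}"
    then have eps: "\<epsilon> \<in> {0..\<epsilon>0}" "\<epsilon> > 0" by auto
    have "0 \<le> gevrey_norm (1 / 20) f" for f
      unfolding gevrey_norm_def by (auto intro!: infsum_nonneg simp: gevrey_weight_def)
    then show "norm (gevrey_norm (1 / 20) (\<lambda>x. \<beta> * sph_harm 2 0 x + \<gamma> * sph_harm 1 0 x - \<Psi> \<epsilon> x)) \<le>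
        50 * (2 * C + 10000) * norm \<epsilon>"
      using gn[OF eps(1)] eps(2) by simp
  qed
  show ?thesis
    using fin gO l2O[of 6] l2O[of 4] e1 unfolding o6 o4 T6_def T4_def
    by (intro exI[of _ 1] exI[of _ "1 / 20"] exI[of _ \<epsilon>1] exI[of _ \<Psi>] exI[of _ F] conjI ballI) simp_all
qed

end
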